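(* Let $\mathsf{H}$ be a finite-dimensional real Hilbert space with norm $\|\cdot\|$, let $\mathsf{f}\in\Gamma_0(\mathsf{H})$, let $\vartheta\in\,]0,+\infty[$, and let $\mathsf{g}\colon\mathsf{H}\to\mathbb{R}$ be a differentiable convex function such that $\nabla\mathsf{g}$ is $\vartheta^{-1}$-Lipschitz continuous on $\mathsf{H}$. Suppose that the set $\mathsf{F}$ of minimizers of $\mathsf{f}+\mathsf{g}$ is nonempty. Let $(\Omega,\mathcal{F},\mathsf{P})$ be a probability space, let $x_0$, $(u_n)_{n\in\mathbb{N}}$, and $(a_n)_{n\in\mathbb{N}}$ be random variables in $L^2(\Omega,\mathcal{F},\mathsf{P};\mathsf{H})$, let $(\lambda_n)_{n\in\mathbb{N}}$ be a sequence in $]0,1]$, let $(\gamma_n)_{n\in\mathbb{N}}$ be a sequence in $]0,2\vartheta[$, and let $(\mathsf{f}_n)_{n\in\mathbb{N}}$ be a sequence of functions in $\Gamma_0(\mathsf{H})$. Let $(x_n)_{n\in\mathbb{N}}$ be generated by $$(\forall n\in\mathbb{N})\quad x_{n+1}=x_n+\lambda_n\big(\operatorname{prox}_{\gamma_n\mathsf{f}_n}(x_n-\gamma_nu_n)+a_n-x_n\big).$$ Let $(\tau_n)_{n\in\mathbb{N}}$ be a sequence in $[0,+\infty[$, and let $\mathscr{X}=(\mathcal{X}_n)_{n\in\mathbb{N}}$ be a sequence of sub-sigma-algebras of $\mathcal{F}$ such that, for every $n\in\mathbb{N}$, $\sigma(x_0,\ldots,x_n)\subset\mathcal{X}_n\subset\mathcal{X}_{n+1}$.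 Suppose that the following are satisfied: (a) $\sum_{n\in\mathbb{N}}\lambda_n\sqrt{\mathsf{E}(\|a_n\|^2\mid\mathcal{X}_n)}<+\infty$ $\mathsf{P}$-a.s. (b) $\sum_{n\in\mathbb{N}}\sqrt{\lambda_n}\,\|\mathsf{E}(u_n\mid\mathcal{X}_n)-\nabla\mathsf{g}(x_n)\|<+\infty$ $\mathsf{P}$-a.s. (c) For every $\mathsf{z}\in\mathsf{F}$, there exists $(\zeta_n(\mathsf{z}))_{n\in\mathbb{N}}\in\ell_+^\infty(\mathscr{X})$ such that $(\lambda_n\zeta_n(\mathsf{z}))_{n\in\mathbb{N}}\in\ell_+^{1/2}(\mathscr{X})$ and $$(\forall n\in\mathbb{N})\quad\mathsf{E}\big(\|u_n-\mathsf{E}(u_n\mid\mathcal{X}_n)\|^2\mid\mathcal{X}_n\big)\leq\tau_n\|\nabla\mathsf{g}(x_n)-\nabla\mathsf{g}(\mathsf{z})\|^2+\zeta_n(\mathsf{z}).$$ (d) There exist sequences $(\alpha_n)_{n\in\mathbb{N}}$ and $(\beta_n)_{n\in\mathbb{N}}$ in $[0,+\infty[$ such that $\sum_{n\in\mathbb{N}}\sqrt{\lambda_n}\,\alpha_n<+\infty$, $\sum_{n\in\mathbb{N}}\lambda_n\beta_n<+\infty$, and $$(\forall n\in\mathbb{N})(\forall\mathsf{x}\in\mathsf{H})\quad\|\operatorname{prox}_{\gamma_n\mathsf{f}_n}\mathsf{x}-\operatorname{prox}_{\gamma_n\mathsf{f}}\mathsf{x}\|\leq\alpha_n\|\mathsf{x}\|+\beta_n.$$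 (e) $\inf_{n\in\mathbb{N}}\gamma_n>0$, $\sup_{n\in\mathbb{N}}\tau_n<+\infty$, and $\sup_{n\in\mathbb{N}}(1+\tau_n)\gamma_n<2\vartheta$. (f) Either $\inf_{n\in\mathbb{N}}\lambda_n>0$, or [there exists $\gamma$ such that $\gamma_n=\gamma$ for every $n\in\mathbb{N}$, $\sum_{n\in\mathbb{N}}\tau_n<+\infty$, and $\sum_{n\in\mathbb{N}}\lambda_n=+\infty$]. Then the following hold for every $\mathsf{z}\in\mathsf{F}$ and for some $\mathsf{F}$-valued random variable $x$: 1. $\sum_{n\in\mathbb{N}}\lambda_n\|\nabla\mathsf{g}(x_n)-\nabla\mathsf{g}(\mathsf{z})\|^2<+\infty$ $\mathsf{P}$-a.s. 2. $\sum_{n\in\mathbb{N}}\lambda_n\big\|x_n-\gamma_n\nabla\mathsf{g}(x_n)-\operatorname{prox}_{\gamma_n\mathsf{f}}\big(x_n-\gamma_n\nabla\mathsf{g}(x_n)\big)+\gamma_n\nabla\mathsf{g}(\mathsf{z})\big\|^2<+\infty$ $\mathsf{P}$-a.s. 3. $(x_n)_{n\in\mathbb{N}}$ converges $\mathsf{P}$-almost surely to $x$.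
   Context: $\Gamma_0(\mathsf{H})$ is the class of proper lower semicontinuous convex functions from $\mathsf{H}$ to $]-\infty,+\infty]$. For $\mathsf{f}\in\Gamma_0(\mathsf{H})$ and $\gamma\in\,]0,+\infty[$, the proximity operator is $\operatorname{prox}_{\gamma\mathsf{f}}\colon\mathsf{x}\mapsto\operatorname{argmin}_{\mathsf{y}\in\mathsf{H}}\big(\mathsf{f}(\mathsf{y})+\frac{1}{2\gamma}\|\mathsf{x}-\mathsf{y}\|^2\big)$. $L^2(\Omega,\mathcal{F},\mathsf{P};\mathsf{H})$ is the space of $\mathsf{H}$-valued random variables $x$ with $\mathsf{E}\|x\|^2<+\infty$. $\sigma(x_0,\ldots,x_n)$ is the smallest sigma-algebra generated by $x_0,\ldots,x_n$. Given $\mathscr{X}=(\mathcal{X}_n)_{n\in\mathbb{N}}$, $\ell_+(\mathscr{X})$ is the set of sequences $(\xi_n)_{n\in\mathbb{N}}$ of $[0,+\infty[$-valued random variables such that $\xi_n$ is $\mathcal{X}_n$-measurable for every $n\in\mathbb{N}$; moreover $$\ell_+^{1/2}(\mathscr{X})=\Big\{(\xi_n)_{n\in\mathbb{N}}\in\ell_+(\mathscr{X})\;\Big|\;\sum_{n\in\mathbb{N}}\xi_n^{1/2}<+\infty\ \mathsf{P}\text{-a.s.}\Big\},\qquad \ell_+^{\infty}(\mathscr{X})=\Big\{(\xi_n)_{n\in\mathbb{N}}\in\ell_+(\mathscr{X})\;\Big|\;\sup_{n\in\mathbb{N}}\xi_n<+\infty\ \mathsf{P}\text{-a.s.}\Big\}.$$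 Relations involving conditional expectations are understood $\mathsf{P}$-almost surely. *)

theory Defs
  imports "HOL-Probability.Probability"
begin

definition proper_fun :: "('h \<Rightarrow> ereal) \<Rightarrow> bool" where
  "proper_fun f \<longleftrightarrow> (\<forall>x. f x \<noteq> -\<infinity>) \<and> (\<exists>x. f x \<noteq> \<infinity>)"

definition lsc_fun :: "('h::topological_space \<Rightarrow> ereal) \<Rightarrow> bool" where
  "lsc_fun f \<longleftrightarrow> (\<forall>x. f x \<le> Liminf (nhds x) f)"

text \<open>The library's \<^const>\<open>convex_on\<close> is for real-valued functions only. The weights are taken in the
  open interval; for functions that avoid \<open>-\<infinity>\<close> the right-hand side is never of the form
  \<open>\<infinity> - \<infinity>\<close>.\<close>

definition convex_fun :: "('h::real_vector \<Rightarrow> ereal) \<Rightarrow> bool" where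
  "convex_fun f \<longleftrightarrow>
     (\<forall>x y. \<forall>t\<in>{0<..<1}. f ((1 - t) *\<^sub>R x + t *\<^sub>R y) \<le> ereal (1 - t) * f x + ereal t * f y)"

definition Gamma0 :: "('h::real_normed_vector \<Rightarrow> ereal) set" where
  "Gamma0 = {f. proper_fun f \<and> lsc_fun f \<and> convex_fun f}"

definition minimizers :: "('h \<Rightarrow> ereal) \<Rightarrow> 'h set" where
  "minimizers h = {x. is_arg_min h (\<lambda>_. True) x}"

text \<open>\<open>prox \<gamma> f\<close> is the proximity operator of \<open>\<gamma> f\<close>. For \<open>\<gamma> > 0\<close> and \<open>f \<in> Gamma0\<close> in finite dimension the
  objective has exactly one minimizer, so the choice made by \<^const>\<open>arg_min\<close> is immaterial.\<close>

definition prox :: "real \<Rightarrow> ('h::real_normed_vector \<Rightarrow> ereal) \<Rightarrow> 'h \<Rightarrow> 'h" where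
  "prox \<gamma> f x = arg_min (\<lambda>y. f y + ereal (1 / (2 * \<gamma>) * (norm (x - y))\<^sup>2)) (\<lambda>_. True)"

definition L2_rv :: "'a measure \<Rightarrow> ('a \<Rightarrow> 'h::euclidean_space) set" where
  "L2_rv M = {X. X \<in> borel_measurable M \<and> integrable M (\<lambda>\<omega>. (norm (X \<omega>))\<^sup>2)}"

definition sigma_upto :: "'a measure \<Rightarrow> (nat \<Rightarrow> 'a \<Rightarrow> 'h::topological_space) \<Rightarrow> nat \<Rightarrow> 'a measure" where
  "sigma_upto M x n = sigma (space M) {x i -` A \<inter> space M | i A. i \<le> n \<and> A \<in> sets borel}"

text \<open>The library only has the conditional expectation of real-valued functions; the vector-valued
  one is taken coordinatewise. The lemmas below show that it has the defining properties of the
  conditional expectation and that these determine it almost surely.\<close>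

definition vec_cond_exp ::
    "'a measure \<Rightarrow> 'a measure \<Rightarrow> ('a \<Rightarrow> 'h::euclidean_space) \<Rightarrow> 'a \<Rightarrow> 'h" where
  "vec_cond_exp M F X \<omega> = (\<Sum>b\<in>Basis. real_cond_exp M F (\<lambda>\<omega>. X \<omega> \<bullet> b) \<omega> *\<^sub>R b)"

lemma vec_cond_exp_inner:
  "b \<in> Basis \<Longrightarrow> vec_cond_exp M F X \<omega> \<bullet> b = real_cond_exp M F (\<lambda>\<omega>. X \<omega> \<bullet> b) \<omega>"
  by (simp add: vec_cond_exp_def)

lemma vec_cond_exp_measurable: "vec_cond_exp M F X \<in> borel_measurable F"
  unfolding vec_cond_exp_def[abs_def] by measurable

context
  fixes M F :: "'a measure" and X :: "'a \<Rightarrow> 'h::euclidean_space"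
  assumes M: "prob_space M" and F: "subalgebra M F" and X: "integrable M X"
begin

interpretation sigma_finite_subalgebra M F
  using M F by (intro finite_measure_subalgebra_is_sigma_finite)
    (simp add: finite_measure_subalgebra_def finite_measure_subalgebra_axioms_def
      prob_space.finite_measure)

lemma vec_cond_exp_integrable: "integrable M (vec_cond_exp M F X)"
  unfolding vec_cond_exp_def[abs_def] using X
  by (intro Bochner_Integration.integrable_sum integrable_scaleR_left real_cond_exp_int
      integrable_inner_left) auto

lemma vec_cond_exp_set_integral:
  assumes A: "A \<in> sets F"
  shows "(LINT \<omega>:A|M. vec_cond_exp M F X \<omega>) = (LINT \<omega>:A|M. X \<omega>)"
proof (rule euclidean_eqI)
  fix b :: 'h assume b: "b \<in> Basis"
  have AM: "A \<in> sets M" using A F by (auto simp: subalgebra_def)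
  have coord: "(LINT \<omega>:A|M. Y \<omega>) \<bullet> b = (LINT \<omega>:A|M. Y \<omega> \<bullet> b)" if "integrable M Y" for Y :: "'a \<Rightarrow> 'h"
    using integrable_mult_indicator[OF AM that] unfolding set_lebesgue_integral_def
    by (subst integral_inner_left[symmetric]) auto
  have "(LINT \<omega>:A|M. vec_cond_exp M F X \<omega> \<bullet> b) = (LINT \<omega>:A|M. X \<omega> \<bullet> b)"
    using X b A by (simp add: vec_cond_exp_inner real_cond_exp_intA[symmetric])
  then show "(LINT \<omega>:A|M. vec_cond_exp M F X \<omega>) \<bullet> b = (LINT \<omega>:A|M. X \<omega>) \<bullet> b"
    by (simp add: coord X vec_cond_exp_integrable)
qed

lemma vec_cond_exp_unique:
  assumes Y: "integrable M Y" "Y \<in> borel_measurable F"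
    and eq: "\<And>A. A \<in> sets F \<Longrightarrow> (LINT \<omega>:A|M. Y \<omega>) = (LINT \<omega>:A|M. X \<omega>)"
  shows "AE \<omega> in M. Y \<omega> = vec_cond_exp M F X \<omega>"
proof -
  have "AE \<omega> in M. real_cond_exp M F (\<lambda>\<omega>. X \<omega> \<bullet> b) \<omega> = Y \<omega> \<bullet> b" for b
  proof (rule real_cond_exp_charact)
    fix A assume A: "A \<in> sets F"
    have AM: "A \<in> sets M" using A F by (auto simp: subalgebra_def)
    have coord: "(LINT \<omega>:A|M. Z \<omega>) \<bullet> b = (LINT \<omega>:A|M. Z \<omega> \<bullet> b)" if "integrable M Z" for Z :: "'a \<Rightarrow> 'h"
      using integrable_mult_indicator[OF AM that] unfolding set_lebesgue_integral_def
      by (subst integral_inner_left[symmetric]) auto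
    show "(LINT \<omega>:A|M. X \<omega> \<bullet> b) = (LINT \<omega>:A|M. Y \<omega> \<bullet> b)"
      using eq[OF A] by (simp add: coord[symmetric] X Y)
  qed (use X Y in auto)
  then have "AE \<omega> in M. \<forall>b\<in>Basis. real_cond_exp M F (\<lambda>\<omega>. X \<omega> \<bullet> b) \<omega> = Y \<omega> \<bullet> b"
    by (intro AE_finite_allI) auto
  then show ?thesis
    by eventually_elim (rule euclidean_eqI, simp add: vec_cond_exp_inner)
qed

end

definition ell_plus :: "'a measure \<Rightarrow> (nat \<Rightarrow> 'a measure) \<Rightarrow> (nat \<Rightarrow> 'a \<Rightarrow> real) set" where
  "ell_plus M \<X> = {\<xi>. \<forall>n. \<xi> n \<in> borel_measurable (\<X> n) \<and> (\<forall>\<omega>\<in>space M. 0 \<le> \<xi> n \<omega>)}"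

definition ell_plus_half :: "'a measure \<Rightarrow> (nat \<Rightarrow> 'a measure) \<Rightarrow> (nat \<Rightarrow> 'a \<Rightarrow> real) set" where
  "ell_plus_half M \<X> = {\<xi> \<in> ell_plus M \<X>. AE \<omega> in M. summable (\<lambda>n. sqrt (\<xi> n \<omega>))}"

definition ell_plus_infty :: "'a measure \<Rightarrow> (nat \<Rightarrow> 'a measure) \<Rightarrow> (nat \<Rightarrow> 'a \<Rightarrow> real) set" where
  "ell_plus_infty M \<X> = {\<xi> \<in> ell_plus M \<X>. AE \<omega> in M. bdd_above (range (\<lambda>n. \<xi> n \<omega>))}"

end

theory Submission
  imports Defs
begin

text \<open>
  Fix a minimizer \<open>z\<close> and let \<open>r\<^sub>n\<close> be the residual in the second claim. One iteration is a perturbed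
  relaxation of the forward-backward map, of which \<open>z\<close> is a fixed point. Conditionally on the past,
  it decreases the squared distance to \<open>z\<close> by a multiple of
  \<open>\<lambda>\<^sub>n (\<parallel>\<nabla>g(x\<^sub>n) - \<nabla>g(z)\<parallel>\<^sup>2 + \<parallel>r\<^sub>n\<parallel>\<^sup>2)\<close>, up to errors: cocoercivity of \<open>\<nabla>g\<close> (\<open>baillon_haddad\<close>) yields
  the gradient term, firm nonexpansiveness of the proximity operator yields the residual term, and the
  gap between \<open>sup (1 + \<tau>\<^sub>n) \<gamma>\<^sub>n\<close> and \<open>2\<theta>\<close> pays for the part of the conditional variance of \<open>u\<^sub>n\<close> that grows
  with the gradient term.

  Every error (that of the stochastic gradient, its bias, and that of the approximate proximity
  operator) is dominated by one sequence \<open>e\<^sub>n\<close> that is known at time \<open>n\<close> and summable almost surely.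
  Splitting off the perturbation by Young's inequality with the random weight \<open>e\<^sub>n\<close>, and putting
  \<open>V\<^sub>n = 1 + \<parallel>x\<^sub>n - z\<parallel>\<^sup>2\<close>, where the summand 1 absorbs the additive errors, gives
  \<open>E(V\<^sub>n\<^sub>+\<^sub>1 | \<X>\<^sub>n) + W\<^sub>n \<le> (1 + \<delta>\<^sub>n) V\<^sub>n\<close> with \<open>\<Sum> \<delta>\<^sub>n < \<infinity>\<close> (\<open>conditional_step_inequality\<close>). The
  theorem of Robbins and Siegmund (\<open>robbins_siegmund\<close>), which is reduced to the convergence of
  nonnegative supermartingales and hence to Doob's upcrossing argument, now shows that \<open>\<Sum> W\<^sub>n < \<infinity>\<close>,
  which is the first two claims, and that \<open>\<parallel>x\<^sub>n - z\<parallel>\<close> converges almost surely.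

  For the convergence of \<open>x\<^sub>n\<close>, both alternatives of the last hypothesis force \<open>\<Sum> \<lambda>\<^sub>n = \<infinity>\<close>, so on almost
  every path both decrease terms vanish along a subsequence. The path is bounded, so a further
  subsequence converges to some \<open>y\<close>, and the closedness of the graph of the subdifferential makes \<open>y\<close> a
  minimizer (\<open>forward_backward_cluster_point\<close>). Almost surely the distances to all points of a
  countable dense set of minimizers converge, and then a single cluster point among the minimizers is
  already the limit of the whole path (\<open>converges_to_cluster_point\<close>).
\<close>

section \<open>Lower semicontinuous convex functions and the proximity operator\<close>

lemma lsc_fun_liminf:
  assumes "lsc_fun f" and "y \<longlonglongrightarrow> p"
  shows "f p \<le> liminf (\<lambda>n. f (y n))"
proof -
  have "eventually (\<lambda>n. c < f (y n)) sequentially" if "c < f p" for c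
  proof -
    have "eventually (\<lambda>x. c < f x) (nhds p)"
      using assms(1) that by (auto simp: lsc_fun_def le_Liminf_iff)
    then show ?thesis
      using assms(2) by (rule eventually_compose_filterlim)
  qed
  then show ?thesis
    by (simp add: le_Liminf_iff)
qed

text \<open>The direct method: a minimizing sequence has a convergent subsequence, along which \<open>f\<close> can only
  drop in the limit.\<close>

lemma lsc_attains_min_on_compact:
  fixes f :: "'h::metric_space \<Rightarrow> ereal" and k :: "'h \<Rightarrow> real"
  assumes f: "lsc_fun f" and k: "continuous_on UNIV k" and K: "compact K" "K \<noteq> {}"
  obtains p where "p \<in> K" "\<And>q. q \<in> K \<Longrightarrow> f p + ereal (k p) \<le> f q + ereal (k q)"
proof -
  let ?h = "\<lambda>x. f x + ereal (k x)"
  obtain v where v: "\<And>n. v n \<in> ?h ` K" and v_lim: "v \<longlonglongrightarrow> Inf (?h ` K)"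
    using Inf_as_limit[of "?h ` K"] K(2) by auto
  have "\<exists>w. \<forall>n. w n \<in> K \<and> v n = ?h (w n)"
    using v by (intro choice) auto
  then obtain w where w: "\<And>n. w n \<in> K" "\<And>n. v n = ?h (w n)"
    by blast
  obtain p r where p: "p \<in> K" and r: "strict_mono r" and wr: "(w \<circ> r) \<longlonglongrightarrow> p"
    using K(1) w(1) unfolding compact_def by metis
  have kr: "(\<lambda>n. ereal (k (w (r n)))) \<longlonglongrightarrow> ereal (k p)"
    using continuous_on_tendsto_compose[OF k wr] by (simp add: o_def)
  have "?h p \<le> ereal (k p) + liminf (\<lambda>n. f (w (r n)))"
    using lsc_fun_liminf[OF f wr] by (subst add.commute) (intro add_left_mono, simp add: o_def)
  also have "\<dots> = liminf (\<lambda>n. ereal (k (w (r n))) + f (w (r n)))"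
    by (rule ereal_liminf_lim_add[OF kr, symmetric]) simp
  also have "\<dots> = liminf (v \<circ> r)"
    by (simp add: w(2) o_def add.commute)
  also have "\<dots> = Inf (?h ` K)"
    by (rule lim_imp_Liminf) (use LIMSEQ_subseq_LIMSEQ[OF v_lim r] in auto)
  finally have "\<And>q. q \<in> K \<Longrightarrow> ?h p \<le> ?h q"
    by (meson INF_lower order_trans)
  with p that show ?thesis by blast
qed

text \<open>On the unit ball about \<open>x0\<close> the function is bounded below by compactness. A point outside can be
  pulled back to the unit sphere along the segment to \<open>x0\<close>, and convexity then forbids a decrease
  that is faster than linear.\<close>

lemma Gamma0_linear_lower_bound:
  fixes f :: "'h::euclidean_space \<Rightarrow> ereal"
  assumes f: "f \<in> Gamma0" and x0: "f x0 = ereal c"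
  obtains K where "K \<ge> 0" "\<And>y. norm (y - x0) \<ge> 1 \<Longrightarrow> ereal (c - K * norm (y - x0)) \<le> f y"
proof -
  have ninf: "\<And>y. f y \<noteq> -\<infinity>" and lsc: "lsc_fun f" and conv: "convex_fun f"
    using f by (auto simp: Gamma0_def proper_fun_def)
  obtain p where p: "\<And>q. q \<in> cball x0 1 \<Longrightarrow> f p \<le> f q"
    using lsc_attains_min_on_compact[OF lsc, of "\<lambda>_. 0" "cball x0 1"]
    by (auto simp flip: zero_ereal_def)
  obtain m where m: "f p = ereal m" 
    using p[of x0] ninf[of p] x0 by (cases "f p") auto
  have "m \<le> c" using p[of x0] m x0 by simp
  have "ereal (c - (c - m) * norm (y - x0)) \<le> f y" if d: "norm (y - x0) \<ge> 1" for y
  proof (cases "f y")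
    case (real v)
    show ?thesis
    proof (cases "norm (y - x0) = 1")
      case True
      have "f p \<le> f y" by (rule p) (use True in \<open>simp add: dist_norm norm_minus_commute\<close>)
      then show ?thesis using True m real by simp
    next
      case False
      define t where "t = 1 / norm (y - x0)"
      have t: "t \<in> {0<..<1}" using d False by (auto simp: t_def divide_less_eq_1)
      have tn: "t * norm (y - x0) = 1" using d by (auto simp: t_def)
      have "(1 - t) *\<^sub>R x0 + t *\<^sub>R y - x0 = t *\<^sub>R (y - x0)" by (simp add: algebra_simps)
      then have "norm ((1 - t) *\<^sub>R x0 + t *\<^sub>R y - x0) = 1" 
        using t tn by simp
      then have "(1 - t) *\<^sub>R x0 + t *\<^sub>R y \<in> cball x0 1"
        by (simp add: dist_norm norm_minus_commute)
      then have "f p \<le> f ((1 - t) *\<^sub>R x0 + t *\<^sub>R y)" by (rule p)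
      also have "\<dots> \<le> ereal (1 - t) * f x0 + ereal t * f y"
        using conv t unfolding convex_fun_def by blast
      finally have "m \<le> (1 - t) * c + t * v" using m real x0 by simp
      then have "c - (c - m) / t \<le> v" using t by (auto simp: field_simps)
      then show ?thesis using real d by (simp add: t_def)
    qed
  qed (use ninf[of y] in auto)
  then show ?thesis using that[of "c - m"] \<open>m \<le> c\<close> by simp
qed

text \<open>The quadratic term outgrows the linear lower bound of \<open>f\<close>, so that the search for a minimizer can
  be confined to a ball.\<close>

lemma prox_objective_has_minimizer:
  fixes f :: "'h::euclidean_space \<Rightarrow> ereal"
  assumes f: "f \<in> Gamma0" and c: "c > 0"
  obtains p where "\<And>q. f p + ereal (c * (norm (x - p))\<^sup>2) \<le> f q + ereal (c * (norm (x - q))\<^sup>2)"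
proof -
  have ninf: "\<And>y. f y \<noteq> -\<infinity>" and lsc: "lsc_fun f"
    using f by (auto simp: Gamma0_def proper_fun_def)
  obtain x0 a where x0: "f x0 = ereal a"
    using f ninf by (auto simp: Gamma0_def proper_fun_def) (metis ereal_cases)
  obtain K where K: "K \<ge> 0" "\<And>y. norm (y - x0) \<ge> 1 \<Longrightarrow> ereal (a - K * norm (y - x0)) \<le> f y"
    using Gamma0_linear_lower_bound[OF f x0] by blast
  \<comment> \<open>chosen such that \<open>c * d\<^sup>2 - 2 * c * d * norm (x - x0)\<close> is at least the linear loss \<open>K * d\<close> for all \<open>d \<ge> R\<close>\<close>
  define R where "R = max 1 (2 * norm (x - x0) + K / c)"
  obtain p where p: "p \<in> cball x0 R"
    "\<And>q. q \<in> cball x0 R \<Longrightarrow> f p + ereal (c * (norm (x - p))\<^sup>2) \<le> f q + ereal (c * (norm (x - q))\<^sup>2)"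
    by (rule lsc_attains_min_on_compact[OF lsc, of "\<lambda>y. c * (norm (x - y))\<^sup>2" "cball x0 R"])
      (auto intro!: continuous_intros simp: R_def)
  have "f p + ereal (c * (norm (x - p))\<^sup>2) \<le> f q + ereal (c * (norm (x - q))\<^sup>2)" for q
  proof (cases "q \<in> cball x0 R")
    case False
    define d where "d = norm (q - x0)"
    have d: "d \<ge> 1" "d \<ge> 2 * norm (x - x0) + K / c"
      using False by (auto simp: R_def d_def dist_norm norm_minus_commute)
    have "norm (x - q) \<ge> d - norm (x - x0)"
      unfolding d_def by (smt (verit, ccfv_SIG) dist_commute dist_norm dist_triangle)
    moreover have "d - norm (x - x0) \<ge> 0"
      using d K(1) c by (smt (verit) divide_nonneg_pos norm_ge_zero)
    ultimately have "(norm (x - q))\<^sup>2 \<ge> (d - norm (x - x0))\<^sup>2"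
      by (rule power_mono)
    then have 1: "c * (norm (x - q))\<^sup>2 \<ge> c * (d - norm (x - x0))\<^sup>2"
      using c by simp
    have "d * (c * d - 2 * c * norm (x - x0) - K) \<ge> 0"
      using d c by (intro mult_nonneg_nonneg) (auto simp: field_simps)
    with 1 have "a + c * (norm (x - x0))\<^sup>2 \<le> (a - K * d) + c * (norm (x - q))\<^sup>2"
      by (simp add: power2_eq_square algebra_simps)
    moreover have "ereal (a - K * d) \<le> f q" using K(2)[of q] d by (simp add: d_def)
    moreover have "f p + ereal (c * (norm (x - p))\<^sup>2) \<le> f x0 + ereal (c * (norm (x - x0))\<^sup>2)"
      by (rule p(2)) (simp add: R_def)
    ultimately show ?thesis using x0 by (cases "f q"; cases "f p") auto
  qed (use p in auto)
  then show ?thesis by (rule that)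
qed

text \<open>The first conjunct confines subgradients to points of the effective domain. Without it every
  vector would be a subgradient at a point with value \<open>-\<infinity>\<close>.\<close>

definition subgradient :: "('h::real_inner \<Rightarrow> ereal) \<Rightarrow> 'h \<Rightarrow> 'h \<Rightarrow> bool" where
  "subgradient f p v \<longleftrightarrow> \<bar>f p\<bar> \<noteq> \<infinity> \<and> (\<forall>q. f p + ereal (inner v (q - p)) \<le> f q)"

lemma subgradient_monotone:
  assumes "subgradient f p v" "subgradient f q w"
  shows "inner (v - w) (p - q) \<ge> 0"
proof -
  have "f p + ereal (inner v (q - p)) \<le> f q" "f q + ereal (inner w (p - q)) \<le> f p"
    "\<bar>f p\<bar> \<noteq> \<infinity>" "\<bar>f q\<bar> \<noteq> \<infinity>"
    using assms by (auto simp: subgradient_def)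
  then have "inner v (q - p) + inner w (p - q) \<le> 0"
    by (cases "f p"; cases "f q") auto
  then show ?thesis by (simp add: inner_diff_left inner_diff_right)
qed

text \<open>The graph of the subdifferential is closed: lower semicontinuity passes to the limit on the larger
  side of the subgradient inequality at each fixed \<open>q\<close>, and properness keeps the limit point in the
  domain.\<close>

lemma subgradient_limit:
  fixes f :: "'h::real_inner \<Rightarrow> ereal"
  assumes f: "proper_fun f" "lsc_fun f" and sub: "\<And>n. subgradient f (p n) (v n)"
    and p: "p \<longlonglongrightarrow> p'" and v: "v \<longlonglongrightarrow> v'"
  shows "subgradient f p' v'"
proof -
  have ninf: "\<And>y. f y \<noteq> -\<infinity>" using f by (auto simp: proper_fun_def)
  have le: "f p' + ereal (inner v' (q - p')) \<le> f q" for q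
  proof (cases "f q")
    case (real c)
    have "f (p n) \<le> ereal (c - inner (v n) (q - p n))" for n
    proof -
      have "f (p n) + ereal (inner (v n) (q - p n)) \<le> ereal c"
        using sub[of n] real unfolding subgradient_def by metis
      then show ?thesis by (cases "f (p n)") auto
    qed
    then have "liminf (\<lambda>n. f (p n)) \<le> liminf (\<lambda>n. ereal (c - inner (v n) (q - p n)))"
      by (intro Liminf_mono) simp
    moreover have "(\<lambda>n. ereal (c - inner (v n) (q - p n))) \<longlonglongrightarrow> ereal (c - inner v' (q - p'))"
      by (intro tendsto_intros p v)
    then have "liminf (\<lambda>n. ereal (c - inner (v n) (q - p n))) = ereal (c - inner v' (q - p'))"
      by (intro lim_imp_Liminf) auto
    ultimately have "f p' \<le> ereal (c - inner v' (q - p'))"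
      using lsc_fun_liminf[OF f(2) p] by simp
    then show ?thesis using real by (cases "f p'") auto
  qed (use ninf[of q] in auto)
  obtain q where "f q \<noteq> \<infinity>" using f by (auto simp: proper_fun_def)
  with le[of q] ninf[of p'] have "\<bar>f p'\<bar> \<noteq> \<infinity>" by (cases "f p'") auto
  with le show ?thesis by (auto simp: subgradient_def)
qed

lemma GDERIV_along_line:
  assumes "GDERIV h p :> d"
  shows "((\<lambda>t. h (p + t *\<^sub>R e)) has_real_derivative inner e d) (at 0)"
proof -
  have "((\<lambda>t. p + t *\<^sub>R e) has_derivative (\<lambda>t. t *\<^sub>R e)) (at 0)"
    by (auto intro!: derivative_eq_intros)
  moreover have "(h has_derivative (\<lambda>k. inner k d)) (at (p + 0 *\<^sub>R e))"
    using assms by (simp add: gderiv_def)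
  ultimately have "(h \<circ> (\<lambda>t. p + t *\<^sub>R e) has_derivative (\<lambda>k. inner k d) \<circ> (\<lambda>t. t *\<^sub>R e)) (at 0)"
    by (rule diff_chain_at)
  then show ?thesis
    by (simp add: has_field_derivative_def o_def mult.commute mult_commute_abs)
qed

text \<open>Fermat's rule with a smooth summand. Minimality is tested on the segment from \<open>p\<close> to \<open>q\<close>, where
  convexity bounds the increase of \<open>f\<close> linearly, and the difference quotient of \<open>h\<close> tends to the
  directional derivative.\<close>

lemma subgradient_of_minimizer:
  fixes f :: "'h::real_inner \<Rightarrow> ereal"
  assumes f: "proper_fun f" "convex_fun f" and h: "GDERIV h p :> d"
    and min: "\<And>q. f p + ereal (h p) \<le> f q + ereal (h q)"
  shows "subgradient f p (- d)"
proof -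
  have ninf: "\<And>y. f y \<noteq> -\<infinity>" using f by (auto simp: proper_fun_def)
  obtain x0 a where x0: "f x0 = ereal a"
    using f ninf by (auto simp: proper_fun_def) (metis ereal_cases)
  obtain fp where fp: "f p = ereal fp"
    using min[of x0] x0 ninf[of p] by (cases "f p") auto
  have "f p + ereal (inner (- d) (q - p)) \<le> f q" for q
  proof (cases "f q")
    case (real fq)
    have "fp - fq \<le> (h (p + t *\<^sub>R (q - p)) - h p) / t" if t: "0 < t" "t < 1" for t
    proof -
      have eq: "(1 - t) *\<^sub>R p + t *\<^sub>R q = p + t *\<^sub>R (q - p)" by (simp add: algebra_simps)
      have "f (p + t *\<^sub>R (q - p)) \<le> ereal (1 - t) * f p + ereal t * f q"
        using f(2) t unfolding convex_fun_def eq[symmetric] by simp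
      then have "f (p + t *\<^sub>R (q - p)) \<le> ereal ((1 - t) * fp + t * fq)" using fp real by simp
      with min[of "p + t *\<^sub>R (q - p)"] have "fp + h p \<le> (1 - t) * fp + t * fq + h (p + t *\<^sub>R (q - p))"
        using fp by (cases "f (p + t *\<^sub>R (q - p))") auto
      then show ?thesis using t by (simp add: field_simps)
    qed
    then have "\<forall>\<^sub>F t in at_right 0. fp - fq \<le> (h (p + t *\<^sub>R (q - p)) - h p) / t"
      unfolding eventually_at_right_field by (intro exI[of _ 1]) auto
    moreover have "((\<lambda>t. (h (p + t *\<^sub>R (q - p)) - h p) / t) \<longlongrightarrow> inner (q - p) d) (at 0)"
      using GDERIV_along_line[OF h, of "q - p"] by (simp add: has_field_derivative_iff)
    then have "((\<lambda>t. (h (p + t *\<^sub>R (q - p)) - h p) / t) \<longlongrightarrow> inner (q - p) d) (at_right 0)"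
      by (rule filterlim_mono) (auto simp: at_le)
    ultimately have "fp - fq \<le> inner (q - p) d"
      by (intro tendsto_lowerbound) auto
    then show ?thesis using fp real by (simp add: inner_commute)
  qed (use ninf[of q] in auto)
  then show ?thesis using fp by (auto simp: subgradient_def)
qed

lemma prox_subgradient:
  fixes f :: "'h::euclidean_space \<Rightarrow> ereal"
  assumes f: "f \<in> Gamma0" and \<gamma>: "\<gamma> > 0"
  shows "subgradient f (prox \<gamma> f x) ((x - prox \<gamma> f x) /\<^sub>R \<gamma>)"
proof -
  let ?h = "\<lambda>y. 1 / (2 * \<gamma>) * (norm (x - y))\<^sup>2"
  let ?p = "prox \<gamma> f x"
  have "\<exists>p. is_arg_min (\<lambda>y. f y + ereal (?h y)) (\<lambda>_. True) p"
  proof -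
    obtain p where "\<And>q. f p + ereal (?h p) \<le> f q + ereal (?h q)"
      using prox_objective_has_minimizer[OF f, of "1 / (2 * \<gamma>)" x] \<gamma> by auto
    then show ?thesis by (auto simp: is_arg_min_linorder)
  qed
  then have "is_arg_min (\<lambda>y. f y + ereal (?h y)) (\<lambda>_. True) ?p"
    unfolding prox_def arg_min_def by (rule someI_ex)
  then have min: "f ?p + ereal (?h ?p) \<le> f q + ereal (?h q)" for q
    by (simp add: is_arg_min_linorder)
  have "GDERIV ?h ?p :> - ((x - ?p) /\<^sub>R \<gamma>)"
    unfolding gderiv_def power2_norm_eq_inner
    by (rule derivative_eq_intros refl)+
      (use \<gamma> in \<open>auto simp: inner_commute field_simps inner_diff_left inner_diff_right\<close>)
  from subgradient_of_minimizer[OF _ _ this min] f show ?thesis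
    by (simp add: Gamma0_def)
qed

text \<open>Both prox points come with a subgradient, and the subdifferential is monotone.\<close>

lemma prox_firmly_nonexpansive:
  fixes f :: "'h::euclidean_space \<Rightarrow> ereal"
  assumes "f \<in> Gamma0" "\<gamma> > 0"
  shows "inner (prox \<gamma> f x - prox \<gamma> f y) (x - y) \<ge> (norm (prox \<gamma> f x - prox \<gamma> f y))\<^sup>2"
proof -
  let ?p = "prox \<gamma> f x" and ?q = "prox \<gamma> f y"
  have "0 \<le> inner ((x - ?p) /\<^sub>R \<gamma> - (y - ?q) /\<^sub>R \<gamma>) (?p - ?q)"
    by (rule subgradient_monotone[OF prox_subgradient[OF assms] prox_subgradient[OF assms]])
  also have "\<dots> = inner ((x - y) - (?p - ?q)) (?p - ?q) / \<gamma>"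
    by (simp add: algebra_simps divide_inverse)
  finally have "0 \<le> inner ((x - y) - (?p - ?q)) (?p - ?q)"
    using assms(2) by (simp add: zero_le_divide_iff)
  then show ?thesis
    by (simp add: power2_norm_eq_inner inner_diff_left inner_diff_right inner_commute)
qed

lemma prox_nonexpansive:
  fixes f :: "'h::euclidean_space \<Rightarrow> ereal"
  assumes "f \<in> Gamma0" "\<gamma> > 0"
  shows "norm (prox \<gamma> f x - prox \<gamma> f y) \<le> norm (x - y)"
proof -
  have "norm (prox \<gamma> f x - prox \<gamma> f y) * norm (prox \<gamma> f x - prox \<gamma> f y)
      \<le> norm (prox \<gamma> f x - prox \<gamma> f y) * norm (x - y)"
    using prox_firmly_nonexpansive[OF assms, of x y] norm_cauchy_schwarz
    by (metis order_trans power2_eq_square)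
  then show ?thesis
    by (metis mult_le_cancel_left_pos norm_ge_zero order_le_less)
qed

lemma prox_lipschitz:
  fixes f :: "'h::euclidean_space \<Rightarrow> ereal"
  assumes "f \<in> Gamma0" "\<gamma> > 0"
  shows "1-lipschitz_on UNIV (prox \<gamma> f)"
  using prox_nonexpansive[OF assms] by (intro lipschitz_onI) (auto simp: dist_norm)

text \<open>Firm nonexpansiveness is symmetric under passing to the complement \<open>x \<mapsto> x - prox \<gamma> f x\<close>. This is
  what allows the argument of a residual to be changed at the price of the change itself.\<close>

lemma prox_complement_nonexpansive:
  fixes f :: "'h::euclidean_space \<Rightarrow> ereal"
  assumes "f \<in> Gamma0" "\<gamma> > 0"
  shows "norm ((x - prox \<gamma> f x) - (y - prox \<gamma> f y)) \<le> norm (x - y)"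
proof -
  let ?p = "prox \<gamma> f x" and ?q = "prox \<gamma> f y"
  have "(x - ?p) - (y - ?q) = (x - y) - (?p - ?q)" by simp
  then have "(norm ((x - ?p) - (y - ?q)))\<^sup>2 = (norm (x - y))\<^sup>2 - 2 * inner (?p - ?q) (x - y) + (norm (?p - ?q))\<^sup>2"
    by (simp only: power2_norm_eq_inner) (simp add: algebra_simps inner_commute)
  also have "\<dots> \<le> (norm (x - y))\<^sup>2"
    using prox_firmly_nonexpansive[OF assms, of x y] zero_le_power2[of "norm (?p - ?q)"] by linarith
  finally show ?thesis by (simp add: power2_le_iff_abs_le)
qed

text \<open>With \<open>v = - \<nabla>g(p)\<close> this turns the optimality condition for \<open>f + g\<close> into the fixed point equation
  of the forward-backward map.\<close>

lemma prox_eqI_subgradient: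
  fixes f :: "'h::euclidean_space \<Rightarrow> ereal"
  assumes "f \<in> Gamma0" "\<gamma> > 0" "subgradient f p v"
  shows "prox \<gamma> f (p + \<gamma> *\<^sub>R v) = p"
proof -
  let ?q = "prox \<gamma> f (p + \<gamma> *\<^sub>R v)"
  have "0 \<le> inner ((p + \<gamma> *\<^sub>R v - ?q) /\<^sub>R \<gamma> - v) (?q - p)"
    by (rule subgradient_monotone[OF prox_subgradient[OF assms(1,2)] assms(3)])
  also have "(p + \<gamma> *\<^sub>R v - ?q) /\<^sub>R \<gamma> - v = (- 1 / \<gamma>) *\<^sub>R (?q - p)"
    using assms(2) by (simp add: algebra_simps divide_inverse)
  finally have "(norm (?q - p))\<^sup>2 \<le> 0"
    using assms(2) by (simp add: power2_norm_eq_inner divide_simps del: inner_eq_zero_iff)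
  then show ?thesis by simp
qed

section \<open>Convex functions with Lipschitz gradient\<close>

lemma convex_gradient_inequality:
  fixes g :: "'h::real_inner \<Rightarrow> real"
  assumes g: "convex_on UNIV g" and "GDERIV g y :> d"
  shows "g y + inner d (q - y) \<le> g q"
proof -
  let ?k = "\<lambda>t. g (y + t *\<^sub>R (q - y))"
  have "convex_on UNIV ?k"
  proof (rule convex_onI)
    fix t s s' :: real assume t: "0 < t" "t < 1"
    have eq: "y + ((1 - t) *\<^sub>R s + t *\<^sub>R s') *\<^sub>R (q - y) = (1 - t) *\<^sub>R (y + s *\<^sub>R (q - y)) + t *\<^sub>R (y + s' *\<^sub>R (q - y))"
      by (simp add: algebra_simps)
    show "?k ((1 - t) *\<^sub>R s + t *\<^sub>R s') \<le> (1 - t) * ?k s + t * ?k s'"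
      unfolding eq using convex_onD[OF g, of t] t by simp
  qed simp
  from convex_on_imp_above_tangent[OF this, of 0 1 "inner (q - y) d"]
  show ?thesis using GDERIV_along_line[OF assms(2), of "q - y"]
    by (simp add: inner_commute)
qed

text \<open>Along the segment from \<open>y\<close> to \<open>y + e\<close> the difference of the two sides has a derivative of constant
  sign, by the Lipschitz bound and the Cauchy-Schwarz inequality.\<close>

lemma descent_lemma:
  fixes g :: "'h::real_inner \<Rightarrow> real"
  assumes g: "\<And>y. GDERIV g y :> G y" and L: "L-lipschitz_on UNIV G"
  shows "g (y + e) \<le> g y + inner (G y) e + L / 2 * (norm e)\<^sup>2"
proof -
  let ?k = "\<lambda>t. g (y + t *\<^sub>R e) - t * inner (G y) e - L / 2 * t\<^sup>2 * (norm e)\<^sup>2"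
  have D: "(?k has_real_derivative inner (G (y + t *\<^sub>R e)) e - inner (G y) e - L * t * (norm e)\<^sup>2) (at t)" for t
  proof -
    have "((\<lambda>s. g (y + (t + s) *\<^sub>R e)) has_real_derivative inner e (G (y + t *\<^sub>R e))) (at 0)"
      using GDERIV_along_line[OF g[of "y + t *\<^sub>R e"], of e] by (simp add: algebra_simps)
    then have "((\<lambda>s. g (y + s *\<^sub>R e)) has_real_derivative inner e (G (y + t *\<^sub>R e))) (at t)"
      using DERIV_shift[of "\<lambda>s. g (y + s *\<^sub>R e)" _ 0 t] by (simp add: add.commute)
    then show ?thesis
      by (auto intro!: derivative_eq_intros simp: inner_commute)
  qed
  have "?k 1 \<le> ?k 0"
  proof (rule DERIV_nonpos_imp_nonincreasing[where f = ?k])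
    fix t :: real assume t: "0 \<le> t" "t \<le> 1"
    have "inner (G (y + t *\<^sub>R e) - G y) e \<le> norm (G (y + t *\<^sub>R e) - G y) * norm e"
      by (rule norm_cauchy_schwarz)
    also have "\<dots> \<le> (L * norm (t *\<^sub>R e)) * norm e"
      using lipschitz_onD[OF L, of "y + t *\<^sub>R e" y] by (intro mult_right_mono) (auto simp: dist_norm)
    finally have "inner (G (y + t *\<^sub>R e)) e - inner (G y) e - L * t * (norm e)\<^sup>2 \<le> 0"
      using t by (simp add: inner_diff_left power2_eq_square)
    with D show "\<exists>z. (?k has_real_derivative z) (at t) \<and> z \<le> 0" by blast
  qed simp
  then show ?thesis by (simp add: algebra_simps)
qed

text \<open>A gradient step of length \<open>\<theta>\<close> from \<open>b\<close>, taken for \<open>g\<close> minus its tangent at \<open>a\<close>, decreases that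
  function by \<open>\<theta>/2 \<parallel>G b - G a\<parallel>\<^sup>2\<close> according to the descent lemma, and yet cannot lead below its minimum
  at \<open>a\<close>. Adding the resulting inequality to its mirror image gives cocoercivity.\<close>

lemma baillon_haddad:
  fixes g :: "'h::real_inner \<Rightarrow> real"
  assumes \<theta>: "\<theta> > 0" and conv: "convex_on UNIV g" and g: "\<And>y. GDERIV g y :> G y"
    and L: "(1 / \<theta>)-lipschitz_on UNIV G"
  shows "inner (x - y) (G x - G y) \<ge> \<theta> * (norm (G x - G y))\<^sup>2"
proof -
  have *: "g a + inner (G a) (b - a) + \<theta> / 2 * (norm (G b - G a))\<^sup>2 \<le> g b" for a b
  proof -
    \<comment> \<open>minimizes the upper bound that the descent lemma gives for \<open>g\<close> minus its tangent at \<open>a\<close>\<close>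
    let ?e = "- \<theta> *\<^sub>R (G b - G a)"
    have "g a + inner (G a) (b + ?e - a) \<le> g (b + ?e)"
      by (rule convex_gradient_inequality[OF conv g])
    also have "\<dots> \<le> g b + inner (G b) ?e + (1 / \<theta>) / 2 * (norm ?e)\<^sup>2"
      by (rule descent_lemma[OF g L])
    also have "(1 / \<theta>) / 2 * (norm ?e)\<^sup>2 = \<theta> / 2 * (norm (G b - G a))\<^sup>2"
      using \<theta> by (simp add: power_mult_distrib power2_eq_square)
    finally have "g a + inner (G a) (b - a) \<le> g b + inner (G b - G a) ?e + \<theta> / 2 * (norm (G b - G a))\<^sup>2"
      by (simp add: inner_diff_left inner_diff_right inner_add_right algebra_simps)
    then show ?thesis
      by (simp add: power2_norm_eq_inner)
  qed
  from *[of x y] *[of y x] show ?thesis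
    by (simp add: norm_minus_commute inner_diff_left inner_diff_right inner_commute)
qed

text \<open>The sum rule for subdifferentials in the easy case of a differentiable summand.\<close>

lemma minimizers_iff_subgradient:
  fixes f :: "'h::real_inner \<Rightarrow> ereal"
  assumes f: "proper_fun f" "convex_fun f" and g: "convex_on UNIV g" "GDERIV g z :> d"
  shows "z \<in> minimizers (\<lambda>y. f y + ereal (g y)) \<longleftrightarrow> subgradient f z (- d)"
proof
  assume "z \<in> minimizers (\<lambda>y. f y + ereal (g y))"
  then show "subgradient f z (- d)"
    by (intro subgradient_of_minimizer[OF f g(2)]) (simp add: minimizers_def is_arg_min_linorder)
next
  assume sub: "subgradient f z (- d)"
  have "f z + ereal (g z) \<le> f q + ereal (g q)" for q
  proof -
    have "f z + ereal (inner (- d) (q - z)) \<le> f q" "\<bar>f z\<bar> \<noteq> \<infinity>" using sub by (auto simp: subgradient_def)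
    moreover have "g z + inner d (q - z) \<le> g q" by (rule convex_gradient_inequality[OF g])
    ultimately show ?thesis by (cases "f z"; cases "f q") auto
  qed
  then show "z \<in> minimizers (\<lambda>y. f y + ereal (g y))"
    by (simp add: minimizers_def is_arg_min_linorder)
qed

section \<open>Nonnegative almost supermartingales\<close>

text \<open>The strategy in Doob's upcrossing argument: buy one unit of \<open>y\<close> as soon as it falls below \<open>a\<close>, and
  sell it as soon as it exceeds \<open>b\<close>. Whether the unit is held from time \<open>n\<close> to \<open>n + 1\<close> depends on
  \<open>y 0, \<dots>, y n\<close> alone, so the strategy is predictable. Each sale completes an upcrossing of \<open>[a, b]\<close>.\<close>

primrec holding :: "real \<Rightarrow> real \<Rightarrow> (nat \<Rightarrow> real) \<Rightarrow> nat \<Rightarrow> bool" where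
  "holding a b y 0 \<longleftrightarrow> y 0 < a"
| "holding a b y (Suc n) \<longleftrightarrow> (if holding a b y n then y (Suc n) \<le> b else y (Suc n) < a)"

definition selling :: "real \<Rightarrow> real \<Rightarrow> (nat \<Rightarrow> real) \<Rightarrow> nat \<Rightarrow> bool" where
  "selling a b y n \<longleftrightarrow> holding a b y n \<and> \<not> holding a b y (Suc n)"

text \<open>Each completed upcrossing has earned at least \<open>b - a\<close>, and a unit that is still held was bought for
  less than \<open>a\<close>.\<close>

lemma gain_ge_sales:
  assumes "a < b"
  shows "(b - a) * (\<Sum>k<n. of_bool (selling a b y k)) + (if holding a b y n then y n - a else 0)
    \<le> (\<Sum>k<n. of_bool (holding a b y k) * (y (Suc k) - y k))"
proof (induction n)
  case (Suc n)
  then show ?case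
    using assms by (cases "holding a b y n") (auto simp: selling_def algebra_simps)
qed simp

lemma frequently_selling:
  assumes "a < b" "\<exists>\<^sub>F n in sequentially. y n < a" "\<exists>\<^sub>F n in sequentially. y n > b"
  shows "\<exists>\<^sub>F n in sequentially. selling a b y n"
proof -
  have hold: "\<exists>n\<ge>m. holding a b y n" for m
  proof (rule ccontr)
    assume "\<not> ?thesis"
    then have no: "\<not> holding a b y n" if "n \<ge> m" for n using that by blast
    obtain n where n: "n \<ge> Suc m" "y n < a"
      using assms(2) unfolding frequently_sequentially by blast
    then obtain k where k: "n = Suc k" "k \<ge> m" by (cases n) auto
    then have "holding a b y n" using no[of k] n by simp
    then show False using no[of n] n(1) by simp
  qed
  have sell: "\<exists>n\<ge>m. \<not> holding a b y n" for m
  proof (rule ccontr)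
    assume "\<not> ?thesis"
    then have yes: "holding a b y n" if "n \<ge> m" for n using that by blast
    obtain n where n: "n \<ge> Suc m" "y n > b"
      using assms(3) unfolding frequently_sequentially by blast
    then obtain k where k: "n = Suc k" "k \<ge> m" by (cases n) auto
    then show False using yes[of k] yes[of "Suc k"] n by simp
  qed
  have "\<exists>k\<ge>m. selling a b y k" for m
  proof -
    obtain i where i: "i \<ge> m" "holding a b y i" using hold by blast
    define j where "j = (LEAST j. j \<ge> i \<and> \<not> holding a b y j)"
    have j: "j \<ge> i" "\<not> holding a b y j" 
      using LeastI_ex[of "\<lambda>j. j \<ge> i \<and> \<not> holding a b y j"] sell[of i] by (auto simp: j_def)
    have "j \<noteq> i" using i j by blast
    moreover have "holding a b y (j - 1)"
      using not_less_Least[of "j - 1" "\<lambda>j. j \<ge> i \<and> \<not> holding a b y j"] j \<open>j \<noteq> i\<close> 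
      unfolding j_def[symmetric] by (auto simp: not_less)
    ultimately have "selling a b y (j - 1)" using j by (auto simp: selling_def)
    with i j \<open>j \<noteq> i\<close> show ?thesis by (intro exI[of _ "j - 1"]) auto
  qed
  then show ?thesis unfolding frequently_sequentially by blast
qed

text \<open>A sequence whose lower and upper limits differ crosses some rational interval between them
  infinitely often. The bound on the lower limit excludes divergence to infinity.\<close>

lemma convergent_if_no_oscillation:
  fixes y :: "nat \<Rightarrow> real"
  assumes nonneg: "\<And>n. y n \<ge> 0" and fin: "liminf (\<lambda>n. ennreal (y n)) < \<infinity>"
    and no: "\<And>a b. a \<in> \<rat> \<Longrightarrow> b \<in> \<rat> \<Longrightarrow> a < b \<Longrightarrow> \<forall>\<^sub>F n in sequentially. \<not> selling a b y n"
  shows "convergent y"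
proof -
  let ?z = "\<lambda>n. ereal (y n)"
  have "limsup ?z \<le> liminf ?z"
  proof (rule ccontr)
    assume "\<not> ?thesis"
    then obtain c where c: "liminf ?z < ereal c" "ereal c < limsup ?z"
      using ereal_dense2 by (metis not_le)
    then obtain d where d: "ereal c < ereal d" "ereal d < limsup ?z"
      using ereal_dense2 by blast
    \<comment> \<open>The midpoint separates the two rationals.\<close>
    obtain a where a: "a \<in> \<rat>" "c < a" "a < (c + d) / 2"
      using Rats_dense_in_real[of c "(c + d) / 2"] d by auto
    obtain b where b: "b \<in> \<rat>" "(c + d) / 2 < b" "b < d"
      using Rats_dense_in_real[of "(c + d) / 2" d] d by auto
    have "\<exists>\<^sub>F n in sequentially. y n < a"
    proof -
      have "\<not> ereal c \<le> liminf ?z" using c by simp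
      then obtain e where e: "e < ereal c" "\<exists>\<^sub>F n in sequentially. \<not> e < ?z n"
        unfolding le_Liminf_iff by (auto simp: frequently_def)
      from e(2) show ?thesis
      proof (rule frequently_elim1)
        fix n assume "\<not> e < ?z n"
        then have "ereal (y n) < ereal c" using e(1) by (meson not_le order_le_less_trans)
        then show "y n < a" using a by simp
      qed
    qed
    moreover have "\<exists>\<^sub>F n in sequentially. y n > b"
    proof -
      have "\<not> limsup ?z \<le> ereal d" using d by simp
      then obtain e where e: "e > ereal d" "\<exists>\<^sub>F n in sequentially. \<not> e > ?z n"
        unfolding Limsup_le_iff by (auto simp: frequently_def)
      from e(2) show ?thesis
      proof (rule frequently_elim1)
        fix n assume "\<not> e > ?z n"
        then have "ereal (y n) > ereal d" using e(1) by (meson not_le order_less_le_trans)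
        then show "y n > b" using b by simp
      qed
    qed
    ultimately have "\<exists>\<^sub>F n in sequentially. selling a b y n"
      using a b by (intro frequently_selling) auto
    with no[of a b] a b show False by (auto simp: frequently_def)
  qed
  then have lim: "?z \<longlonglongrightarrow> liminf ?z"
    by (simp add: Liminf_le_Limsup antisym tendsto_iff_Liminf_eq_Limsup)
  have "liminf ?z \<ge> 0"
    by (rule Liminf_bounded) (simp add: nonneg)
  moreover have "liminf ?z \<noteq> \<infinity>"
  proof
    assume "liminf ?z = \<infinity>"
    then have "(\<lambda>n. e2ennreal (?z n)) \<longlonglongrightarrow> e2ennreal \<infinity>"
      using lim by (metis tendsto_e2ennrealI)
    then have "liminf (\<lambda>n. ennreal (y n)) = \<infinity>"
      by (intro lim_imp_Liminf) (auto simp: e2ennreal_ereal)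
    with fin show False by simp
  qed
  ultimately obtain l where "liminf ?z = ereal l" by (cases "liminf ?z") auto
  with lim show ?thesis by (auto simp: convergent_def)
qed

text \<open>The expected gain of the predictable strategy is not positive, while an open position can have
  lost at most \<open>\<bar>a\<bar>\<close> because \<open>Y\<close> is nonnegative. Hence the probabilities of a sale at time \<open>n\<close> have a
  finite sum, and by the Borel-Cantelli lemma almost every path makes finitely many sales. Fatou's
  lemma keeps the lower limit finite.\<close>

lemma (in prob_space) nonneg_supermartingale_converges:
  fixes Y :: "nat \<Rightarrow> 'a \<Rightarrow> real"
  assumes sub: "\<And>n. subalgebra M (F n)" and mono: "\<And>n. subalgebra (F (Suc n)) (F n)"
    and meas: "\<And>n. Y n \<in> borel_measurable (F n)" and int: "\<And>n. integrable M (Y n)"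
    and nonneg: "\<And>n \<omega>. \<omega> \<in> space M \<Longrightarrow> 0 \<le> Y n \<omega>"
    and super: "\<And>n A. A \<in> sets (F n) \<Longrightarrow> (LINT \<omega>:A|M. Y (Suc n) \<omega>) \<le> (LINT \<omega>:A|M. Y n \<omega>)"
  shows "AE \<omega> in M. convergent (\<lambda>n. Y n \<omega>)"
proof -
  have space_F: "space (F n) = space M" and sets_F: "sets (F n) \<subseteq> sets M" for n
    using sub by (auto simp: subalgebra_def)
  have holdF: "{\<omega> \<in> space M. holding a b (\<lambda>k. Y k \<omega>) n} \<in> sets (F n)" for a b n
  proof (induction n)
    case 0
    have "{\<omega> \<in> space (F 0). Y 0 \<omega> < a} \<in> sets (F 0)" using meas[of 0] by measurable
    then show ?case by (simp add: space_F)
  next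
    case (Suc n)
    let ?H = "{\<omega> \<in> space M. holding a b (\<lambda>k. Y k \<omega>) n}"
    have H: "?H \<in> sets (F (Suc n))" using Suc mono[of n] by (auto simp: subalgebra_def)
    have "{\<omega> \<in> space (F (Suc n)). Y (Suc n) \<omega> \<le> b} \<in> sets (F (Suc n))"
      "{\<omega> \<in> space (F (Suc n)). Y (Suc n) \<omega> < a} \<in> sets (F (Suc n))"
      using meas[of "Suc n"] by measurable
    with H have "(?H \<inter> {\<omega> \<in> space (F (Suc n)). Y (Suc n) \<omega> \<le> b}) \<union> ({\<omega> \<in> space (F (Suc n)). Y (Suc n) \<omega> < a} - ?H) \<in> sets (F (Suc n))"
      by blast
    also have "(?H \<inter> {\<omega> \<in> space (F (Suc n)). Y (Suc n) \<omega> \<le> b}) \<union> ({\<omega> \<in> space (F (Suc n)). Y (Suc n) \<omega> < a} - ?H)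
      = {\<omega> \<in> space M. holding a b (\<lambda>k. Y k \<omega>) (Suc n)}"
      by (auto simp: space_F)
    finally show ?case .
  qed
  have no: "AE \<omega> in M. \<forall>\<^sub>F n in sequentially. \<not> selling a b (\<lambda>k. Y k \<omega>) n" if ab: "a < b" for a b
  proof -
    let ?H = "\<lambda>n. {\<omega> \<in> space M. holding a b (\<lambda>k. Y k \<omega>) n}"
    let ?S = "\<lambda>n. {\<omega> \<in> space M. selling a b (\<lambda>k. Y k \<omega>) n}"
    have H[measurable]: "?H n \<in> sets M" for n using holdF sets_F by blast
    have S[measurable]: "?S n \<in> sets M" for n
    proof -
      have "?H n - ?H (Suc n) \<in> sets M" by (rule sets.Diff[OF H H])
      also have "?H n - ?H (Suc n) = ?S n" by (auto simp: selling_def)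
      finally show ?thesis .
    qed
    have gain_int: "integrable M (\<lambda>\<omega>. indicator (?H k) \<omega> * (Y (Suc k) \<omega> - Y k \<omega>))" for k
      using integrable_mult_indicator[OF H Bochner_Integration.integrable_diff[OF int int], of k "Suc k" k] by simp
    have gain: "(\<integral>\<omega>. indicator (?H k) \<omega> * (Y (Suc k) \<omega> - Y k \<omega>) \<partial>M) \<le> 0" for k
    proof -
      have "(\<integral>\<omega>. indicator (?H k) \<omega> * (Y (Suc k) \<omega> - Y k \<omega>) \<partial>M)
          = (LINT \<omega>:?H k|M. Y (Suc k) \<omega>) - (LINT \<omega>:?H k|M. Y k \<omega>)"
        using integrable_mult_indicator[OF H int, of k "Suc k"] integrable_mult_indicator[OF H int, of k k]
        by (simp add: set_lebesgue_integral_def right_diff_distrib)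
      with super[OF holdF, of a b k] show ?thesis by simp
    qed
    have S_int: "integrable M (indicat_real (?S k))" for k
      using S by (intro integrable_real_indicator) (auto simp: less_top[symmetric])
    have "(\<Sum>k<n. prob (?S k)) \<le> \<bar>a\<bar> / (b - a)" for n
    proof -
      have "(b - a) * (\<Sum>k<n. prob (?S k)) - \<bar>a\<bar> = (\<integral>\<omega>. (b - a) * (\<Sum>k<n. indicator (?S k) \<omega>) - \<bar>a\<bar> \<partial>M)"
        by (simp add: S_int prob_space S sets.Int_space_eq2)
      also have "\<dots> \<le> (\<integral>\<omega>. (\<Sum>k<n. indicator (?H k) \<omega> * (Y (Suc k) \<omega> - Y k \<omega>)) \<partial>M)"
      proof (rule integral_mono)
        fix \<omega> assume w: "\<omega> \<in> space M"
        have "(b - a) * (\<Sum>k<n. indicator (?S k) \<omega>) = (b - a) * (\<Sum>k<n. of_bool (selling a b (\<lambda>k. Y k \<omega>) k))"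
          using w by (simp add: indicator_def)
        moreover have "(\<Sum>k<n. indicator (?H k) \<omega> * (Y (Suc k) \<omega> - Y k \<omega>))
            = (\<Sum>k<n. of_bool (holding a b (\<lambda>k. Y k \<omega>) k) * (Y (Suc k) \<omega> - Y k \<omega>))"
          using w by (simp add: indicator_def)
        moreover have "- \<bar>a\<bar> \<le> (if holding a b (\<lambda>k. Y k \<omega>) n then Y n \<omega> - a else 0)"
          using nonneg[OF w, of n] by auto
        ultimately show "(b - a) * (\<Sum>k<n. indicator (?S k) \<omega>) - \<bar>a\<bar>
            \<le> (\<Sum>k<n. indicator (?H k) \<omega> * (Y (Suc k) \<omega> - Y k \<omega>))"
          using gain_ge_sales[OF ab, where y = "\<lambda>k. Y k \<omega>" and n = n] by linarith
      qed (intro Bochner_Integration.integrable_diff integrable_mult_right Bochner_Integration.integrable_sum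
          integrable_const S_int gain_int)+
      also have "\<dots> = (\<Sum>k<n. \<integral>\<omega>. indicator (?H k) \<omega> * (Y (Suc k) \<omega> - Y k \<omega>) \<partial>M)"
        by (rule Bochner_Integration.integral_sum) (rule gain_int)
      also have "\<dots> \<le> 0" by (rule sum_nonpos) (rule gain)
      finally show ?thesis using ab by (simp add: field_simps)
    qed
    then have "summable (\<lambda>k. prob (?S k))"
      by (intro summableI_nonneg_bounded) auto
    then have "AE \<omega> in M. \<forall>\<^sub>F n in sequentially. \<omega> \<in> space M - ?S n"
      by (intro borel_cantelli_AE1) (auto simp: less_top[symmetric])
    then show ?thesis
      by eventually_elim (auto elim: eventually_mono)
  qed
  have "AE \<omega> in M. \<forall>p\<in>\<rat> \<times> \<rat>. fst p < snd p \<longrightarrow> (\<forall>\<^sub>F n in sequentially. \<not> selling (fst p) (snd p) (\<lambda>k. Y k \<omega>) n)"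
    using no by (subst AE_ball_countable) (auto simp: countable_rat)
  moreover have "AE \<omega> in M. liminf (\<lambda>n. ennreal (Y n \<omega>)) < \<infinity>"
  proof -
    have Ymeas[measurable]: "Y n \<in> borel_measurable M" for n using int by auto
    have dec: "(\<integral>\<omega>. Y n \<omega> \<partial>M) \<le> (\<integral>\<omega>. Y 0 \<omega> \<partial>M)" for n
    proof (induction n)
      case (Suc n)
      have "(\<integral>\<omega>. Y (Suc n) \<omega> \<partial>M) \<le> (\<integral>\<omega>. Y n \<omega> \<partial>M)"
        using super[of "space (F n)" n, OF sets.top] int by (simp add: space_F set_integral_space)
      with Suc show ?case by simp
    qed simp
    have "(\<integral>\<^sup>+\<omega>. liminf (\<lambda>n. ennreal (Y n \<omega>)) \<partial>M) \<le> liminf (\<lambda>n. \<integral>\<^sup>+\<omega>. ennreal (Y n \<omega>) \<partial>M)"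
      by (rule nn_integral_liminf) measurable
    also have "\<dots> = liminf (\<lambda>n. ennreal (\<integral>\<omega>. Y n \<omega> \<partial>M))"
      using int nonneg by (simp add: nn_integral_eq_integral)
    also have "\<dots> \<le> liminf (\<lambda>n. ennreal (\<integral>\<omega>. Y 0 \<omega> \<partial>M))"
      by (rule Liminf_mono) (simp add: dec ennreal_leI)
    also have "\<dots> < \<infinity>" by (simp add: Liminf_const)
    finally have "AE \<omega> in M. liminf (\<lambda>n. ennreal (Y n \<omega>)) \<noteq> \<infinity>"
      by (intro nn_integral_PInf_AE) auto
    then show ?thesis by (simp add: less_top)
  qed
  ultimately show ?thesis
    using AE_space
  proof eventually_elim
    case (elim \<omega>)
    show ?case by (rule convergent_if_no_oscillation) (use elim nonneg in auto)
  qed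
qed

text \<open>The factors \<open>P n\<close> increase to a finite positive limit, so that division by them affects neither
  convergence nor summability.\<close>

lemma convergent_of_discounted:
  fixes V W \<delta> :: "nat \<Rightarrow> real"
  defines "P \<equiv> \<lambda>n. \<Prod>k<n. (1 + \<delta> k)"
  assumes nonneg: "\<And>n. 0 \<le> V n" "\<And>n. 0 \<le> W n" "\<And>n. 0 \<le> \<delta> n" and "summable \<delta>"
    and Y: "convergent (\<lambda>n. V n / P n + (\<Sum>k<n. W k / P (Suc k)))"
  shows "convergent V \<and> summable W"
proof
  have P1: "1 \<le> P n" for n unfolding P_def using nonneg(3) by (intro prod_ge_1) auto
  have P_le: "P n \<le> exp (\<Sum>k. \<delta> k)" for n
  proof -
    have "P n \<le> exp (\<Sum>k<n. \<delta> k)"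
    proof (induction n)
      case (Suc n)
      have "P (Suc n) = P n * (1 + \<delta> n)" by (simp add: P_def)
      also have "\<dots> \<le> exp (\<Sum>k<n. \<delta> k) * exp (\<delta> n)"
        using Suc P1[of n] nonneg(3)[of n] by (intro mult_mono) auto
      finally show ?case by (simp add: exp_add)
    qed (simp add: P_def)
    also have "\<dots> \<le> exp (\<Sum>k. \<delta> k)"
      using sum_le_suminf[OF \<open>summable \<delta>\<close>, of "{..<n}"] nonneg(3) by simp
    finally show ?thesis .
  qed
  have "incseq P"
  proof (rule incseq_SucI)
    fix n
    show "P n \<le> P (Suc n)"
      using nonneg(3)[of n] P1[of n] by (simp add: P_def distrib_left)
  qed
  then have P: "convergent P"
    using incseq_convergent[of P] P_le by (metis convergent_def)
  obtain C where C: "V n / P n + (\<Sum>k<n. W k / P (Suc k)) \<le> C" for n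
    using Y[THEN convergent_imp_Bseq] by (auto simp: Bseq_def) (meson abs_le_D1)
  have W_le: "(\<Sum>k<n. W k / P (Suc k)) \<le> C" for n
    using C[of n] nonneg(1)[of n] P1[of n] by (smt (verit) divide_nonneg_nonneg)
  have W': "summable (\<lambda>k. W k / P (Suc k))"
    by (rule summableI_nonneg_bounded[OF _ W_le]) (use nonneg(2) P1 in \<open>auto intro: divide_nonneg_nonneg order_trans[OF zero_le_one]\<close>)
  have "norm (W k) \<le> exp (\<Sum>k. \<delta> k) * (W k / P (Suc k))" for k
  proof -
    have "W k = P (Suc k) * (W k / P (Suc k))" using P1[of "Suc k"] by simp
    also have "\<dots> \<le> exp (\<Sum>k. \<delta> k) * (W k / P (Suc k))"
      using P_le nonneg(2)[of k] P1[of "Suc k"] by (intro mult_right_mono) auto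
    finally show ?thesis using nonneg(2) by simp
  qed
  then show "summable W"
    by (rule summable_comparison_test'[OF summable_mult[OF W'], of 0])
  have "V n = P n * ((V n / P n + (\<Sum>k<n. W k / P (Suc k))) - (\<Sum>k<n. W k / P (Suc k)))" for n
    using P1[of n] by simp
  moreover have "convergent (\<lambda>n. P n * ((V n / P n + (\<Sum>k<n. W k / P (Suc k))) - (\<Sum>k<n. W k / P (Suc k))))"
    by (intro convergent_mult convergent_diff P Y summable_iff_convergent[THEN iffD1] W')
  ultimately show "convergent V" by simp
qed

lemma borel_measurable_later:
  assumes mono: "\<And>n. subalgebra (F (Suc n)) (F n)" and "m \<le> n" and "Z \<in> borel_measurable (F m)"
  shows "Z \<in> borel_measurable (F n)"
  using assms(2,3)
proof (induction n rule: dec_induct)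
  case (step n)
  then show ?case by (meson measurable_from_subalg mono)
qed

text \<open>With \<open>P n = \<Prod>k<n. (1 + \<delta> k)\<close>, the process \<open>V n / P n + (\<Sum>k<n. W k / P (Suc k))\<close> is a nonnegative
  supermartingale. It matters that \<open>P (Suc n)\<close> is known at time \<open>n\<close>, so that it can be taken out of the
  conditional expectation. Division by \<open>P\<close> also makes the terms with \<open>W\<close> integrable, since they are
  dominated by \<open>V\<close>.\<close>

lemma (in prob_space) robbins_siegmund:
  fixes V W \<delta> :: "nat \<Rightarrow> 'a \<Rightarrow> real"
  assumes sub: "\<And>n. subalgebra M (F n)" and mono: "\<And>n. subalgebra (F (Suc n)) (F n)"
    and meas: "\<And>n. V n \<in> borel_measurable (F n)" "\<And>n. W n \<in> borel_measurable (F n)"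
      "\<And>n. \<delta> n \<in> borel_measurable (F n)"
    and int: "\<And>n. integrable M (V n)"
    and nonneg: "\<And>n \<omega>. \<omega> \<in> space M \<Longrightarrow> 0 \<le> V n \<omega>" "\<And>n \<omega>. \<omega> \<in> space M \<Longrightarrow> 0 \<le> W n \<omega>"
      "\<And>n \<omega>. \<omega> \<in> space M \<Longrightarrow> 0 \<le> \<delta> n \<omega>"
    and step: "\<And>n. AE \<omega> in M. real_cond_exp M (F n) (V (Suc n)) \<omega> + W n \<omega> \<le> (1 + \<delta> n \<omega>) * V n \<omega>"
    and sum: "AE \<omega> in M. summable (\<lambda>n. \<delta> n \<omega>)"
  shows "AE \<omega> in M. convergent (\<lambda>n. V n \<omega>) \<and> summable (\<lambda>n. W n \<omega>)"
proof -
  define P where "P n \<omega> = (\<Prod>k<n. (1 + \<delta> k \<omega>))" for n \<omega>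
  define Y where "Y n \<omega> = V n \<omega> / P n \<omega> + (\<Sum>k<n. W k \<omega> / P (Suc k) \<omega>)" for n \<omega>
  have P1: "1 \<le> P n \<omega>" if "\<omega> \<in> space M" for n \<omega>
    unfolding P_def using nonneg(3)[OF that] by (intro prod_ge_1) auto
  have P_Suc: "P (Suc n) \<omega> = P n \<omega> * (1 + \<delta> n \<omega>)" for n \<omega>
    by (simp add: P_def)
  have \<delta>_later: "\<delta> k \<in> borel_measurable (F n)" if "k \<le> n" for k n
    using borel_measurable_later[of F k n "\<delta> k", OF mono that meas(3)] .
  have P_pred: "P (Suc n) \<in> borel_measurable (F n)" for n
    unfolding P_def[abs_def] by (intro borel_measurable_prod borel_measurable_add borel_measurable_const \<delta>_later) auto
  have P_meas: "P n \<in> borel_measurable (F n)" for n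
    unfolding P_def[abs_def] by (intro borel_measurable_prod borel_measurable_add borel_measurable_const \<delta>_later) auto
  have Y_meas: "Y n \<in> borel_measurable (F n)" for n
  proof -
    have WP: "(\<lambda>\<omega>. W k \<omega> / P (Suc k) \<omega>) \<in> borel_measurable (F n)" if "k < n" for k
      using that by (intro borel_measurable_later[of F k n, OF mono] borel_measurable_divide meas P_pred) auto
    show ?thesis
      unfolding Y_def[abs_def]
      by (intro borel_measurable_add borel_measurable_divide[OF meas(1) P_meas] borel_measurable_sum WP) auto
  qed
  note to_M = measurable_from_subalg[OF sub]
  have subalg_F: "sigma_finite_subalgebra M (F n)" for n
    using sub by (intro finite_measure_subalgebra_is_sigma_finite)
      (simp add: finite_measure_subalgebra_def finite_measure_subalgebra_axioms_def finite_measure_axioms)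
  have VP_int: "integrable M (\<lambda>\<omega>. V n \<omega> / P n \<omega>)" for n
  proof (rule Bochner_Integration.integrable_bound[OF int[of n]])
    show "AE \<omega> in M. norm (V n \<omega> / P n \<omega>) \<le> norm (V n \<omega>)"
    proof (rule AE_I2)
      fix \<omega> assume "\<omega> \<in> space M"
      then have "1 \<le> P n \<omega>" by (rule P1)
      then show "norm (V n \<omega> / P n \<omega>) \<le> norm (V n \<omega>)"
        by (simp add: divide_le_eq mult_left_le[of "\<bar>V n \<omega>\<bar>"] mult_le_cancel_left1)
    qed
  qed (intro borel_measurable_divide to_M[OF meas(1)] to_M[OF P_meas])
  have W_le: "AE \<omega> in M. W n \<omega> / P (Suc n) \<omega> \<le> V n \<omega> / P n \<omega>" for n
  proof -
    have "AE \<omega> in M. 0 \<le> real_cond_exp M (F n) (V (Suc n)) \<omega>"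
      using nonneg(1) int by (intro sigma_finite_subalgebra.real_cond_exp_pos[OF subalg_F]) auto
    with step[of n] AE_space show ?thesis
    proof eventually_elim
      case (elim \<omega>)
      then have "W n \<omega> \<le> (1 + \<delta> n \<omega>) * V n \<omega>" by linarith
      then have "W n \<omega> / P (Suc n) \<omega> \<le> (1 + \<delta> n \<omega>) * V n \<omega> / P (Suc n) \<omega>"
        using P1[of \<omega> "Suc n"] elim by (intro divide_right_mono) auto
      also have "\<dots> = V n \<omega> / P n \<omega>"
        using nonneg(3)[of \<omega> n] elim by (simp add: P_Suc)
      finally show ?case .
    qed
  qed
  have WP_int: "integrable M (\<lambda>\<omega>. W n \<omega> / P (Suc n) \<omega>)" for n
  proof (rule Bochner_Integration.integrable_bound[OF VP_int[of n]])
    show "AE \<omega> in M. norm (W n \<omega> / P (Suc n) \<omega>) \<le> norm (V n \<omega> / P n \<omega>)"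
      using W_le[of n] AE_space
    proof eventually_elim
      case (elim \<omega>)
      then show ?case using nonneg(1,2)[of \<omega> n] P1[of \<omega> n] P1[of \<omega> "Suc n"] by simp
    qed
  qed (intro borel_measurable_divide to_M[OF meas(2)] to_M[OF P_pred])
  have Y_int: "integrable M (Y n)" for n
    unfolding Y_def[abs_def] by (intro Bochner_Integration.integrable_add Bochner_Integration.integrable_sum VP_int WP_int)
  have Y_super: "(LINT \<omega>:A|M. Y (Suc n) \<omega>) \<le> (LINT \<omega>:A|M. Y n \<omega>)" if A: "A \<in> sets (F n)" for n A
  proof -
    interpret S: sigma_finite_subalgebra M "F n" by (rule subalg_F)
    let ?E = "real_cond_exp M (F n) (V (Suc n))"
    define h where "h \<omega> = indicator A \<omega> / P (Suc n) \<omega>" for \<omega>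
    have AM: "A \<in> sets M" using A sub[of n] by (auto simp: subalgebra_def)
    have h_meas: "h \<in> borel_measurable (F n)"
      unfolding h_def[abs_def] by (intro borel_measurable_divide borel_measurable_indicator A P_pred)
    have hV_int: "integrable M (\<lambda>\<omega>. h \<omega> * V (Suc n) \<omega>)"
      using integrable_mult_indicator[OF AM VP_int[of "Suc n"]] by (simp add: h_def)
    have hE: "integrable M (\<lambda>\<omega>. h \<omega> * ?E \<omega>)" "(\<integral>\<omega>. h \<omega> * ?E \<omega> \<partial>M) = (\<integral>\<omega>. h \<omega> * V (Suc n) \<omega> \<partial>M)"
      by (rule S.real_cond_exp_intg[OF hV_int h_meas borel_measurable_integrable[OF int]])+
    have hW: "integrable M (\<lambda>\<omega>. h \<omega> * W n \<omega>)"
      using integrable_mult_indicator[OF AM WP_int[of n]] by (simp add: h_def)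
    have AV: "integrable M (\<lambda>\<omega>. indicator A \<omega> * (V n \<omega> / P n \<omega>))"
      using integrable_mult_indicator[OF AM VP_int[of n]] by simp
    define R where "R \<omega> = indicator A \<omega> * (\<Sum>k<n. W k \<omega> / P (Suc k) \<omega>)" for \<omega>
    have R: "integrable M R"
      unfolding R_def[abs_def]
      using integrable_mult_indicator[OF AM Bochner_Integration.integrable_sum[of "{..<n}" M "\<lambda>k \<omega>. W k \<omega> / P (Suc k) \<omega>"]] WP_int by simp
    have "(LINT \<omega>:A|M. Y (Suc n) \<omega>) = (\<integral>\<omega>. h \<omega> * V (Suc n) \<omega> + h \<omega> * W n \<omega> + R \<omega> \<partial>M)"
      unfolding set_lebesgue_integral_def by (rule Bochner_Integration.integral_cong) (auto simp: Y_def h_def R_def algebra_simps)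
    also have "\<dots> = (\<integral>\<omega>. h \<omega> * ?E \<omega> + h \<omega> * W n \<omega> + R \<omega> \<partial>M)"
      using hE hW hV_int R by simp
    also have "\<dots> \<le> (\<integral>\<omega>. indicator A \<omega> * (V n \<omega> / P n \<omega>) + R \<omega> \<partial>M)"
    proof (rule integral_mono_AE)
      show "AE \<omega> in M. h \<omega> * ?E \<omega> + h \<omega> * W n \<omega> + R \<omega> \<le> indicator A \<omega> * (V n \<omega> / P n \<omega>) + R \<omega>"
        using step[of n] AE_space
      proof eventually_elim
        case (elim \<omega>)
        have "h \<omega> * (?E \<omega> + W n \<omega>) \<le> h \<omega> * ((1 + \<delta> n \<omega>) * V n \<omega>)"
          using elim P1[of \<omega> "Suc n"] by (intro mult_left_mono) (auto simp: h_def)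
        also have "\<dots> = indicator A \<omega> * (V n \<omega> / P n \<omega>)"
          using nonneg(3)[of \<omega> n] elim by (simp add: P_Suc h_def)
        finally show ?case by (simp add: algebra_simps)
      qed
    qed (use hE hW AV R in auto)
    also have "\<dots> = (LINT \<omega>:A|M. Y n \<omega>)"
      unfolding set_lebesgue_integral_def by (rule Bochner_Integration.integral_cong) (auto simp: Y_def R_def algebra_simps)
    finally show ?thesis .
  qed
  have Y_nonneg: "0 \<le> Y n \<omega>" if "\<omega> \<in> space M" for n \<omega>
    unfolding Y_def using nonneg[OF that] P1[OF that]
    by (intro add_nonneg_nonneg sum_nonneg divide_nonneg_nonneg) (auto intro: order_trans[OF zero_le_one])
  have "AE \<omega> in M. convergent (\<lambda>n. Y n \<omega>)"
    by (rule nonneg_supermartingale_converges[of F Y, OF sub mono Y_meas Y_int Y_nonneg Y_super])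
  with sum AE_space show ?thesis
  proof eventually_elim
    case (elim \<omega>)
    then show ?case
      using convergent_of_discounted[of "\<lambda>n. V n \<omega>" "\<lambda>n. W n \<omega>" "\<lambda>n. \<delta> n \<omega>"] nonneg
      by (simp add: Y_def P_def)
  qed
qed

section \<open>Square integrable vectors and conditional expectation\<close>

text \<open>The parallelogram law without one of its nonnegative terms.\<close>

lemma norm_add_power2_le:
  fixes x y :: "'h::real_inner"
  shows "(norm (x + y))\<^sup>2 \<le> 2 * (norm x)\<^sup>2 + 2 * (norm y)\<^sup>2"
proof -
  have "(norm (x + y))\<^sup>2 + (norm (x - y))\<^sup>2 = 2 * (norm x)\<^sup>2 + 2 * (norm y)\<^sup>2"
    by (simp only: power2_norm_eq_inner) (simp add: algebra_simps inner_commute)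
  then show ?thesis by (smt (verit) zero_le_power2)
qed

lemma L2_rv_cong:
  assumes "\<And>\<omega>. \<omega> \<in> space M \<Longrightarrow> X \<omega> = Y \<omega>"
  shows "X \<in> L2_rv M \<longleftrightarrow> Y \<in> L2_rv M"
  using assms by (simp add: L2_rv_def cong: measurable_cong Bochner_Integration.integrable_cong)

lemma L2_rv_bound:
  assumes "X \<in> borel_measurable M" "integrable M h" "\<And>\<omega>. \<omega> \<in> space M \<Longrightarrow> (norm (X \<omega>))\<^sup>2 \<le> h \<omega>"
  shows "X \<in> L2_rv M"
  unfolding L2_rv_def
proof (intro CollectI conjI)
  show "integrable M (\<lambda>\<omega>. (norm (X \<omega>))\<^sup>2)"
    by (rule Bochner_Integration.integrable_bound[OF assms(2)])
      (use assms in \<open>auto intro!: AE_I2 order_trans[OF _ abs_ge_self]\<close>)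
qed (rule assms(1))

lemma L2_rv_add:
  assumes "X \<in> L2_rv M" "Y \<in> L2_rv M"
  shows "(\<lambda>\<omega>. X \<omega> + Y \<omega>) \<in> L2_rv M"
  using assms by (intro L2_rv_bound[where h = "\<lambda>\<omega>. 2 * (norm (X \<omega>))\<^sup>2 + 2 * (norm (Y \<omega>))\<^sup>2"])
    (auto simp: L2_rv_def norm_add_power2_le)

lemma L2_rv_scaleR:
  assumes "X \<in> L2_rv M"
  shows "(\<lambda>\<omega>. c *\<^sub>R X \<omega>) \<in> L2_rv M"
  using assms by (intro L2_rv_bound[where h = "\<lambda>\<omega>. c\<^sup>2 * (norm (X \<omega>))\<^sup>2"])
    (auto simp: L2_rv_def power_mult_distrib)

lemma L2_rv_diff:
  assumes "X \<in> L2_rv M" "Y \<in> L2_rv M"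
  shows "(\<lambda>\<omega>. X \<omega> - Y \<omega>) \<in> L2_rv M"
  using L2_rv_add[OF assms(1) L2_rv_scaleR[OF assms(2), of "-1"]] by simp

lemma L2_rv_inner_integrable:
  assumes "X \<in> L2_rv M" "Y \<in> L2_rv M"
  shows "integrable M (\<lambda>\<omega>. inner (X \<omega>) (Y \<omega>))"
proof (rule Bochner_Integration.integrable_bound)
  show "integrable M (\<lambda>\<omega>. (norm (X \<omega>))\<^sup>2 + (norm (Y \<omega>))\<^sup>2)"
    using assms by (auto simp: L2_rv_def)
  show "(\<lambda>\<omega>. inner (X \<omega>) (Y \<omega>)) \<in> borel_measurable M"
    using assms by (auto simp: L2_rv_def)
  have "\<bar>inner a b\<bar> \<le> (norm a)\<^sup>2 + (norm b)\<^sup>2" for a b :: 'b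
    using Cauchy_Schwarz_ineq2[of a b] sum_squares_bound[of "norm a" "norm b"]
      mult_nonneg_nonneg[OF norm_ge_zero[of a] norm_ge_zero[of b]] by linarith
  then show "AE \<omega> in M. norm (inner (X \<omega>) (Y \<omega>)) \<le> norm ((norm (X \<omega>))\<^sup>2 + (norm (Y \<omega>))\<^sup>2)"
    by (intro AE_I2) simp
qed

context prob_space
begin

lemma L2_rv_const: "(\<lambda>_. c) \<in> L2_rv M"
  by (simp add: L2_rv_def)

lemma L2_rv_integrable:
  assumes "X \<in> L2_rv M"
  shows "integrable M X"
proof (rule Bochner_Integration.integrable_bound)
  show "integrable M (\<lambda>\<omega>. 1 + (norm (X \<omega>))\<^sup>2)"
    using assms by (auto simp: L2_rv_def)
  have "norm a \<le> 1 + (norm a)\<^sup>2" for a :: 'b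
    using sum_squares_bound[of 1 "norm a"] norm_ge_zero[of a] by (simp only: one_power2 mult_1_right)
  then show "AE \<omega> in M. norm (X \<omega>) \<le> norm (1 + (norm (X \<omega>))\<^sup>2)"
    by (intro AE_I2) simp
qed (use assms in \<open>auto simp: L2_rv_def\<close>)

lemma L2_rv_lipschitz_image:
  assumes X: "X \<in> L2_rv M" and T: "L-lipschitz_on UNIV T"
  shows "(\<lambda>\<omega>. T (X \<omega>)) \<in> L2_rv M"
proof (rule L2_rv_bound)
  show "(\<lambda>\<omega>. T (X \<omega>)) \<in> borel_measurable M"
    using X lipschitz_on_continuous_on[OF T] borel_measurable_continuous_onI
    by (auto simp: L2_rv_def intro: measurable_compose)
  show "integrable M (\<lambda>\<omega>. 2 * (L\<^sup>2 * (norm (X \<omega>))\<^sup>2) + 2 * (norm (T 0))\<^sup>2)"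
    using X by (auto simp: L2_rv_def)
  fix \<omega>
  have "norm (T (X \<omega>) - T 0) \<le> L * norm (X \<omega>)"
    using lipschitz_onD[OF T, of "X \<omega>" 0] by (simp add: dist_norm)
  then have "(norm (T (X \<omega>) - T 0))\<^sup>2 \<le> L\<^sup>2 * (norm (X \<omega>))\<^sup>2"
    by (metis norm_ge_zero power_mono power_mult_distrib)
  then show "(norm (T (X \<omega>)))\<^sup>2 \<le> 2 * (L\<^sup>2 * (norm (X \<omega>))\<^sup>2) + 2 * (norm (T 0))\<^sup>2"
    using norm_add_power2_le[of "T (X \<omega>) - T 0" "T 0"] by simp
qed

end

locale prob_subalgebra = prob_space M for M :: "'a measure" +
  fixes G :: "'a measure"
  assumes sub: "subalgebra M G"

sublocale prob_subalgebra \<subseteq> sigma_finite_subalgebra M G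
  using sub by (intro finite_measure_subalgebra_is_sigma_finite)
    (simp add: finite_measure_subalgebra_def finite_measure_subalgebra_axioms_def finite_measure_axioms)

context prob_subalgebra
begin

lemma L2_rv_vec_cond_exp:
  assumes X: "X \<in> L2_rv M"
  shows "vec_cond_exp M G X \<in> L2_rv M"
  unfolding L2_rv_def
proof (intro CollectI conjI)
  show "vec_cond_exp M G X \<in> borel_measurable M"
    using measurable_from_subalg[OF sub vec_cond_exp_measurable] .
  have "(norm (vec_cond_exp M G X \<omega>))\<^sup>2 = (\<Sum>b\<in>Basis. (real_cond_exp M G (\<lambda>\<omega>. inner (X \<omega>) b) \<omega>)\<^sup>2)" for \<omega>
    unfolding power2_norm_eq_inner
    by (subst euclidean_inner) (simp add: vec_cond_exp_inner power2_eq_square)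
  moreover have "integrable M (\<lambda>\<omega>. (real_cond_exp M G (\<lambda>\<omega>. inner (X \<omega>) b) \<omega>)\<^sup>2)" if b: "b \<in> Basis" for b
  proof (rule integrable_convex_cond_exp[where I = UNIV])
    have X2: "integrable M (\<lambda>\<omega>. (norm (X \<omega>))\<^sup>2)" "X \<in> borel_measurable M" using X by (auto simp: L2_rv_def)
    have "(inner (X \<omega>) b)\<^sup>2 \<le> (norm (X \<omega>))\<^sup>2" for \<omega>
      by (rule abs_le_square_iff[THEN iffD1]) (use Basis_le_norm[OF b, of "X \<omega>"] in simp)
    then show "integrable M (\<lambda>\<omega>. (inner (X \<omega>) b)\<^sup>2)"
      using X2 by (intro Bochner_Integration.integrable_bound[OF X2(1)]) auto
    show "integrable M (\<lambda>\<omega>. inner (X \<omega>) b)"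
      using L2_rv_integrable[OF X] by simp
  qed (auto simp: convex_power2 emeasure_space_1)
  ultimately show "integrable M (\<lambda>\<omega>. (norm (vec_cond_exp M G X \<omega>))\<^sup>2)"
    by simp
qed

lemma real_cond_exp_inner:
  assumes Z: "Z \<in> L2_rv M" "Z \<in> borel_measurable G" and X: "X \<in> L2_rv M"
  shows "AE \<omega> in M. real_cond_exp M G (\<lambda>\<omega>. inner (Z \<omega>) (X \<omega>)) \<omega> = inner (Z \<omega>) (vec_cond_exp M G X \<omega>)"
proof -
  define p where "p b \<omega> = inner (Z \<omega>) b * inner (X \<omega>) b" for b \<omega>
  have meas: "X \<in> borel_measurable M" using X by (auto simp: L2_rv_def)
  have p_int: "integrable M (p b)" if "b \<in> Basis" for b
  proof (rule Bochner_Integration.integrable_bound)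
    show "integrable M (\<lambda>\<omega>. (norm (Z \<omega>))\<^sup>2 + (norm (X \<omega>))\<^sup>2)"
      using Z X by (auto simp: L2_rv_def)
    show "p b \<in> borel_measurable M"
      using Z X by (auto simp: L2_rv_def p_def[abs_def])
    have "\<bar>p b \<omega>\<bar> \<le> (norm (Z \<omega>))\<^sup>2 + (norm (X \<omega>))\<^sup>2" for \<omega>
    proof -
      have "\<bar>p b \<omega>\<bar> \<le> norm (Z \<omega>) * norm (X \<omega>)"
        unfolding p_def abs_mult using Basis_le_norm[OF that] by (intro mult_mono) auto
      then show ?thesis
        using sum_squares_bound[of "norm (Z \<omega>)" "norm (X \<omega>)"]
          mult_nonneg_nonneg[OF norm_ge_zero[of "Z \<omega>"] norm_ge_zero[of "X \<omega>"]] by linarith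
    qed
    then show "AE \<omega> in M. norm (p b \<omega>) \<le> norm ((norm (Z \<omega>))\<^sup>2 + (norm (X \<omega>))\<^sup>2)"
      by (intro AE_I2) simp
  qed
  have "AE \<omega> in M. \<forall>b\<in>Basis. real_cond_exp M G (p b) \<omega> = inner (Z \<omega>) b * inner (vec_cond_exp M G X \<omega>) b"
  proof (intro AE_finite_allI)
    fix b :: 'b assume b: "b \<in> Basis"
    show "AE \<omega> in M. real_cond_exp M G (p b) \<omega> = inner (Z \<omega>) b * inner (vec_cond_exp M G X \<omega>) b"
      unfolding vec_cond_exp_inner[OF b] p_def[abs_def]
      by (rule real_cond_exp_mult) (use Z meas p_int[OF b] in \<open>auto simp: p_def[abs_def]\<close>)
  qed simp
  moreover have "AE \<omega> in M. real_cond_exp M G (\<lambda>\<omega>. \<Sum>b\<in>Basis. (if b \<in> Basis then p b \<omega> else 0)) \<omega>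
      = (\<Sum>b\<in>Basis. real_cond_exp M G (\<lambda>\<omega>. if b \<in> Basis then p b \<omega> else 0) \<omega>)"
  proof (rule real_cond_exp_sum)
    fix b show "integrable M (\<lambda>\<omega>. if b \<in> Basis then p b \<omega> else 0)"
      using p_int by (cases "b \<in> Basis") auto
  qed
  ultimately show ?thesis
  proof eventually_elim
    case (elim \<omega>)
    have "(\<lambda>\<omega>. inner (Z \<omega>) (X \<omega>)) = (\<lambda>\<omega>. \<Sum>b\<in>Basis. (if b \<in> Basis then p b \<omega> else 0))"
      by (rule ext, subst euclidean_inner) (simp add: p_def)
    moreover have "inner (Z \<omega>) (vec_cond_exp M G X \<omega>)
        = (\<Sum>b\<in>Basis. inner (Z \<omega>) b * inner (vec_cond_exp M G X \<omega>) b)"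
      by (rule euclidean_inner)
    ultimately show ?case using elim by simp
  qed
qed

text \<open>The decomposition into squared bias and variance. The cross term vanishes because the error of the
  conditional expectation is orthogonal to every square integrable \<open>G\<close>-measurable vector.\<close>

lemma real_cond_exp_dist_sq:
  assumes Z: "Z \<in> L2_rv M" "Z \<in> borel_measurable G" and X: "X \<in> L2_rv M"
  shows "AE \<omega> in M. real_cond_exp M G (\<lambda>\<omega>. (norm (Z \<omega> - c *\<^sub>R X \<omega>))\<^sup>2) \<omega>
    = (norm (Z \<omega> - c *\<^sub>R vec_cond_exp M G X \<omega>))\<^sup>2
      + c\<^sup>2 * real_cond_exp M G (\<lambda>\<omega>. (norm (X \<omega> - vec_cond_exp M G X \<omega>))\<^sup>2) \<omega>"
proof -
  let ?w = "vec_cond_exp M G X"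
  define Y where "Y \<omega> = c *\<^sub>R ?w \<omega> - Z \<omega>" for \<omega>
  define d where "d \<omega> = (norm (Y \<omega>))\<^sup>2 - 2 * c * inner (Y \<omega>) (?w \<omega>)" for \<omega>
  have w: "?w \<in> L2_rv M" by (rule L2_rv_vec_cond_exp[OF X])
  have Y: "Y \<in> L2_rv M" "Y \<in> borel_measurable G"
    unfolding Y_def[abs_def] using Z vec_cond_exp_measurable
    by (auto intro!: L2_rv_diff L2_rv_scaleR w borel_measurable_diff borel_measurable_scaleR)
  have D: "integrable M (\<lambda>\<omega>. (norm (X \<omega> - ?w \<omega>))\<^sup>2)"
    using L2_rv_diff[OF X w] by (simp add: L2_rv_def)
  have I: "integrable M (\<lambda>\<omega>. inner (Y \<omega>) (X \<omega>))"
    by (rule L2_rv_inner_integrable[OF Y(1) X])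
  have d: "integrable M d" "d \<in> borel_measurable G"
    unfolding d_def[abs_def] using Y L2_rv_inner_integrable[OF Y(1) w] vec_cond_exp_measurable
    by (auto simp: L2_rv_def intro!: borel_measurable_diff borel_measurable_times borel_measurable_inner)
  have eq: "(norm (Z \<omega> - c *\<^sub>R X \<omega>))\<^sup>2 = c\<^sup>2 * (norm (X \<omega> - ?w \<omega>))\<^sup>2 + (2 * c * inner (Y \<omega>) (X \<omega>) + d \<omega>)" for \<omega>
  proof -
    have "Z \<omega> - c *\<^sub>R X \<omega> = - (c *\<^sub>R (X \<omega> - ?w \<omega>) + Y \<omega>)" by (simp add: Y_def algebra_simps)
    then have "(norm (Z \<omega> - c *\<^sub>R X \<omega>))\<^sup>2 = (norm (c *\<^sub>R (X \<omega> - ?w \<omega>) + Y \<omega>))\<^sup>2"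
      by (simp only: norm_minus_cancel)
    then show ?thesis
      unfolding d_def power2_norm_eq_inner
      by (simp add: inner_add_left inner_add_right inner_diff_left inner_diff_right inner_commute power2_eq_square algebra_simps)
  qed
  have "AE \<omega> in M. real_cond_exp M G (\<lambda>\<omega>. c\<^sup>2 * (norm (X \<omega> - ?w \<omega>))\<^sup>2 + (2 * c * inner (Y \<omega>) (X \<omega>) + d \<omega>)) \<omega>
      = real_cond_exp M G (\<lambda>\<omega>. c\<^sup>2 * (norm (X \<omega> - ?w \<omega>))\<^sup>2) \<omega>
        + real_cond_exp M G (\<lambda>\<omega>. 2 * c * inner (Y \<omega>) (X \<omega>) + d \<omega>) \<omega>"
    using D I d by (intro real_cond_exp_add) auto
  moreover have "AE \<omega> in M. real_cond_exp M G (\<lambda>\<omega>. 2 * c * inner (Y \<omega>) (X \<omega>) + d \<omega>) \<omega>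
      = real_cond_exp M G (\<lambda>\<omega>. 2 * c * inner (Y \<omega>) (X \<omega>)) \<omega> + real_cond_exp M G d \<omega>"
    using D I d by (intro real_cond_exp_add) auto
  moreover have "AE \<omega> in M. real_cond_exp M G (\<lambda>\<omega>. c\<^sup>2 * (norm (X \<omega> - ?w \<omega>))\<^sup>2) \<omega>
      = c\<^sup>2 * real_cond_exp M G (\<lambda>\<omega>. (norm (X \<omega> - ?w \<omega>))\<^sup>2) \<omega>"
    by (rule real_cond_exp_cmult[OF D])
  moreover have "AE \<omega> in M. real_cond_exp M G (\<lambda>\<omega>. 2 * c * inner (Y \<omega>) (X \<omega>)) \<omega>
      = 2 * c * real_cond_exp M G (\<lambda>\<omega>. inner (Y \<omega>) (X \<omega>)) \<omega>"
    by (rule real_cond_exp_cmult[OF I])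
  moreover have "AE \<omega> in M. real_cond_exp M G d \<omega> = d \<omega>"
    by (rule real_cond_exp_F_meas[OF d])
  ultimately show ?thesis
    using real_cond_exp_inner[OF Y X]
  proof eventually_elim
    case (elim \<omega>)
    then have "real_cond_exp M G (\<lambda>\<omega>. (norm (Z \<omega> - c *\<^sub>R X \<omega>))\<^sup>2) \<omega>
      = c\<^sup>2 * real_cond_exp M G (\<lambda>\<omega>. (norm (X \<omega> - ?w \<omega>))\<^sup>2) \<omega> + (norm (Y \<omega>))\<^sup>2"
      by (simp add: eq d_def)
    then show ?case by (simp add: Y_def norm_minus_commute)
  qed
qed

text \<open>Both sides have the same integral over every set in \<open>G\<close>.\<close>

lemma nn_cond_exp_eq_real_cond_exp:
  assumes Y: "integrable M Y" "AE \<omega> in M. 0 \<le> Y \<omega>"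
  shows "AE \<omega> in M. nn_cond_exp M G (\<lambda>\<omega>. ennreal (Y \<omega>)) \<omega> = ennreal (real_cond_exp M G Y \<omega>)"
proof (rule AE_symmetric[OF nn_cond_exp_charact])
  have pos: "AE \<omega> in M. 0 \<le> real_cond_exp M G Y \<omega>"
    using Y by (intro real_cond_exp_pos) auto
  fix A assume A: "A \<in> sets G"
  then have AM: "A \<in> sets M" using sub by (auto simp: subalgebra_def)
  have set_nn: "(\<integral>\<^sup>+\<omega>\<in>A. ennreal (h \<omega>) \<partial>M) = ennreal (LINT \<omega>:A|M. h \<omega>)"
    if "integrable M h" "AE \<omega> in M. 0 \<le> h \<omega>" for h :: "'a \<Rightarrow> real"
  proof -
    have "(\<integral>\<^sup>+\<omega>\<in>A. ennreal (h \<omega>) \<partial>M) = (\<integral>\<^sup>+\<omega>. ennreal (indicator A \<omega> * h \<omega>) \<partial>M)"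
      by (intro nn_integral_cong) (auto simp: indicator_def)
    also have "\<dots> = ennreal (\<integral>\<omega>. indicator A \<omega> * h \<omega> \<partial>M)"
      using integrable_mult_indicator[OF AM that(1)] that(2)
      by (intro nn_integral_eq_integral) (auto elim: eventually_mono)
    finally show ?thesis by (simp add: set_lebesgue_integral_def)
  qed
  show "(\<integral>\<^sup>+\<omega>\<in>A. ennreal (Y \<omega>) \<partial>M) = (\<integral>\<^sup>+\<omega>\<in>A. ennreal (real_cond_exp M G Y \<omega>) \<partial>M)"
    using set_nn[OF Y] set_nn[OF real_cond_exp_int(1)[OF Y(1)] pos] real_cond_exp_intA[OF Y(1) A] by simp
qed (use Y in auto)

text \<open>The weights are unbounded in the intended use, so the products with them need not be integrable.
  For the conditional expectation of functions with values in \<open>[0, \<infinity>]\<close> this is no obstacle, and the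
  real-valued inequality is recovered from it.\<close>

lemma real_cond_exp_le_combination:
  assumes A: "A \<in> borel_measurable G" "\<And>\<omega>. \<omega> \<in> space M \<Longrightarrow> 0 \<le> A \<omega>"
    and B: "B \<in> borel_measurable G" "\<And>\<omega>. \<omega> \<in> space M \<Longrightarrow> 0 \<le> B \<omega>"
    and P: "integrable M P" "\<And>\<omega>. \<omega> \<in> space M \<Longrightarrow> 0 \<le> P \<omega>"
    and Q: "integrable M Q" "\<And>\<omega>. \<omega> \<in> space M \<Longrightarrow> 0 \<le> Q \<omega>"
    and Y: "integrable M Y" "\<And>\<omega>. \<omega> \<in> space M \<Longrightarrow> 0 \<le> Y \<omega>"
    and le: "\<And>\<omega>. \<omega> \<in> space M \<Longrightarrow> Y \<omega> \<le> A \<omega> * P \<omega> + B \<omega> * Q \<omega>"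
  shows "AE \<omega> in M. real_cond_exp M G Y \<omega> \<le> A \<omega> * real_cond_exp M G P \<omega> + B \<omega> * real_cond_exp M G Q \<omega>"
proof -
  let ?n = "\<lambda>h. nn_cond_exp M G (\<lambda>\<omega>. ennreal (h \<omega>))"
  have [measurable]: "A \<in> borel_measurable M" "B \<in> borel_measurable M"
    using A B measurable_from_subalg[OF sub] by blast+
  have [measurable]: "P \<in> borel_measurable M" "Q \<in> borel_measurable M" "Y \<in> borel_measurable M"
    using P Q Y by auto
  have A': "(\<lambda>\<omega>. ennreal (A \<omega>)) \<in> borel_measurable G" and B': "(\<lambda>\<omega>. ennreal (B \<omega>)) \<in> borel_measurable G"
    using A(1) B(1) by measurable
  have "AE \<omega> in M. ?n Y \<omega> \<le> nn_cond_exp M G (\<lambda>\<omega>. ennreal (A \<omega>) * ennreal (P \<omega>) + ennreal (B \<omega>) * ennreal (Q \<omega>)) \<omega>"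
  proof (rule nn_cond_exp_mono)
    show "AE \<omega> in M. ennreal (Y \<omega>) \<le> ennreal (A \<omega>) * ennreal (P \<omega>) + ennreal (B \<omega>) * ennreal (Q \<omega>)"
      using le A(2) B(2) P(2) Q(2)
      by (intro AE_I2) (simp add: ennreal_mult[symmetric] ennreal_plus[symmetric] ennreal_leI del: ennreal_plus)
  qed measurable
  moreover have "AE \<omega> in M. nn_cond_exp M G (\<lambda>\<omega>. ennreal (A \<omega>) * ennreal (P \<omega>)) \<omega>
      + nn_cond_exp M G (\<lambda>\<omega>. ennreal (B \<omega>) * ennreal (Q \<omega>)) \<omega>
      = nn_cond_exp M G (\<lambda>\<omega>. ennreal (A \<omega>) * ennreal (P \<omega>) + ennreal (B \<omega>) * ennreal (Q \<omega>)) \<omega>"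
    by (rule nn_cond_exp_sum) measurable
  moreover have "AE \<omega> in M. ennreal (A \<omega>) * ?n P \<omega> = nn_cond_exp M G (\<lambda>\<omega>. ennreal (A \<omega>) * ennreal (P \<omega>)) \<omega>"
    by (rule nn_cond_exp_prod[OF A']) measurable
  moreover have "AE \<omega> in M. ennreal (B \<omega>) * ?n Q \<omega> = nn_cond_exp M G (\<lambda>\<omega>. ennreal (B \<omega>) * ennreal (Q \<omega>)) \<omega>"
    by (rule nn_cond_exp_prod[OF B']) measurable
  moreover have "AE \<omega> in M. 0 \<le> real_cond_exp M G P \<omega>" "AE \<omega> in M. 0 \<le> real_cond_exp M G Q \<omega>"
    using P Q by (auto intro!: real_cond_exp_pos)
  moreover have "AE \<omega> in M. ?n Y \<omega> = ennreal (real_cond_exp M G Y \<omega>)"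
    "AE \<omega> in M. ?n P \<omega> = ennreal (real_cond_exp M G P \<omega>)"
    "AE \<omega> in M. ?n Q \<omega> = ennreal (real_cond_exp M G Q \<omega>)"
    using P Q Y by (intro nn_cond_exp_eq_real_cond_exp AE_I2; simp)+
  ultimately show ?thesis
    using AE_space
  proof eventually_elim
    case (elim \<omega>)
    let ?p = "real_cond_exp M G P \<omega>" and ?q = "real_cond_exp M G Q \<omega>"
    have "ennreal (real_cond_exp M G Y \<omega>) \<le> ennreal (A \<omega>) * ennreal ?p + ennreal (B \<omega>) * ennreal ?q"
      using elim by metis
    also have "\<dots> = ennreal (A \<omega> * ?p + B \<omega> * ?q)"
      using elim A(2)[of \<omega>] B(2)[of \<omega>] by (simp add: ennreal_mult ennreal_plus)
    finally show ?case
      using elim A(2)[of \<omega>] B(2)[of \<omega>] by (subst (asm) ennreal_le_iff) auto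
  qed
qed

end

lemma (in prob_subalgebra) real_cond_exp_linear_combination:
  assumes d: "integrable M d" "d \<in> borel_measurable G"
    and int: "integrable M A" "integrable M B" "integrable M C"
  shows "AE \<omega> in M. real_cond_exp M G (\<lambda>\<omega>. d \<omega> + (c1 * A \<omega> + (c2 * B \<omega> + c3 * C \<omega>))) \<omega>
    = d \<omega> + (c1 * real_cond_exp M G A \<omega> + (c2 * real_cond_exp M G B \<omega> + c3 * real_cond_exp M G C \<omega>))"
proof -
  have int': "integrable M (\<lambda>\<omega>. c1 * A \<omega>)" "integrable M (\<lambda>\<omega>. c2 * B \<omega>)" "integrable M (\<lambda>\<omega>. c3 * C \<omega>)"
    using int by auto
  show ?thesis
    using real_cond_exp_add[OF d(1) Bochner_Integration.integrable_add[OF int'(1) Bochner_Integration.integrable_add[OF int'(2,3)]]]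
      real_cond_exp_add[OF int'(1) Bochner_Integration.integrable_add[OF int'(2,3)]]
      real_cond_exp_add[OF int'(2,3)] real_cond_exp_F_meas[OF d]
      real_cond_exp_cmult[OF int(1), of c1] real_cond_exp_cmult[OF int(2), of c2] real_cond_exp_cmult[OF int(3), of c3]
    by eventually_elim simp
qed

lemma sigma_upto_measurable:
  assumes "x n \<in> borel_measurable M"
  shows "x n \<in> borel_measurable (sigma_upto M x n)"
proof (rule measurableI)
  have gen: "{x i -` A \<inter> space M | i A. i \<le> n \<and> A \<in> sets borel} \<subseteq> Pow (space M)" by auto
  fix A :: "'b set" assume "A \<in> sets borel"
  then show "x n -` A \<inter> space (sigma_upto M x n) \<in> sets (sigma_upto M x n)"
    unfolding sigma_upto_def using gen by (auto simp: sets_measure_of)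
qed simp

section \<open>The decrease of the squared distance in one step\<close>

text \<open>Young's inequality for the cross term.\<close>

lemma norm_add_power2_le_weighted:
  fixes p q :: "'h::real_inner"
  assumes "e > 0"
  shows "(norm (p + q))\<^sup>2 \<le> (1 + e) * (norm p)\<^sup>2 + (1 + 1 / e) * (norm q)\<^sup>2"
proof -
  have "0 \<le> (norm (e *\<^sub>R p - q))\<^sup>2 / e" using assms by simp
  also have "(norm (e *\<^sub>R p - q))\<^sup>2 / e = e * (norm p)\<^sup>2 - 2 * inner p q + (norm q)\<^sup>2 / e"
    using assms unfolding power2_norm_eq_inner
    by (simp add: inner_diff_left inner_diff_right inner_commute field_simps)
  finally show ?thesis
    unfolding power2_norm_eq_inner
    by (simp add: inner_add_left inner_add_right inner_commute distrib_right)
qed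

text \<open>Firm nonexpansiveness bounds the distance of the new point from \<open>z\<close> and subtracts the squared
  residual, but the residual for the noisy gradient \<open>u\<close>. Replacing it by the residual \<open>r\<close> for the exact
  gradient \<open>gx\<close> costs a multiple of \<open>\<parallel>gx - u\<parallel>\<^sup>2\<close>. The factor \<open>\<eta>\<close> gives away part of the decrease in order
  to make this cost as small as desired.\<close>

lemma forward_backward_dist_sq:
  fixes f :: "'h::euclidean_space \<Rightarrow> ereal" and x z u gx gz :: 'h
  assumes f: "f \<in> Gamma0" and \<gamma>: "\<gamma> > 0" and z: "prox \<gamma> f (z - \<gamma> *\<^sub>R gz) = z"
    and \<eta>: "0 \<le> \<eta>" "\<eta> \<le> 1"
  defines "r \<equiv> x - \<gamma> *\<^sub>R gx - prox \<gamma> f (x - \<gamma> *\<^sub>R gx) + \<gamma> *\<^sub>R gz"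
  shows "(norm (prox \<gamma> f (x - \<gamma> *\<^sub>R u) - z))\<^sup>2
    \<le> (norm (x - z))\<^sup>2 - 2 * \<gamma> * inner (x - z) (u - gz) + \<gamma>\<^sup>2 * (norm (gz - u))\<^sup>2
      - \<eta> * ((norm r)\<^sup>2 / 2 - \<gamma>\<^sup>2 * (norm (gx - u))\<^sup>2)"
proof -
  define t where "t = prox \<gamma> f (x - \<gamma> *\<^sub>R u)"
  define d where "d = (x - z) - \<gamma> *\<^sub>R (u - gz)"
  define q where "q = x - \<gamma> *\<^sub>R u - t + \<gamma> *\<^sub>R gz"
  have "(norm (t - z))\<^sup>2 \<le> inner (t - z) ((x - \<gamma> *\<^sub>R u) - (z - \<gamma> *\<^sub>R gz))"
    using prox_firmly_nonexpansive[OF f \<gamma>, of "x - \<gamma> *\<^sub>R u" "z - \<gamma> *\<^sub>R gz"] by (simp add: z t_def)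
  also have "(x - \<gamma> *\<^sub>R u) - (z - \<gamma> *\<^sub>R gz) = d"
    by (simp add: d_def algebra_simps)
  finally have *: "(norm (t - z))\<^sup>2 \<le> inner (t - z) d" .
  have "q = d - (t - z)" by (simp add: q_def d_def algebra_simps)
  then have "(norm q)\<^sup>2 = (norm d)\<^sup>2 - 2 * inner (t - z) d + (norm (t - z))\<^sup>2"
    by (simp only: power2_norm_eq_inner) (simp add: inner_diff_left inner_diff_right inner_commute)
  with * have tz: "(norm (t - z))\<^sup>2 \<le> (norm d)\<^sup>2 - (norm q)\<^sup>2" by linarith
  have "r - q = ((x - \<gamma> *\<^sub>R gx) - prox \<gamma> f (x - \<gamma> *\<^sub>R gx)) - ((x - \<gamma> *\<^sub>R u) - t)"
    by (simp add: r_def q_def)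
  then have "norm (r - q) \<le> norm ((x - \<gamma> *\<^sub>R gx) - (x - \<gamma> *\<^sub>R u))"
    unfolding t_def using prox_complement_nonexpansive[OF f \<gamma>] by metis
  also have "(x - \<gamma> *\<^sub>R gx) - (x - \<gamma> *\<^sub>R u) = (- \<gamma>) *\<^sub>R (gx - u)" by (simp add: algebra_simps)
  finally have "norm (r - q) \<le> \<gamma> * norm (gx - u)" using \<gamma> by simp
  then have "(norm (r - q))\<^sup>2 \<le> \<gamma>\<^sup>2 * (norm (gx - u))\<^sup>2"
    by (metis norm_ge_zero power_mono power_mult_distrib)
  then have "(norm r)\<^sup>2 / 2 - \<gamma>\<^sup>2 * (norm (gx - u))\<^sup>2 \<le> (norm q)\<^sup>2"
    using norm_add_power2_le[of "r - q" q] by simp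
  then have "\<eta> * ((norm r)\<^sup>2 / 2 - \<gamma>\<^sup>2 * (norm (gx - u))\<^sup>2) \<le> \<eta> * (norm q)\<^sup>2"
    using \<eta> by (intro mult_left_mono) auto
  also have "\<dots> \<le> (norm q)\<^sup>2" using \<eta> by (simp add: mult_left_le_one_le)
  finally have "\<eta> * ((norm r)\<^sup>2 / 2 - \<gamma>\<^sup>2 * (norm (gx - u))\<^sup>2) \<le> (norm q)\<^sup>2" .
  moreover have "(norm d)\<^sup>2 = (norm (x - z))\<^sup>2 - 2 * \<gamma> * inner (x - z) (u - gz) + \<gamma>\<^sup>2 * (norm (gz - u))\<^sup>2"
    unfolding d_def norm_minus_commute[of gz]
    by (simp only: power2_norm_eq_inner)
      (simp add: inner_diff_left inner_diff_right inner_commute power2_eq_square algebra_simps)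
  ultimately show ?thesis using tz unfolding t_def by linarith
qed

text \<open>The point without the perturbation \<open>c\<close> is a convex combination, to which convexity of the squared
  norm applies; the perturbation is split off with weight \<open>e\<close>.\<close>

lemma relaxed_step_dist_sq:
  fixes x z t c :: "'h::real_inner"
  assumes l: "0 < l" "l \<le> 1" and e: "e > 0"
  shows "(norm (x + l *\<^sub>R (t + c - x) - z))\<^sup>2
    \<le> (1 + e) * ((1 - l) * (norm (x - z))\<^sup>2 + l * (norm (t - z))\<^sup>2) + (1 + 1 / e) * (l\<^sup>2 * (norm c)\<^sup>2)"
proof -
  define p where "p = (1 - l) *\<^sub>R (x - z) + l *\<^sub>R (t - z)"
  have "(norm p)\<^sup>2 = (1 - l) * (norm (x - z))\<^sup>2 + l * (norm (t - z))\<^sup>2 - l * (1 - l) * (norm ((x - z) - (t - z)))\<^sup>2"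
    unfolding p_def power2_norm_eq_inner inner_add_left inner_add_right inner_diff_left[of "x - z"]
      inner_diff_right[of _ "x - z"] inner_scaleR_left inner_scaleR_right inner_commute[of "t - z" "x - z"]
    by (simp only: algebra_simps)
  moreover have "0 \<le> l * (1 - l) * (norm ((x - z) - (t - z)))\<^sup>2"
    using l by simp
  ultimately have "(norm p)\<^sup>2 \<le> (1 - l) * (norm (x - z))\<^sup>2 + l * (norm (t - z))\<^sup>2" by linarith
  then have "(1 + e) * (norm p)\<^sup>2 \<le> (1 + e) * ((1 - l) * (norm (x - z))\<^sup>2 + l * (norm (t - z))\<^sup>2)"
    using e by (intro mult_left_mono) auto
  moreover have "x + l *\<^sub>R (t + c - x) - z = p + l *\<^sub>R c"
    by (simp add: p_def algebra_simps)
  ultimately show ?thesis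
    using norm_add_power2_le_weighted[OF e, of p "l *\<^sub>R c"] by (simp add: power_mult_distrib)
qed

text \<open>The two lines on the left are the conditional expectations of the main part and of the squared
  perturbation, where \<open>s\<close> is the distance to \<open>z\<close>, \<open>D\<close> and \<open>r\<close> are the norms of the gradient difference and
  of the residual, \<open>\<nu>\<close> is the bias and \<open>S\<close> the variance of the stochastic gradient. Each error carries a
  factor \<open>l\<close>, which can be distributed as \<open>sqrt l\<close> to each factor of a quadratic expression, so that
  \<open>e\<close> dominates it. The squared perturbation is of order \<open>e\<^sup>2 (1 + s\<^sup>2)\<close>, which compensates for the factor \<open>1 / e\<close> from
  Young's inequality. Terms that are linear in \<open>s\<close> are absorbed by \<open>1 + s\<^sup>2\<close>. The
  coefficients in \<open>C\<close> merely add up the crude bounds used for the individual errors.\<close>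

lemma expected_step_bound:
  fixes s D \<nu> \<theta> \<gamma> l \<eta> \<tau> T \<zeta> S A \<alpha> \<beta> e \<kappa> ip nw nx r Z :: real
  assumes \<theta>: "\<theta> > 0" and \<gamma>: "0 < \<gamma>" "\<gamma> < 2 * \<theta>" and l: "0 < l" "l \<le> 1" and \<eta>: "0 \<le> \<eta>" "\<eta> \<le> 1"
    and \<tau>: "0 \<le> \<tau>" "\<tau> \<le> T" and e: "e > 0"
    and nonneg: "0 \<le> s" "0 \<le> D" "0 \<le> \<nu>" "0 \<le> \<zeta>" "0 \<le> A" "0 \<le> \<alpha>" "0 \<le> \<beta>" "0 \<le> nw" "0 \<le> nx" "0 \<le> Z" "0 \<le> \<kappa>"
    and e_ge: "sqrt l * \<nu> \<le> e" "sqrt (l * \<zeta>) \<le> e" "sqrt l * \<alpha> \<le> e" "l * \<beta> \<le> e" "l * sqrt A \<le> e"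
    and D: "\<theta> * D \<le> s" and S: "S \<le> \<tau> * D\<^sup>2 + \<zeta>"
    and \<kappa>: "\<kappa> \<le> \<gamma> * (2 * \<theta> - (1 + \<tau>) * \<gamma>) - \<eta> * \<gamma>\<^sup>2 * \<tau>"
    and ip: "\<theta> * D\<^sup>2 - s * \<nu> \<le> ip" and nw: "nw \<le> D + \<nu>" and nx: "nx \<le> 3 * s + Z + 2 * \<theta> * \<nu>"
  defines "C \<equiv> 115 + 12 * \<theta> + 80 * \<theta>\<^sup>2 + 16 * T + 12 * Z\<^sup>2"
  shows "(1 + e) * (s\<^sup>2 + l * (- 2 * \<gamma> * ip + \<gamma>\<^sup>2 * (nw\<^sup>2 + S) - \<eta> * (r\<^sup>2 / 2 - \<gamma>\<^sup>2 * (\<nu>\<^sup>2 + S))))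
      + (1 + 1 / e) * (l\<^sup>2 * (2 * A + 4 * \<alpha>\<^sup>2 * (nx\<^sup>2 + \<gamma>\<^sup>2 * S) + 4 * \<beta>\<^sup>2))
    \<le> (1 + C * (e * (1 + e) ^ 3)) * (1 + s\<^sup>2) - 1 - l * (\<kappa> * D\<^sup>2 + \<eta> * r\<^sup>2 / 2)"
proof -
  define W where "W = l * (\<kappa> * D\<^sup>2 + \<eta> * r\<^sup>2 / 2)"
  have W: "0 \<le> W" using l nonneg \<eta> by (simp add: W_def)
  have sq_le: "l * v\<^sup>2 \<le> e\<^sup>2" if "sqrt l * v \<le> e" "0 \<le> v" for v
    using power_mono[OF that(1), of 2] that(2) l by (simp add: power_mult_distrib)
  have l\<nu>: "l * \<nu> \<le> e"
  proof -
    have "l * \<nu> = sqrt l * (sqrt l * \<nu>)" using l by (simp add: mult.assoc[symmetric])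
    also have "\<dots> \<le> 1 * (sqrt l * \<nu>)" using l nonneg by (intro mult_right_mono) auto
    finally show ?thesis using e_ge(1) by simp
  qed
  have l\<nu>2: "l * \<nu>\<^sup>2 \<le> e\<^sup>2" using sq_le e_ge(1) nonneg by blast
  have l\<alpha>2: "l * \<alpha>\<^sup>2 \<le> e\<^sup>2" using sq_le e_ge(3) nonneg by blast
  have l\<zeta>: "l * \<zeta> \<le> e\<^sup>2" using power_mono[OF e_ge(2), of 2] l nonneg by simp
  have l\<beta>2: "l\<^sup>2 * \<beta>\<^sup>2 \<le> e\<^sup>2" using power_mono[OF e_ge(4), of 2] l nonneg by (simp add: power_mult_distrib)
  have lA: "l\<^sup>2 * A \<le> e\<^sup>2" using power_mono[OF e_ge(5), of 2] l nonneg by (simp add: power_mult_distrib)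
  have \<gamma>2: "\<gamma>\<^sup>2 \<le> 4 * \<theta>\<^sup>2" using power_mono[of \<gamma> "2 * \<theta>" 2] \<gamma> by (simp add: power_mult_distrib)
  have s1: "s \<le> 1 + s\<^sup>2" using sum_squares_bound[of 1 s] nonneg by simp
  have \<theta>2D2: "\<theta>\<^sup>2 * D\<^sup>2 \<le> s\<^sup>2" using power_mono[OF D, of 2] \<theta> nonneg by (simp add: power_mult_distrib)
  let ?K1 = "12 * \<theta> + 16 * \<theta>\<^sup>2" and ?K2 = "114 + 16 * T + 12 * Z\<^sup>2 + 64 * \<theta>\<^sup>2"
  let ?EP = "s\<^sup>2 + l * (- 2 * \<gamma> * ip + \<gamma>\<^sup>2 * (nw\<^sup>2 + S) - \<eta> * (r\<^sup>2 / 2 - \<gamma>\<^sup>2 * (\<nu>\<^sup>2 + S)))"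
  have EP: "?EP \<le> s\<^sup>2 - W + ?K1 * (e * (1 + e)) * (1 + s\<^sup>2)"
  proof -
    have "- 2 * \<gamma> * ip \<le> - 2 * \<gamma> * (\<theta> * D\<^sup>2 - s * \<nu>)"
      using ip \<gamma> by simp
    moreover have "\<gamma>\<^sup>2 * nw\<^sup>2 \<le> \<gamma>\<^sup>2 * (D + \<nu>)\<^sup>2"
      using nw nonneg by (intro mult_left_mono power_mono) auto
    moreover have "(1 + \<eta>) * \<gamma>\<^sup>2 * S \<le> (1 + \<eta>) * \<gamma>\<^sup>2 * (\<tau> * D\<^sup>2 + \<zeta>)"
      using S \<eta> by (intro mult_left_mono) auto
    moreover have "\<kappa> * D\<^sup>2 \<le> (\<gamma> * (2 * \<theta> - (1 + \<tau>) * \<gamma>) - \<eta> * \<gamma>\<^sup>2 * \<tau>) * D\<^sup>2"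
      using \<kappa> by (intro mult_right_mono) auto
    moreover have "2 * \<gamma> * (s * \<nu>) \<le> 4 * \<theta> * (s * \<nu>)"
      using \<gamma> nonneg by (intro mult_right_mono) auto
    moreover have "\<gamma>\<^sup>2 * (2 * D * \<nu>) \<le> 8 * \<theta> * (s * \<nu>)"
    proof -
      have "\<gamma>\<^sup>2 * (2 * D * \<nu>) \<le> 4 * \<theta>\<^sup>2 * (2 * D * \<nu>)" using \<gamma>2 nonneg by (intro mult_right_mono) auto
      also have "\<dots> = 8 * \<theta> * \<nu> * (\<theta> * D)" by (simp add: power2_eq_square)
      also have "\<dots> \<le> 8 * \<theta> * \<nu> * s" using D \<theta> nonneg by (intro mult_left_mono) auto
      finally show ?thesis by (simp add: mult.assoc mult.commute[of \<nu>])
    qed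
    moreover have "(1 + \<eta>) * \<gamma>\<^sup>2 * \<nu>\<^sup>2 \<le> 2 * (4 * \<theta>\<^sup>2) * \<nu>\<^sup>2"
      using \<gamma>2 \<eta> by (intro mult_right_mono mult_mono) auto
    moreover have "(1 + \<eta>) * \<gamma>\<^sup>2 * \<zeta> \<le> 2 * (4 * \<theta>\<^sup>2) * \<zeta>"
      using \<gamma>2 \<eta> nonneg by (intro mult_right_mono mult_mono) auto
    ultimately have "- 2 * \<gamma> * ip + \<gamma>\<^sup>2 * (nw\<^sup>2 + S) - \<eta> * (r\<^sup>2 / 2 - \<gamma>\<^sup>2 * (\<nu>\<^sup>2 + S))
        \<le> - (\<kappa> * D\<^sup>2 + \<eta> * r\<^sup>2 / 2) + (12 * \<theta> * (s * \<nu>) + 8 * \<theta>\<^sup>2 * \<nu>\<^sup>2 + 8 * \<theta>\<^sup>2 * \<zeta>)"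
      by (simp add: power2_eq_square algebra_simps)
    then have "l * (- 2 * \<gamma> * ip + \<gamma>\<^sup>2 * (nw\<^sup>2 + S) - \<eta> * (r\<^sup>2 / 2 - \<gamma>\<^sup>2 * (\<nu>\<^sup>2 + S)))
        \<le> l * (- (\<kappa> * D\<^sup>2 + \<eta> * r\<^sup>2 / 2) + (12 * \<theta> * (s * \<nu>) + 8 * \<theta>\<^sup>2 * \<nu>\<^sup>2 + 8 * \<theta>\<^sup>2 * \<zeta>))"
      using l by (intro mult_left_mono) auto
    also have "\<dots> = - W + 12 * \<theta> * s * (l * \<nu>) + 8 * \<theta>\<^sup>2 * (l * \<nu>\<^sup>2) + 8 * \<theta>\<^sup>2 * (l * \<zeta>)"
      by (simp add: W_def algebra_simps)
    also have "\<dots> \<le> - W + 12 * \<theta> * s * e + 8 * \<theta>\<^sup>2 * e\<^sup>2 + 8 * \<theta>\<^sup>2 * e\<^sup>2"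
      using l\<nu> l\<nu>2 l\<zeta> \<theta> nonneg by (intro add_mono mult_left_mono) auto
    also have "12 * \<theta> * s * e \<le> 12 * \<theta> * (1 + s\<^sup>2) * (e * (1 + e))"
      using s1 \<theta> e nonneg by (intro mult_mono) (auto simp: algebra_simps)
    also have "8 * \<theta>\<^sup>2 * e\<^sup>2 \<le> 8 * \<theta>\<^sup>2 * ((e * (1 + e)) * (1 + s\<^sup>2))"
    proof -
      have "e\<^sup>2 \<le> (e * (1 + e)) * 1" using e by (simp add: power2_eq_square algebra_simps)
      also have "\<dots> \<le> (e * (1 + e)) * (1 + s\<^sup>2)" using e by (intro mult_left_mono) auto
      finally show ?thesis by (intro mult_left_mono) auto
    qed
    finally show ?thesis by (simp add: algebra_simps)
  qed
  have EQ: "l\<^sup>2 * (2 * A + 4 * \<alpha>\<^sup>2 * (nx\<^sup>2 + \<gamma>\<^sup>2 * S) + 4 * \<beta>\<^sup>2) \<le> ?K2 * (e\<^sup>2 * (1 + e\<^sup>2)) * (1 + s\<^sup>2)"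
  proof -
    have "nx\<^sup>2 \<le> (3 * s + Z + 2 * \<theta> * \<nu>)\<^sup>2" using nx nonneg by (intro power_mono) auto
    also have "\<dots> \<le> 3 * ((3 * s)\<^sup>2 + Z\<^sup>2 + (2 * \<theta> * \<nu>)\<^sup>2)"
      using sum_squares_bound[of "3 * s" Z] sum_squares_bound[of Z "2 * \<theta> * \<nu>"] sum_squares_bound[of "3 * s" "2 * \<theta> * \<nu>"]
      by (simp add: power2_sum algebra_simps)
    finally have nx2: "nx\<^sup>2 \<le> 27 * s\<^sup>2 + 3 * Z\<^sup>2 + 12 * \<theta>\<^sup>2 * \<nu>\<^sup>2" by (simp add: power_mult_distrib)
    have "l * nx\<^sup>2 \<le> l * (27 * s\<^sup>2 + 3 * Z\<^sup>2) + 12 * \<theta>\<^sup>2 * (l * \<nu>\<^sup>2)"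
      using mult_left_mono[OF nx2, of l] l by (simp add: algebra_simps)
    also have "\<dots> \<le> 1 * (27 * s\<^sup>2 + 3 * Z\<^sup>2) + 12 * \<theta>\<^sup>2 * e\<^sup>2"
      using l l\<nu>2 by (intro add_mono mult_right_mono mult_left_mono) auto
    finally have lnx: "l * nx\<^sup>2 \<le> 27 * s\<^sup>2 + 3 * Z\<^sup>2 + 12 * \<theta>\<^sup>2 * e\<^sup>2" by simp
    have "l * (\<gamma>\<^sup>2 * S) \<le> l * (\<gamma>\<^sup>2 * (\<tau> * D\<^sup>2 + \<zeta>))"
      using l S by (intro mult_left_mono) auto
    also have "\<dots> \<le> l * (4 * \<theta>\<^sup>2 * (T * D\<^sup>2 + \<zeta>))"
      using l \<tau> \<gamma>2 nonneg by (intro mult_left_mono mult_mono add_mono mult_right_mono) auto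
    also have "\<dots> = 4 * T * (l * (\<theta>\<^sup>2 * D\<^sup>2)) + 4 * \<theta>\<^sup>2 * (l * \<zeta>)"
      by (simp add: algebra_simps)
    also have "\<dots> \<le> 4 * T * (1 * s\<^sup>2) + 4 * \<theta>\<^sup>2 * e\<^sup>2"
      using l \<tau> \<theta>2D2 l\<zeta> by (intro add_mono mult_left_mono mult_mono) auto
    finally have lS: "l * (\<gamma>\<^sup>2 * S) \<le> 4 * T * s\<^sup>2 + 4 * \<theta>\<^sup>2 * e\<^sup>2" by simp
    have "(l * \<alpha>\<^sup>2) * (l * (nx\<^sup>2 + \<gamma>\<^sup>2 * S)) \<le> (l * \<alpha>\<^sup>2) * ((27 + 4 * T) * s\<^sup>2 + 3 * Z\<^sup>2 + 16 * \<theta>\<^sup>2 * e\<^sup>2)"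
      using lnx lS l by (intro mult_left_mono) (auto simp: algebra_simps)
    also have "\<dots> \<le> e\<^sup>2 * ((27 + 4 * T) * s\<^sup>2 + 3 * Z\<^sup>2 + 16 * \<theta>\<^sup>2 * e\<^sup>2)"
      using l\<alpha>2 \<tau> by (intro mult_right_mono) auto
    finally have "l\<^sup>2 * (\<alpha>\<^sup>2 * (nx\<^sup>2 + \<gamma>\<^sup>2 * S)) \<le> e\<^sup>2 * ((27 + 4 * T) * s\<^sup>2 + 3 * Z\<^sup>2 + 16 * \<theta>\<^sup>2 * e\<^sup>2)"
      by (simp add: power2_eq_square mult_ac)
    then have "l\<^sup>2 * (2 * A + 4 * \<alpha>\<^sup>2 * (nx\<^sup>2 + \<gamma>\<^sup>2 * S) + 4 * \<beta>\<^sup>2)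
        \<le> 2 * e\<^sup>2 + 4 * (e\<^sup>2 * ((27 + 4 * T) * s\<^sup>2 + 3 * Z\<^sup>2 + 16 * \<theta>\<^sup>2 * e\<^sup>2)) + 4 * e\<^sup>2"
      using lA l\<beta>2 by (simp add: distrib_left mult.left_commute[of "l\<^sup>2"])
    also have "\<dots> = e\<^sup>2 * (6 + (108 + 16 * T) * s\<^sup>2 + 12 * Z\<^sup>2 + 64 * \<theta>\<^sup>2 * e\<^sup>2)"
      by (simp add: algebra_simps)
    also have "\<dots> \<le> e\<^sup>2 * (?K2 * ((1 + e\<^sup>2) * (1 + s\<^sup>2)))"
    proof (rule mult_left_mono)
      have "1 \<le> (1 + e\<^sup>2) * (1 + s\<^sup>2)" "s\<^sup>2 \<le> (1 + e\<^sup>2) * (1 + s\<^sup>2)" "e\<^sup>2 \<le> (1 + e\<^sup>2) * (1 + s\<^sup>2)"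
        by (simp_all add: algebra_simps add_increasing)
      then have "6 * 1 + (108 + 16 * T) * s\<^sup>2 + 12 * Z\<^sup>2 * 1 + 64 * \<theta>\<^sup>2 * e\<^sup>2
          \<le> 6 * ((1 + e\<^sup>2) * (1 + s\<^sup>2)) + (108 + 16 * T) * ((1 + e\<^sup>2) * (1 + s\<^sup>2))
            + 12 * Z\<^sup>2 * ((1 + e\<^sup>2) * (1 + s\<^sup>2)) + 64 * \<theta>\<^sup>2 * ((1 + e\<^sup>2) * (1 + s\<^sup>2))"
        using \<tau> by (intro add_mono mult_left_mono) auto
      then show "6 + (108 + 16 * T) * s\<^sup>2 + 12 * Z\<^sup>2 + 64 * \<theta>\<^sup>2 * e\<^sup>2 \<le> ?K2 * ((1 + e\<^sup>2) * (1 + s\<^sup>2))"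
        by (simp only: distrib_right[symmetric] mult_1_right) simp
    qed simp
    finally show ?thesis by (simp add: mult_ac)
  qed
  have "(1 + e) * ?EP \<le> (1 + e) * (s\<^sup>2 - W + ?K1 * (e * (1 + e)) * (1 + s\<^sup>2))"
    using EP e by (intro mult_left_mono) auto
  also have "\<dots> = s\<^sup>2 - W + e * s\<^sup>2 - e * W + ?K1 * (1 + s\<^sup>2) * (e * (1 + e)\<^sup>2)"
    by (simp add: power2_eq_square algebra_simps)
  also have "\<dots> \<le> s\<^sup>2 - W + e * (1 + s\<^sup>2) + ?K1 * (1 + s\<^sup>2) * (e * (1 + e)\<^sup>2)"
    using e W by (simp add: algebra_simps add_increasing)
  also have "\<dots> \<le> s\<^sup>2 - W + (e * (1 + e) ^ 3) * (1 + s\<^sup>2) + ?K1 * (1 + s\<^sup>2) * (e * (1 + e) ^ 3)"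
    using e \<theta> by (intro add_mono mult_left_mono mult_right_mono order_refl) 
      (auto simp: power_increasing mult_le_cancel_left1 one_le_power)
  finally have 1: "(1 + e) * ?EP \<le> s\<^sup>2 - W + (1 + ?K1) * ((1 + s\<^sup>2) * (e * (1 + e) ^ 3))"
    by (simp add: algebra_simps)
  have "(1 + 1 / e) * (l\<^sup>2 * (2 * A + 4 * \<alpha>\<^sup>2 * (nx\<^sup>2 + \<gamma>\<^sup>2 * S) + 4 * \<beta>\<^sup>2))
      \<le> (1 + 1 / e) * (?K2 * (e\<^sup>2 * (1 + e\<^sup>2)) * (1 + s\<^sup>2))"
    using EQ e by (intro mult_left_mono) auto
  also have "\<dots> = (?K2 * (1 + s\<^sup>2)) * (e * ((1 + e) * (1 + e\<^sup>2)))"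
    using e by (simp add: field_simps power2_eq_square)
  also have "\<dots> \<le> (?K2 * (1 + s\<^sup>2)) * (e * (1 + e) ^ 3)"
  proof (intro mult_left_mono)
    show "(1 + e) * (1 + e\<^sup>2) \<le> (1 + e) ^ 3"
      using e by (simp add: power3_eq_cube power2_eq_square algebra_simps)
    show "0 \<le> ?K2 * (1 + s\<^sup>2)" using \<tau> by (intro mult_nonneg_nonneg) auto
  qed (use e in auto)
  finally have 2: "(1 + 1 / e) * (l\<^sup>2 * (2 * A + 4 * \<alpha>\<^sup>2 * (nx\<^sup>2 + \<gamma>\<^sup>2 * S) + 4 * \<beta>\<^sup>2))
      \<le> ?K2 * ((1 + s\<^sup>2) * (e * (1 + e) ^ 3))" by (simp add: mult_ac)
  have "s\<^sup>2 - W + (1 + ?K1) * ((1 + s\<^sup>2) * (e * (1 + e) ^ 3)) + ?K2 * ((1 + s\<^sup>2) * (e * (1 + e) ^ 3))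
      = s\<^sup>2 - W + C * ((1 + s\<^sup>2) * (e * (1 + e) ^ 3))"
    unfolding C_def by (simp only: distrib_right) 
  also have "\<dots> = (1 + C * (e * (1 + e) ^ 3)) * (1 + s\<^sup>2) - 1 - W"
    by (simp only: distrib_left distrib_right mult_1_left mult_1_right mult_ac)
  finally show ?thesis using 1 2 unfolding W_def by linarith
qed

text \<open>The squared distance after the step is bounded by a combination of quadratic polynomials in \<open>u\<close>
  and \<open>a\<close>, whose conditional expectations are known from the decomposition into bias and variance.\<close>

lemma (in prob_subalgebra) conditional_step_inequality:
  fixes f :: "'h::euclidean_space \<Rightarrow> ereal" and x u a x' :: "'a \<Rightarrow> 'h" and grad :: "'h \<Rightarrow> 'h"
    and e \<zeta> :: "'a \<Rightarrow> real" and z :: 'h and \<theta> \<gamma> l \<eta> \<tau> T \<alpha> \<beta> \<kappa> :: real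
  defines "w \<equiv> vec_cond_exp M G u"
    and "S \<equiv> real_cond_exp M G (\<lambda>\<omega>. (norm (u \<omega> - vec_cond_exp M G u \<omega>))\<^sup>2)"
    and "A \<equiv> real_cond_exp M G (\<lambda>\<omega>. (norm (a \<omega>))\<^sup>2)"
    and "C \<equiv> 115 + 12 * \<theta> + 80 * \<theta>\<^sup>2 + 16 * T + 12 * (norm z + 2 * \<theta> * norm (grad z))\<^sup>2"
  assumes f: "f \<in> Gamma0" and \<theta>: "\<theta> > 0"
    and lip: "(1 / \<theta>)-lipschitz_on UNIV grad"
    and coco: "\<And>y y'. \<theta> * (norm (grad y - grad y'))\<^sup>2 \<le> inner (y - y') (grad y - grad y')"
    and \<gamma>: "0 < \<gamma>" "\<gamma> < 2 * \<theta>" and z: "prox \<gamma> f (z - \<gamma> *\<^sub>R grad z) = z"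
    and l: "0 < l" "l \<le> 1" and \<eta>: "0 \<le> \<eta>" "\<eta> \<le> 1" and \<tau>: "0 \<le> \<tau>" "\<tau> \<le> T"
    and \<alpha>: "0 \<le> \<alpha>" and \<beta>: "0 \<le> \<beta>"
    and \<kappa>: "0 \<le> \<kappa>" "\<kappa> \<le> \<gamma> * (2 * \<theta> - (1 + \<tau>) * \<gamma>) - \<eta> * \<gamma>\<^sup>2 * \<tau>"
    and L2: "x \<in> L2_rv M" "u \<in> L2_rv M" "a \<in> L2_rv M" "x' \<in> L2_rv M" and x: "x \<in> borel_measurable G"
    and step: "\<And>\<omega>. \<omega> \<in> space M \<Longrightarrow> \<exists>t. x' \<omega> = x \<omega> + l *\<^sub>R (t + a \<omega> - x \<omega>)
      \<and> norm (t - prox \<gamma> f (x \<omega> - \<gamma> *\<^sub>R u \<omega>)) \<le> \<alpha> * norm (x \<omega> - \<gamma> *\<^sub>R u \<omega>) + \<beta>"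
    and S: "AE \<omega> in M. S \<omega> \<le> \<tau> * (norm (grad (x \<omega>) - grad z))\<^sup>2 + \<zeta> \<omega>"
    and \<zeta>: "\<And>\<omega>. \<omega> \<in> space M \<Longrightarrow> 0 \<le> \<zeta> \<omega>"
    and e: "e \<in> borel_measurable G" "\<And>\<omega>. \<omega> \<in> space M \<Longrightarrow> 0 < e \<omega>"
    and e_ge: "\<And>\<omega>. \<omega> \<in> space M \<Longrightarrow> sqrt l * norm (w \<omega> - grad (x \<omega>)) \<le> e \<omega>"
      "\<And>\<omega>. \<omega> \<in> space M \<Longrightarrow> sqrt (l * \<zeta> \<omega>) \<le> e \<omega>" "\<And>\<omega>. \<omega> \<in> space M \<Longrightarrow> sqrt l * \<alpha> \<le> e \<omega>"
      "\<And>\<omega>. \<omega> \<in> space M \<Longrightarrow> l * \<beta> \<le> e \<omega>" "\<And>\<omega>. \<omega> \<in> space M \<Longrightarrow> l * sqrt (A \<omega>) \<le> e \<omega>"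
  shows "AE \<omega> in M. real_cond_exp M G (\<lambda>\<omega>. 1 + (norm (x' \<omega> - z))\<^sup>2) \<omega>
      + l * (\<kappa> * (norm (grad (x \<omega>) - grad z))\<^sup>2 + \<eta> * (norm (x \<omega> - \<gamma> *\<^sub>R grad (x \<omega>)
          - prox \<gamma> f (x \<omega> - \<gamma> *\<^sub>R grad (x \<omega>)) + \<gamma> *\<^sub>R grad z))\<^sup>2 / 2)
    \<le> (1 + C * (e \<omega> * (1 + e \<omega>) ^ 3)) * (1 + (norm (x \<omega> - z))\<^sup>2)"
proof -
  define gx where "gx \<omega> = grad (x \<omega>)" for \<omega>
  define r where "r \<omega> = x \<omega> - \<gamma> *\<^sub>R gx \<omega> - prox \<gamma> f (x \<omega> - \<gamma> *\<^sub>R gx \<omega>) + \<gamma> *\<^sub>R grad z" for \<omega>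
  define d where "d \<omega> = (norm (x \<omega> - z))\<^sup>2 + l * (2 * \<gamma> * inner (x \<omega> - z) (grad z) - \<eta> * (norm (r \<omega>))\<^sup>2 / 2)" for \<omega>
  define I where "I \<omega> = inner (x \<omega> - z) (u \<omega>)" for \<omega>
  define P where "P \<omega> = d \<omega> + ((- 2 * \<gamma> * l) * I \<omega> + (l * \<gamma>\<^sup>2 * (norm (grad z - 1 *\<^sub>R u \<omega>))\<^sup>2
    + l * \<eta> * \<gamma>\<^sup>2 * (norm (gx \<omega> - 1 *\<^sub>R u \<omega>))\<^sup>2))" for \<omega>
  define Q where "Q \<omega> = l\<^sup>2 * (4 * \<beta>\<^sup>2) + (l\<^sup>2 * 2 * (norm (a \<omega>))\<^sup>2
    + (l\<^sup>2 * (4 * \<alpha>\<^sup>2) * (norm (x \<omega> - \<gamma> *\<^sub>R u \<omega>))\<^sup>2 + 0 * (norm (a \<omega>))\<^sup>2))" for \<omega>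
  have sq_int: "integrable M (\<lambda>\<omega>. (norm (Y \<omega>))\<^sup>2)" if "Y \<in> L2_rv M" for Y :: "'a \<Rightarrow> 'h"
    using that by (simp add: L2_rv_def)
  have lip_meas: "(\<lambda>\<omega>. k (Y \<omega>)) \<in> borel_measurable G"
    if "Y \<in> borel_measurable G" "L-lipschitz_on UNIV k" for Y and k :: "'h \<Rightarrow> 'h" and L
    using measurable_compose[OF that(1) borel_measurable_continuous_onI[OF lipschitz_on_continuous_on[OF that(2)]]] .
  have gx: "gx \<in> L2_rv M" "gx \<in> borel_measurable G"
    unfolding gx_def[abs_def] using L2_rv_lipschitz_image[OF L2(1) lip] lip_meas[OF x lip] by auto
  have y: "(\<lambda>\<omega>. x \<omega> - \<gamma> *\<^sub>R gx \<omega>) \<in> L2_rv M" "(\<lambda>\<omega>. x \<omega> - \<gamma> *\<^sub>R gx \<omega>) \<in> borel_measurable G"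
    using gx x L2 by (auto intro!: L2_rv_diff L2_rv_scaleR borel_measurable_diff borel_measurable_scaleR)
  have r: "r \<in> L2_rv M" "r \<in> borel_measurable G"
    unfolding r_def[abs_def]
    using y L2_rv_lipschitz_image[OF y(1) prox_lipschitz[OF f \<gamma>(1)]] lip_meas[OF y(2) prox_lipschitz[OF f \<gamma>(1)]]
    by (auto intro!: L2_rv_add L2_rv_diff L2_rv_const borel_measurable_diff borel_measurable_add)
  have xz: "(\<lambda>\<omega>. x \<omega> - z) \<in> L2_rv M" "(\<lambda>\<omega>. x \<omega> - z) \<in> borel_measurable G"
    using L2 x by (auto intro!: L2_rv_diff L2_rv_const)
  have d_int: "integrable M d" "d \<in> borel_measurable G"
    unfolding d_def[abs_def] using sq_int[OF xz(1)] sq_int[OF r(1)] L2_rv_inner_integrable[OF xz(1) L2_rv_const, of "grad z"] xz r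
    by auto
  have I_int: "integrable M I" unfolding I_def[abs_def] by (rule L2_rv_inner_integrable[OF xz(1) L2(2)])
  have dist_int: "integrable M (\<lambda>\<omega>. (norm (Y \<omega> - c *\<^sub>R u \<omega>))\<^sup>2)" if "Y \<in> L2_rv M" for Y c
    by (rule sq_int) (intro L2_rv_diff L2_rv_scaleR that L2)
  have P_int: "integrable M P"
    unfolding P_def[abs_def]
    by (intro Bochner_Integration.integrable_add integrable_mult_right d_int I_int dist_int L2_rv_const gx)
  have Q_int: "integrable M Q"
    unfolding Q_def[abs_def]
    by (intro Bochner_Integration.integrable_add integrable_mult_right integrable_const sq_int dist_int L2)
  have Y_int: "integrable M (\<lambda>\<omega>. (norm (x' \<omega> - z))\<^sup>2)"
    by (rule sq_int) (intro L2_rv_diff L2_rv_const L2)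
  have P_ge: "(1 - l) * (norm (x \<omega> - z))\<^sup>2 + l * (norm (prox \<gamma> f (x \<omega> - \<gamma> *\<^sub>R u \<omega>) - z))\<^sup>2 \<le> P \<omega>" for \<omega>
  proof -
    have "l * (norm (prox \<gamma> f (x \<omega> - \<gamma> *\<^sub>R u \<omega>) - z))\<^sup>2
        \<le> l * ((norm (x \<omega> - z))\<^sup>2 - 2 * \<gamma> * inner (x \<omega> - z) (u \<omega> - grad z) + \<gamma>\<^sup>2 * (norm (grad z - u \<omega>))\<^sup>2
          - \<eta> * ((norm (r \<omega>))\<^sup>2 / 2 - \<gamma>\<^sup>2 * (norm (gx \<omega> - u \<omega>))\<^sup>2))"
      unfolding r_def using l forward_backward_dist_sq[OF f \<gamma>(1) z \<eta>] by (intro mult_left_mono) auto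
    then show ?thesis
      by (simp add: P_def d_def I_def inner_diff_right algebra_simps)
  qed
  have P_nonneg: "0 \<le> P \<omega>" for \<omega>
    by (rule order_trans[OF _ P_ge]) (use l in simp)
  have Q_nonneg: "0 \<le> Q \<omega>" for \<omega>
    by (simp add: Q_def)
  have pointwise: "(norm (x' \<omega> - z))\<^sup>2 \<le> (1 + e \<omega>) * P \<omega> + (1 + 1 / e \<omega>) * Q \<omega>" if \<omega>: "\<omega> \<in> space M" for \<omega>
  proof -
    let ?v = "x \<omega> - \<gamma> *\<^sub>R u \<omega>"
    obtain t where t: "x' \<omega> = x \<omega> + l *\<^sub>R (t + a \<omega> - x \<omega>)" "norm (t - prox \<gamma> f ?v) \<le> \<alpha> * norm ?v + \<beta>"
      using step[OF \<omega>] by blast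
    define c where "c = (t - prox \<gamma> f ?v) + a \<omega>"
    have "(norm (t - prox \<gamma> f ?v))\<^sup>2 \<le> (\<alpha> * norm ?v + \<beta>)\<^sup>2" using t(2) by (intro power_mono) auto
    also have "\<dots> \<le> 2 * (\<alpha> * norm ?v)\<^sup>2 + 2 * \<beta>\<^sup>2"
      using norm_add_power2_le[of "\<alpha> * norm ?v" \<beta>] by (simp add: power_abs)
    finally have "(norm (t - prox \<gamma> f ?v))\<^sup>2 \<le> 2 * (\<alpha>\<^sup>2 * (norm ?v)\<^sup>2) + 2 * \<beta>\<^sup>2" by (simp add: power_mult_distrib)
    then have "(norm c)\<^sup>2 \<le> 4 * \<alpha>\<^sup>2 * (norm ?v)\<^sup>2 + 4 * \<beta>\<^sup>2 + 2 * (norm (a \<omega>))\<^sup>2"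
      unfolding c_def using norm_add_power2_le[of "t - prox \<gamma> f ?v" "a \<omega>"] by linarith
    then have "l\<^sup>2 * (norm c)\<^sup>2 \<le> l\<^sup>2 * (4 * \<alpha>\<^sup>2 * (norm ?v)\<^sup>2 + 4 * \<beta>\<^sup>2 + 2 * (norm (a \<omega>))\<^sup>2)"
      by (intro mult_left_mono) auto
    also have "\<dots> = Q \<omega>" by (simp add: Q_def algebra_simps)
    finally have c: "l\<^sup>2 * (norm c)\<^sup>2 \<le> Q \<omega>" .
    have "x' \<omega> = x \<omega> + l *\<^sub>R (prox \<gamma> f ?v + c - x \<omega>)" by (simp add: t(1) c_def)
    then have "(norm (x' \<omega> - z))\<^sup>2 \<le> (1 + e \<omega>) * ((1 - l) * (norm (x \<omega> - z))\<^sup>2 + l * (norm (prox \<gamma> f ?v - z))\<^sup>2)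
        + (1 + 1 / e \<omega>) * (l\<^sup>2 * (norm c)\<^sup>2)"
      using relaxed_step_dist_sq[OF l e(2)[OF \<omega>]] by simp
    also have "\<dots> \<le> (1 + e \<omega>) * P \<omega> + (1 + 1 / e \<omega>) * Q \<omega>"
      using e(2)[OF \<omega>] P_ge c by (intro add_mono mult_left_mono) auto
    finally show ?thesis .
  qed
  have "AE \<omega> in M. real_cond_exp M G (\<lambda>\<omega>. (norm (x' \<omega> - z))\<^sup>2) \<omega>
      \<le> (1 + e \<omega>) * real_cond_exp M G P \<omega> + (1 + 1 / e \<omega>) * real_cond_exp M G Q \<omega>"
  proof (rule real_cond_exp_le_combination)
    show "(\<lambda>\<omega>. 1 + e \<omega>) \<in> borel_measurable G" "(\<lambda>\<omega>. 1 + 1 / e \<omega>) \<in> borel_measurable G" using e(1) by auto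
    show "\<And>\<omega>. \<omega> \<in> space M \<Longrightarrow> 0 \<le> 1 + e \<omega>" "\<And>\<omega>. \<omega> \<in> space M \<Longrightarrow> 0 \<le> 1 + 1 / e \<omega>" using e(2) by (auto simp: less_imp_le)
  qed (use P_int Q_int Y_int P_nonneg Q_nonneg pointwise in auto)
  moreover have "AE \<omega> in M. real_cond_exp M G (\<lambda>\<omega>. 1 + (norm (x' \<omega> - z))\<^sup>2) \<omega>
      = real_cond_exp M G (\<lambda>\<omega>. 1) \<omega> + real_cond_exp M G (\<lambda>\<omega>. (norm (x' \<omega> - z))\<^sup>2) \<omega>"
    using Y_int by (intro real_cond_exp_add) auto
  moreover have "AE \<omega> in M. real_cond_exp M G (\<lambda>\<omega>. 1) \<omega> = 1"
    by (rule real_cond_exp_F_meas) auto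
  moreover have "AE \<omega> in M. real_cond_exp M G P \<omega> = d \<omega> + ((- 2 * \<gamma> * l) * real_cond_exp M G I \<omega>
      + (l * \<gamma>\<^sup>2 * real_cond_exp M G (\<lambda>\<omega>. (norm (grad z - 1 *\<^sub>R u \<omega>))\<^sup>2) \<omega>
      + l * \<eta> * \<gamma>\<^sup>2 * real_cond_exp M G (\<lambda>\<omega>. (norm (gx \<omega> - 1 *\<^sub>R u \<omega>))\<^sup>2) \<omega>))"
    unfolding P_def[abs_def] by (intro real_cond_exp_linear_combination d_int I_int dist_int L2_rv_const gx)
  moreover have "AE \<omega> in M. real_cond_exp M G Q \<omega> = l\<^sup>2 * (4 * \<beta>\<^sup>2) + (l\<^sup>2 * 2 * A \<omega>
      + (l\<^sup>2 * (4 * \<alpha>\<^sup>2) * real_cond_exp M G (\<lambda>\<omega>. (norm (x \<omega> - \<gamma> *\<^sub>R u \<omega>))\<^sup>2) \<omega> + 0 * A \<omega>))"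
    unfolding Q_def[abs_def] A_def by (intro real_cond_exp_linear_combination sq_int dist_int L2 integrable_const) auto
  moreover have "AE \<omega> in M. real_cond_exp M G I \<omega> = inner (x \<omega> - z) (w \<omega>)"
    unfolding I_def[abs_def] w_def by (rule real_cond_exp_inner[OF xz L2(2)])
  moreover have "AE \<omega> in M. real_cond_exp M G (\<lambda>\<omega>. (norm (grad z - 1 *\<^sub>R u \<omega>))\<^sup>2) \<omega>
      = (norm (grad z - 1 *\<^sub>R w \<omega>))\<^sup>2 + 1\<^sup>2 * S \<omega>"
    unfolding w_def S_def by (rule real_cond_exp_dist_sq[OF L2_rv_const _ L2(2)]) simp
  moreover have "AE \<omega> in M. real_cond_exp M G (\<lambda>\<omega>. (norm (gx \<omega> - 1 *\<^sub>R u \<omega>))\<^sup>2) \<omega>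
      = (norm (gx \<omega> - 1 *\<^sub>R w \<omega>))\<^sup>2 + 1\<^sup>2 * S \<omega>"
    unfolding w_def S_def by (rule real_cond_exp_dist_sq[OF gx L2(2)])
  moreover have "AE \<omega> in M. real_cond_exp M G (\<lambda>\<omega>. (norm (x \<omega> - \<gamma> *\<^sub>R u \<omega>))\<^sup>2) \<omega>
      = (norm (x \<omega> - \<gamma> *\<^sub>R w \<omega>))\<^sup>2 + \<gamma>\<^sup>2 * S \<omega>"
    unfolding w_def S_def by (rule real_cond_exp_dist_sq[OF L2(1) x L2(2)])
  moreover have "AE \<omega> in M. 0 \<le> A \<omega>"
    unfolding A_def using sq_int[OF L2(3)] by (intro real_cond_exp_pos) auto
  ultimately show ?thesis
    using S AE_space
  proof eventually_elim
    case (elim \<omega>)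
    define s where "s = norm (x \<omega> - z)"
    define D where "D = norm (gx \<omega> - grad z)"
    define \<nu> where "\<nu> = norm (w \<omega> - gx \<omega>)"
    define nw where "nw = norm (grad z - w \<omega>)"
    define nx where "nx = norm (x \<omega> - \<gamma> *\<^sub>R w \<omega>)"
    define ip where "ip = inner (x \<omega> - z) (w \<omega> - grad z)"
    define Z where "Z = norm z + 2 * \<theta> * norm (grad z)"
    have D: "\<theta> * D \<le> s"
      using lipschitz_onD[OF lip, of "x \<omega>" z] \<theta> by (simp add: D_def s_def gx_def dist_norm field_simps)
    have ip: "\<theta> * D\<^sup>2 - s * \<nu> \<le> ip"
    proof -
      have "ip = inner (x \<omega> - z) (gx \<omega> - grad z) + inner (x \<omega> - z) (w \<omega> - gx \<omega>)"
        by (simp add: ip_def inner_diff_right)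
      moreover have "- (s * \<nu>) \<le> inner (x \<omega> - z) (w \<omega> - gx \<omega>)"
        using Cauchy_Schwarz_ineq2[of "x \<omega> - z" "w \<omega> - gx \<omega>"] by (simp add: s_def \<nu>_def)
      ultimately show ?thesis using coco[of "x \<omega>" z] by (simp add: D_def gx_def)
    qed
    have nw: "nw \<le> D + \<nu>"
      using norm_triangle_ineq[of "gx \<omega> - grad z" "w \<omega> - gx \<omega>"] 
      by (simp add: nw_def D_def \<nu>_def norm_minus_commute)
    have nx: "nx \<le> 3 * s + Z + 2 * \<theta> * \<nu>"
    proof -
      have "x \<omega> - \<gamma> *\<^sub>R w \<omega> = (x \<omega> - z) + z - \<gamma> *\<^sub>R ((w \<omega> - gx \<omega>) + (gx \<omega> - grad z) + grad z)"
        by simp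
      then have "nx \<le> norm (x \<omega> - z) + norm z + norm (\<gamma> *\<^sub>R ((w \<omega> - gx \<omega>) + (gx \<omega> - grad z) + grad z))"
        unfolding nx_def by (metis norm_triangle_ineq norm_triangle_ineq4 order_trans add_right_mono)
      also have "norm (\<gamma> *\<^sub>R ((w \<omega> - gx \<omega>) + (gx \<omega> - grad z) + grad z)) \<le> \<gamma> * (\<nu> + D + norm (grad z))"
        using \<gamma> norm_triangle_ineq[of "w \<omega> - gx \<omega>" "gx \<omega> - grad z"] norm_triangle_ineq[of "w \<omega> - grad z" "grad z"]
        by (simp add: \<nu>_def D_def)
      also have "\<gamma> * (\<nu> + D + norm (grad z)) \<le> 2 * \<theta> * (\<nu> + D + norm (grad z))"
        using \<gamma> by (intro mult_right_mono) (auto simp: \<nu>_def D_def)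
      also have "\<dots> = 2 * \<theta> * \<nu> + 2 * (\<theta> * D) + 2 * \<theta> * norm (grad z)"
        by (simp add: algebra_simps)
      finally show ?thesis using D by (simp add: Z_def s_def)
    qed
    have P': "real_cond_exp M G P \<omega> = s\<^sup>2 + l * (- 2 * \<gamma> * ip + \<gamma>\<^sup>2 * (nw\<^sup>2 + S \<omega>)
        - \<eta> * ((norm (r \<omega>))\<^sup>2 / 2 - \<gamma>\<^sup>2 * (\<nu>\<^sup>2 + S \<omega>)))"
      using elim by (simp add: d_def s_def ip_def nw_def \<nu>_def norm_minus_commute[of "gx \<omega>"] inner_diff_right algebra_simps)
    have Q': "real_cond_exp M G Q \<omega> = l\<^sup>2 * (2 * A \<omega> + 4 * \<alpha>\<^sup>2 * (nx\<^sup>2 + \<gamma>\<^sup>2 * S \<omega>) + 4 * \<beta>\<^sup>2)"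
      using elim by (simp add: nx_def algebra_simps)
    have "(1 + e \<omega>) * real_cond_exp M G P \<omega> + (1 + 1 / e \<omega>) * real_cond_exp M G Q \<omega>
        \<le> (1 + C * (e \<omega> * (1 + e \<omega>) ^ 3)) * (1 + s\<^sup>2) - 1 - l * (\<kappa> * D\<^sup>2 + \<eta> * (norm (r \<omega>))\<^sup>2 / 2)"
      unfolding P' Q' C_def Z_def[symmetric]
      by (rule expected_step_bound[where D = D and \<nu> = \<nu> and \<zeta> = "\<zeta> \<omega>" and \<tau> = \<tau>])
        (use \<theta> \<gamma> l \<eta> \<tau> e(2) \<zeta> elim \<alpha> \<beta> \<kappa> e_ge D ip nw nx in
          \<open>auto simp: s_def D_def \<nu>_def nw_def nx_def Z_def gx_def\<close>)
    with elim show ?case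
      by (simp add: s_def D_def r_def gx_def)
  qed
qed

section \<open>Convergence of a single path\<close>

text \<open>If \<open>h\<close> stayed away from 0 eventually, \<open>l\<close> would be dominated by a multiple of \<open>l * h\<close> and thus
  be summable.\<close>

lemma vanishing_along_subsequence:
  fixes l h :: "nat \<Rightarrow> real"
  assumes l: "\<And>n. 0 \<le> l n" "\<not> summable l" and h: "summable (\<lambda>n. l n * h n)" "\<And>n. 0 \<le> h n"
  obtains k where "\<And>j. j \<le> k j" "(\<lambda>j. h (k j)) \<longlonglongrightarrow> 0"
proof -
  have "\<exists>n\<ge>j. h n < inverse (real (Suc j))" for j
  proof (rule ccontr)
    assume "\<not> ?thesis"
    then have *: "inverse (real (Suc j)) \<le> h n" if "n \<ge> j" for n using that by force
    have "norm (l n) \<le> real (Suc j) * (l n * h n)" if "n \<ge> j" for n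
    proof -
      have "1 = real (Suc j) * inverse (real (Suc j))" by simp
      also have "\<dots> \<le> real (Suc j) * h n" using *[OF that] by (intro mult_left_mono) auto
      finally show ?thesis using mult_left_mono[of 1 "real (Suc j) * h n" "l n"] l(1)[of n] by (simp add: mult_ac)
    qed
    then have "summable l"
      by (rule summable_comparison_test'[OF summable_mult[OF h(1)]])
    with l show False by simp
  qed
  then obtain k where k: "\<And>j. j \<le> k j" "\<And>j. h (k j) < inverse (real (Suc j))" by metis
  have "(\<lambda>j. h (k j)) \<longlonglongrightarrow> 0"
    by (rule tendsto_sandwich[OF _ _ tendsto_const LIMSEQ_inverse_real_of_nat])
      (use k(2) h(2) in \<open>auto intro!: always_eventually less_imp_le\<close>)
  with k(1) show ?thesis by (rule that)
qed

text \<open>The limit of the distances to a point \<open>d\<close> can be read off along the subsequence: it is the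
  distance from \<open>y\<close> to \<open>d\<close>, and thus small if \<open>d\<close> is close to \<open>y\<close>.\<close>

lemma converges_to_cluster_point:
  fixes x :: "nat \<Rightarrow> 'h::real_normed_vector"
  assumes conv: "\<And>d. d \<in> D \<Longrightarrow> convergent (\<lambda>n. norm (x n - d))" and y: "y \<in> closure D"
    and k: "filterlim k at_top sequentially" "(\<lambda>j. x (k j)) \<longlonglongrightarrow> y"
  shows "x \<longlonglongrightarrow> y"
proof (rule tendstoI)
  fix \<epsilon> :: real assume "\<epsilon> > 0"
  then obtain d where d: "d \<in> D" "dist d y < \<epsilon> / 2"
    using y by (meson closure_approachable half_gt_zero)
  obtain L where L: "(\<lambda>n. norm (x n - d)) \<longlonglongrightarrow> L" using conv[OF d(1)] by (auto simp: convergent_def)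
  have "(\<lambda>j. norm (x (k j) - d)) \<longlonglongrightarrow> L" by (rule filterlim_compose[OF L k(1)])
  moreover have "(\<lambda>j. norm (x (k j) - d)) \<longlonglongrightarrow> norm (y - d)" by (intro tendsto_intros k)
  ultimately have "L = norm (y - d)" by (rule LIMSEQ_unique)
  then have "L < \<epsilon> / 2" using d by (simp add: dist_norm norm_minus_commute)
  then have "eventually (\<lambda>n. norm (x n - d) < \<epsilon> / 2) sequentially"
    using L by (rule order_tendstoD(2)[rotated])
  then show "eventually (\<lambda>n. dist (x n) y < \<epsilon>) sequentially"
  proof eventually_elim
    case (elim n)
    have "dist (x n) y \<le> dist (x n) d + dist d y" by (rule dist_triangle)
    with elim d(2) show ?case by (simp add: dist_norm)
  qed
qed

text \<open>The prox point \<open>p n\<close> comes with the subgradient \<open>s n / \<gamma> n - grad z\<close>, where \<open>s n\<close> is the residual.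
  Since \<open>s n\<close> tends to 0 and the gradients at \<open>x n\<close> tend to \<open>grad z\<close>, the prox points tend to \<open>y\<close> as well,
  and \<open>- grad z = - grad y\<close> is a subgradient there.\<close>

lemma forward_backward_cluster_point:
  fixes f :: "'h::euclidean_space \<Rightarrow> ereal" and x :: "nat \<Rightarrow> 'h"
  assumes f: "f \<in> Gamma0" and g: "convex_on UNIV g" "\<And>y. GDERIV g y :> grad y"
    and cont: "continuous_on UNIV grad"
    and \<gamma>: "0 < c" "\<And>n. c \<le> \<gamma> n" "\<And>n. \<gamma> n \<le> c'"
    and x: "x \<longlonglongrightarrow> y"
    and D: "(\<lambda>n. (norm (grad (x n) - grad z))\<^sup>2) \<longlonglongrightarrow> 0"
    and r: "(\<lambda>n. (norm (x n - \<gamma> n *\<^sub>R grad (x n) - prox (\<gamma> n) f (x n - \<gamma> n *\<^sub>R grad (x n))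
          + \<gamma> n *\<^sub>R grad z))\<^sup>2) \<longlonglongrightarrow> 0"
  shows "y \<in> minimizers (\<lambda>y. f y + ereal (g y))"
proof -
  define p where "p n = prox (\<gamma> n) f (x n - \<gamma> n *\<^sub>R grad (x n))" for n
  define s where "s n = x n - \<gamma> n *\<^sub>R grad (x n) - p n + \<gamma> n *\<^sub>R grad z" for n
  have \<gamma>_pos: "\<gamma> n > 0" for n using \<gamma>(1) \<gamma>(2)[of n] by simp
  have null: "v \<longlonglongrightarrow> 0" if "(\<lambda>n. (norm (v n))\<^sup>2) \<longlonglongrightarrow> 0" for v :: "nat \<Rightarrow> 'h"
    using tendsto_real_sqrt[OF that] by (simp add: tendsto_norm_zero_iff)
  have D': "(\<lambda>n. grad (x n) - grad z) \<longlonglongrightarrow> 0" by (rule null[OF D])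
  have s: "s \<longlonglongrightarrow> 0" by (rule null) (use r in \<open>simp add: s_def p_def\<close>)
  have "(\<lambda>n. grad (x n)) \<longlonglongrightarrow> grad y"
    using continuous_on_tendsto_compose[OF cont x] by simp
  then have "(\<lambda>n. grad (x n) - grad z) \<longlonglongrightarrow> grad y - grad z" by (intro tendsto_intros)
  with D' have grad_y: "grad y = grad z" using LIMSEQ_unique by fastforce
  have "(\<lambda>n. \<gamma> n *\<^sub>R (grad (x n) - grad z)) \<longlonglongrightarrow> 0"
  proof (rule Lim_null_comparison)
    have "\<gamma> n * norm (grad (x n) - grad z) \<le> c' * norm (grad (x n) - grad z)" for n
      using \<gamma>(3) by (intro mult_right_mono) auto
    then show "\<forall>\<^sub>F n in sequentially. norm (\<gamma> n *\<^sub>R (grad (x n) - grad z)) \<le> c' * norm (grad (x n) - grad z)"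
      using \<gamma>_pos by (simp add: less_imp_le)
    show "(\<lambda>n. c' * norm (grad (x n) - grad z)) \<longlonglongrightarrow> 0"
      using tendsto_mult_right_zero[OF tendsto_norm_zero[OF D']] by simp
  qed
  then have "(\<lambda>n. x n - \<gamma> n *\<^sub>R (grad (x n) - grad z) - s n) \<longlonglongrightarrow> y - 0 - 0"
    by (intro tendsto_diff x s)
  moreover have "p = (\<lambda>n. x n - \<gamma> n *\<^sub>R (grad (x n) - grad z) - s n)"
    by (rule ext) (simp add: s_def algebra_simps)
  ultimately have p: "p \<longlonglongrightarrow> y" by simp
  have "(\<lambda>n. s n /\<^sub>R \<gamma> n) \<longlonglongrightarrow> 0"
  proof (rule Lim_null_comparison)
    have "norm (s n) / \<gamma> n \<le> norm (s n) / c" for n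
      using \<gamma>(1) \<gamma>(2)[of n] by (intro divide_left_mono) auto
    then show "\<forall>\<^sub>F n in sequentially. norm (s n /\<^sub>R \<gamma> n) \<le> norm (s n) / c"
      using \<gamma>_pos by (simp add: less_imp_le divide_inverse mult.commute)
    show "(\<lambda>n. norm (s n) / c) \<longlonglongrightarrow> 0"
      using tendsto_divide[OF tendsto_norm_zero[OF s] tendsto_const[of c]] \<gamma>(1) by simp
  qed
  then have v: "(\<lambda>n. s n /\<^sub>R \<gamma> n - grad z) \<longlonglongrightarrow> - grad y"
    unfolding grad_y using tendsto_diff[of "\<lambda>n. s n /\<^sub>R \<gamma> n" 0 sequentially "\<lambda>_. grad z" "grad z"] by simp
  have "subgradient f (p n) (s n /\<^sub>R \<gamma> n - grad z)" for n
  proof -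
    have "s n /\<^sub>R \<gamma> n - grad z = (x n - \<gamma> n *\<^sub>R grad (x n) - p n) /\<^sub>R \<gamma> n"
      using \<gamma>_pos[of n] by (simp add: s_def scaleR_add_right)
    then show ?thesis
      using prox_subgradient[OF f \<gamma>_pos[of n], of "x n - \<gamma> n *\<^sub>R grad (x n)"] by (simp add: p_def)
  qed
  from subgradient_limit[OF _ _ this p v] f have "subgradient f y (- grad y)"
    by (simp add: Gamma0_def)
  then show ?thesis
    using f minimizers_iff_subgradient[OF _ _ g(1) g(2)] by (simp add: Gamma0_def)
qed

lemma forward_backward_pathwise_convergence:
  fixes f :: "'h::euclidean_space \<Rightarrow> ereal" and x :: "nat \<Rightarrow> 'h"
  assumes f: "f \<in> Gamma0" and g: "convex_on UNIV g" "\<And>y. GDERIV g y :> grad y"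
    and cont: "continuous_on UNIV grad"
    and \<gamma>: "0 < c" "\<And>n. c \<le> \<gamma> n" "\<And>n. \<gamma> n \<le> c'"
    and l: "\<And>n. 0 \<le> l n" "\<not> summable l"
    and D: "\<And>d. d \<in> D \<Longrightarrow> convergent (\<lambda>n. norm (x n - d))"
      "minimizers (\<lambda>y. f y + ereal (g y)) \<subseteq> closure D" "D \<noteq> {}"
    and sum: "summable (\<lambda>n. l n * (norm (grad (x n) - grad z))\<^sup>2)"
      "summable (\<lambda>n. l n * (norm (x n - \<gamma> n *\<^sub>R grad (x n) - prox (\<gamma> n) f (x n - \<gamma> n *\<^sub>R grad (x n))
          + \<gamma> n *\<^sub>R grad z))\<^sup>2)"
  shows "\<exists>y\<in>minimizers (\<lambda>y. f y + ereal (g y)). x \<longlonglongrightarrow> y"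
proof -
  define h1 where "h1 n = (norm (grad (x n) - grad z))\<^sup>2" for n
  define h2 where "h2 n = (norm (x n - \<gamma> n *\<^sub>R grad (x n) - prox (\<gamma> n) f (x n - \<gamma> n *\<^sub>R grad (x n))
          + \<gamma> n *\<^sub>R grad z))\<^sup>2" for n
  have h: "0 \<le> h1 n" "0 \<le> h2 n" for n by (simp_all add: h1_def h2_def)
  have "summable (\<lambda>n. l n * (h1 n + h2 n))"
    using summable_add[OF sum] by (simp add: h1_def h2_def distrib_left)
  then obtain k where k: "\<And>j. j \<le> k j" "(\<lambda>j. h1 (k j) + h2 (k j)) \<longlonglongrightarrow> 0"
    using vanishing_along_subsequence[OF l, of "\<lambda>n. h1 n + h2 n"] h by (metis add_nonneg_nonneg)
  obtain d where d: "d \<in> D" using D(3) by blast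
  obtain B where B: "\<And>n. norm (norm (x n - d)) \<le> B"
    using convergent_imp_Bseq[OF D(1)[OF d]] by (auto simp: Bseq_def)
  have "x (k j) \<in> cball d B" for j
    using B[of "k j"] by (simp add: dist_norm norm_minus_commute)
  then obtain y \<rho> where \<rho>: "strict_mono \<rho>" "((\<lambda>j. x (k j)) \<circ> \<rho>) \<longlonglongrightarrow> y"
    using compact_cball[of d B] unfolding compact_def by metis
  have k_lim: "filterlim (\<lambda>j. k (\<rho> j)) at_top sequentially"
    by (rule filterlim_at_top_mono[OF filterlim_subseq[OF \<rho>(1)]]) (simp add: k(1))
  have xk: "(\<lambda>j. x (k (\<rho> j))) \<longlonglongrightarrow> y" using \<rho>(2) by (simp add: o_def)
  have hk: "(\<lambda>j. h1 (k (\<rho> j)) + h2 (k (\<rho> j))) \<longlonglongrightarrow> 0"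
    using LIMSEQ_subseq_LIMSEQ[OF k(2) \<rho>(1)] by (simp add: o_def)
  have "(\<lambda>j. h1 (k (\<rho> j))) \<longlonglongrightarrow> 0" "(\<lambda>j. h2 (k (\<rho> j))) \<longlonglongrightarrow> 0"
    by (rule tendsto_sandwich[OF _ _ tendsto_const hk]; use h in \<open>auto intro!: always_eventually\<close>)+
  then have "y \<in> minimizers (\<lambda>y. f y + ereal (g y))"
    unfolding h1_def h2_def
    by (intro forward_backward_cluster_point[OF f g cont \<gamma>(1), of "\<lambda>j. \<gamma> (k (\<rho> j))" c', OF \<gamma>(2,3) xk])
  moreover from this have "x \<longlonglongrightarrow> y"
    using D(2) by (intro converges_to_cluster_point[OF D(1) _ k_lim xk]) auto
  ultimately show ?thesis by blast
qed

section \<open>Convergence of the stochastic algorithm\<close>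

text \<open>For one fixed point \<open>z\<close> this combines the inequality for a single step with the theorem of Robbins
  and Siegmund.\<close>

lemma (in prob_space) stochastic_forward_backward_fejer:
  fixes f :: "'h::euclidean_space \<Rightarrow> ereal" and x u a :: "nat \<Rightarrow> 'a \<Rightarrow> 'h" and grad :: "'h \<Rightarrow> 'h"
    and G :: "nat \<Rightarrow> 'a measure" and \<zeta> :: "nat \<Rightarrow> 'a \<Rightarrow> real" and z :: 'h
    and lam \<gamma> \<tau> \<alpha> \<beta> :: "nat \<Rightarrow> real" and \<theta> c \<mu> T :: real
  assumes f: "f \<in> Gamma0" and \<theta>: "\<theta> > 0"
    and lip: "(1 / \<theta>)-lipschitz_on UNIV grad"
    and coco: "\<And>y y'. \<theta> * (norm (grad y - grad y'))\<^sup>2 \<le> inner (y - y') (grad y - grad y')"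
    and z: "\<And>n. prox (\<gamma> n) f (z - \<gamma> n *\<^sub>R grad z) = z"
    and \<gamma>: "0 < c" "\<And>n. c \<le> \<gamma> n" and \<mu>: "0 < \<mu>" "\<And>n. (1 + \<tau> n) * \<gamma> n \<le> 2 * \<theta> - \<mu>"
    and \<tau>: "\<And>n. 0 \<le> \<tau> n" "\<And>n. \<tau> n \<le> T"
    and lam: "\<And>n. 0 < lam n" "\<And>n. lam n \<le> 1"
    and \<alpha>: "\<And>n. 0 \<le> \<alpha> n" "summable (\<lambda>n. sqrt (lam n) * \<alpha> n)"
    and \<beta>: "\<And>n. 0 \<le> \<beta> n" "summable (\<lambda>n. lam n * \<beta> n)"
    and sub: "\<And>n. subalgebra M (G n)" and mono: "\<And>n. subalgebra (G (Suc n)) (G n)"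
    and L2: "\<And>n. x n \<in> L2_rv M" "\<And>n. u n \<in> L2_rv M" "\<And>n. a n \<in> L2_rv M"
    and adapted: "\<And>n. x n \<in> borel_measurable (G n)"
    and step: "\<And>n \<omega>. \<omega> \<in> space M \<Longrightarrow> \<exists>t. x (Suc n) \<omega> = x n \<omega> + lam n *\<^sub>R (t + a n \<omega> - x n \<omega>)
      \<and> norm (t - prox (\<gamma> n) f (x n \<omega> - \<gamma> n *\<^sub>R u n \<omega>)) \<le> \<alpha> n * norm (x n \<omega> - \<gamma> n *\<^sub>R u n \<omega>) + \<beta> n"
    and hyp_a: "AE \<omega> in M. summable (\<lambda>n. lam n * sqrt (real_cond_exp M (G n) (\<lambda>\<omega>. (norm (a n \<omega>))\<^sup>2) \<omega>))"
    and hyp_b: "AE \<omega> in M. summable (\<lambda>n. sqrt (lam n) * norm (vec_cond_exp M (G n) (u n) \<omega> - grad (x n \<omega>)))"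
    and \<zeta>: "\<And>n. \<zeta> n \<in> borel_measurable (G n)" "\<And>n \<omega>. \<omega> \<in> space M \<Longrightarrow> 0 \<le> \<zeta> n \<omega>"
      "AE \<omega> in M. summable (\<lambda>n. sqrt (lam n * \<zeta> n \<omega>))"
    and S: "\<And>n. AE \<omega> in M. real_cond_exp M (G n) (\<lambda>\<omega>. (norm (u n \<omega> - vec_cond_exp M (G n) (u n) \<omega>))\<^sup>2) \<omega>
      \<le> \<tau> n * (norm (grad (x n \<omega>) - grad z))\<^sup>2 + \<zeta> n \<omega>"
  shows "AE \<omega> in M. convergent (\<lambda>n. norm (x n \<omega> - z))
    \<and> summable (\<lambda>n. lam n * (norm (grad (x n \<omega>) - grad z))\<^sup>2)
    \<and> summable (\<lambda>n. lam n * (norm (x n \<omega> - \<gamma> n *\<^sub>R grad (x n \<omega>)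
        - prox (\<gamma> n) f (x n \<omega> - \<gamma> n *\<^sub>R grad (x n \<omega>)) + \<gamma> n *\<^sub>R grad z))\<^sup>2)"
proof -
  define w where "w n = vec_cond_exp M (G n) (u n)" for n
  define A where "A n = real_cond_exp M (G n) (\<lambda>\<omega>. (norm (a n \<omega>))\<^sup>2)" for n
  \<comment> \<open>The last summand keeps \<open>e\<close> positive, as Young's inequality requires. The absolute value is there
    because a version of the conditional expectation may be negative on a null set.\<close>
  define e where "e n \<omega> = lam n * sqrt \<bar>A n \<omega>\<bar> + lam n * \<beta> n + sqrt (lam n) * \<alpha> n + sqrt (lam n * \<zeta> n \<omega>)
    + sqrt (lam n) * norm (w n \<omega> - grad (x n \<omega>)) + (1 / 2) ^ n" for n \<omega>
  define C where "C = 115 + 12 * \<theta> + 80 * \<theta>\<^sup>2 + 16 * T + 12 * (norm z + 2 * \<theta> * norm (grad z))\<^sup>2"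
  define \<delta> where "\<delta> n \<omega> = C * (e n \<omega> * (1 + e n \<omega>) ^ 3)" for n \<omega>
  \<comment> \<open>The decrease of the gradient term is at least \<open>c * \<mu>\<close>. One half is kept as \<open>\<kappa>\<close>, and \<open>\<eta>\<close> is so small
    that the other half pays for the passage to the exact residual.\<close>
  define \<kappa> where "\<kappa> = c * \<mu> / 2"
  define \<eta> where "\<eta> = min 1 (c * \<mu> / (8 * \<theta>\<^sup>2 * (1 + T)))"
  define D where "D n \<omega> = (norm (grad (x n \<omega>) - grad z))\<^sup>2" for n \<omega>
  define r where "r n \<omega> = (norm (x n \<omega> - \<gamma> n *\<^sub>R grad (x n \<omega>)
        - prox (\<gamma> n) f (x n \<omega> - \<gamma> n *\<^sub>R grad (x n \<omega>)) + \<gamma> n *\<^sub>R grad z))\<^sup>2" for n \<omega>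
  define W where "W n \<omega> = lam n * (\<kappa> * D n \<omega> + \<eta> * r n \<omega> / 2)" for n \<omega>
  define V where "V n \<omega> = 1 + (norm (x n \<omega> - z))\<^sup>2" for n \<omega>
  have \<gamma>_pos: "0 < \<gamma> n" for n using \<gamma>(1) \<gamma>(2)[of n] by simp
  have \<gamma>_less: "\<gamma> n < 2 * \<theta>" for n
  proof -
    have "1 * \<gamma> n \<le> (1 + \<tau> n) * \<gamma> n" using \<tau>(1)[of n] \<gamma>_pos[of n] by (intro mult_right_mono) auto
    then show ?thesis using \<mu>(1) \<mu>(2)[of n] by simp
  qed
  have T: "0 \<le> T" using \<tau>(1)[of 0] \<tau>(2)[of 0] by simp
  have C: "0 \<le> C" using \<theta> T by (simp add: C_def)
  have \<kappa>_pos: "0 < \<kappa>" using \<gamma> \<mu> by (simp add: \<kappa>_def)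
  have \<eta>: "0 < \<eta>" "\<eta> \<le> 1" using \<gamma> \<mu> \<theta> T by (auto simp: \<eta>_def)
  have \<kappa>_le: "\<kappa> \<le> \<gamma> n * (2 * \<theta> - (1 + \<tau> n) * \<gamma> n) - \<eta> * (\<gamma> n)\<^sup>2 * \<tau> n" for n
  proof -
    have "c * \<mu> \<le> \<gamma> n * (2 * \<theta> - (1 + \<tau> n) * \<gamma> n)"
      using \<gamma>(1) \<gamma>(2)[of n] \<mu>(1) \<mu>(2)[of n] by (intro mult_mono) auto
    moreover have "\<eta> * (\<gamma> n)\<^sup>2 * \<tau> n \<le> c * \<mu> / (8 * \<theta>\<^sup>2 * (1 + T)) * (2 * \<theta>)\<^sup>2 * (1 + T)"
      using \<eta> \<gamma>_pos[of n] \<gamma>_less[of n] \<tau>(1)[of n] \<tau>(2)[of n]  \<gamma> \<mu>(1) T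
      by (intro mult_mono power_mono) (auto simp: \<eta>_def)
    moreover have "c * \<mu> / (8 * \<theta>\<^sup>2 * (1 + T)) * (2 * \<theta>)\<^sup>2 * (1 + T) = c * \<mu> / 2"
    proof -
      have "c * \<mu> / (8 * \<theta>\<^sup>2 * k) * (2 * \<theta>)\<^sup>2 * k = c * \<mu> / 2" if "k \<noteq> 0" for k
        using \<theta> that by (simp add: power_mult_distrib)
      then show ?thesis using T by simp
    qed
    ultimately show ?thesis by (simp add: \<kappa>_def)
  qed
  have e_pos: "0 < e n \<omega>" if "\<omega> \<in> space M" for n \<omega>
    unfolding e_def using lam(1)[of n] \<alpha>(1)[of n] \<beta>(1)[of n] \<zeta>(2)[OF that, of n]
    by (intro add_nonneg_pos add_nonneg_nonneg) auto
  have lip_meas: "(\<lambda>\<omega>. k (Y \<omega>)) \<in> borel_measurable (G n)"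
    if "Y \<in> borel_measurable (G n)" "L-lipschitz_on UNIV k" for Y and k :: "'h \<Rightarrow> 'h" and L n
    using measurable_compose[OF that(1) borel_measurable_continuous_onI[OF lipschitz_on_continuous_on[OF that(2)]]] .
  have gx: "(\<lambda>\<omega>. grad (x n \<omega>)) \<in> borel_measurable (G n)" for n
    by (rule lip_meas[OF adapted lip])
  have y: "(\<lambda>\<omega>. x n \<omega> - \<gamma> n *\<^sub>R grad (x n \<omega>)) \<in> borel_measurable (G n)" for n
    using gx adapted by (intro borel_measurable_diff borel_measurable_scaleR) auto
  have A_meas: "A n \<in> borel_measurable (G n)" for n
    unfolding A_def by (rule borel_measurable_cond_exp)
  have e_meas: "e n \<in> borel_measurable (G n)" for n
    unfolding e_def[abs_def] w_def
    using A_meas[of n] \<zeta>(1)[of n] gx[of n] vec_cond_exp_measurable[of M "G n" "u n"] by measurable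
  have \<delta>_meas: "\<delta> n \<in> borel_measurable (G n)" for n
    unfolding \<delta>_def[abs_def] using e_meas[of n] by measurable
  have W_meas: "W n \<in> borel_measurable (G n)" for n
    unfolding W_def[abs_def] D_def r_def
    using gx[of n] y[of n] lip_meas[OF y[of n] prox_lipschitz[OF f \<gamma>_pos[of n]]] by measurable
  have V_meas: "V n \<in> borel_measurable (G n)" for n
    unfolding V_def[abs_def] using adapted[of n] by measurable
  have V_int: "integrable M (V n)" for n
    using L2_rv_diff[OF L2(1)[of n] L2_rv_const[of z]] by (simp add: V_def[abs_def] L2_rv_def)
  have V_step: "AE \<omega> in M. real_cond_exp M (G n) (V (Suc n)) \<omega> + W n \<omega> \<le> (1 + \<delta> n \<omega>) * V n \<omega>" for n
  proof -
    interpret S: prob_subalgebra M "G n" by unfold_locales (rule sub)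
    have e_parts: "0 \<le> lam n * sqrt \<bar>A n \<omega>\<bar>" "0 \<le> lam n * \<beta> n" "0 \<le> sqrt (lam n) * \<alpha> n" "0 \<le> sqrt (lam n * \<zeta> n \<omega>)"
      "0 \<le> sqrt (lam n) * norm (w n \<omega> - grad (x n \<omega>))" "(0::real) \<le> (1 / 2) ^ n" if "\<omega> \<in> space M" for \<omega>
      using lam(1)[of n] \<alpha>(1)[of n] \<beta>(1)[of n] \<zeta>(2)[OF that, of n] by auto
    have "AE \<omega> in M. real_cond_exp M (G n) (\<lambda>\<omega>. 1 + (norm (x (Suc n) \<omega> - z))\<^sup>2) \<omega>
        + lam n * (\<kappa> * (norm (grad (x n \<omega>) - grad z))\<^sup>2 + \<eta> * (norm (x n \<omega> - \<gamma> n *\<^sub>R grad (x n \<omega>)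
          - prox (\<gamma> n) f (x n \<omega> - \<gamma> n *\<^sub>R grad (x n \<omega>)) + \<gamma> n *\<^sub>R grad z))\<^sup>2 / 2)
      \<le> (1 + C * (e n \<omega> * (1 + e n \<omega>) ^ 3)) * (1 + (norm (x n \<omega> - z))\<^sup>2)"
      unfolding C_def
    proof (rule S.conditional_step_inequality[where u = "u n" and a = "a n" and \<tau> = "\<tau> n" and \<zeta> = "\<zeta> n"
          and \<alpha> = "\<alpha> n" and \<beta> = "\<beta> n", OF f \<theta> lip coco \<gamma>_pos \<gamma>_less z lam less_imp_le[OF \<eta>(1)] \<eta>(2) \<tau> \<alpha>(1) \<beta>(1)
          less_imp_le[OF \<kappa>_pos] \<kappa>_le L2 L2(1) adapted step S \<zeta>(2) e_meas e_pos])
      fix \<omega> assume \<omega>: "\<omega> \<in> space M"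
      note p = e_parts[OF \<omega>]
      show "sqrt (lam n) * norm (vec_cond_exp M (G n) (u n) \<omega> - grad (x n \<omega>)) \<le> e n \<omega>"
        "sqrt (lam n * \<zeta> n \<omega>) \<le> e n \<omega>" "sqrt (lam n) * \<alpha> n \<le> e n \<omega>" "lam n * \<beta> n \<le> e n \<omega>"
        unfolding w_def[symmetric] e_def using p by linarith+
      have "lam n * sqrt (A n \<omega>) \<le> lam n * sqrt \<bar>A n \<omega>\<bar>"
        using lam(1)[of n] by (intro mult_left_mono real_sqrt_le_mono) auto
      also have "\<dots> \<le> e n \<omega>" unfolding e_def using p by linarith
      finally show "lam n * sqrt (real_cond_exp M (G n) (\<lambda>\<omega>. (norm (a n \<omega>))\<^sup>2) \<omega>) \<le> e n \<omega>"
        by (simp add: A_def)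
    qed
    then show ?thesis by (simp add: V_def[abs_def] W_def D_def r_def \<delta>_def)
  qed
  have \<delta>_sum: "AE \<omega> in M. summable (\<lambda>n. \<delta> n \<omega>)"
  proof -
    have "AE \<omega> in M. \<forall>n. 0 \<le> A n \<omega>"
    proof (subst AE_all_countable, rule allI)
      fix n
      interpret S: prob_subalgebra M "G n" by unfold_locales (rule sub)
      show "AE \<omega> in M. 0 \<le> A n \<omega>"
        unfolding A_def using L2(3)[of n] by (intro S.real_cond_exp_pos) (auto simp: L2_rv_def)
    qed
    with hyp_a hyp_b \<zeta>(3) AE_space show ?thesis
    proof eventually_elim
      case (elim \<omega>)
      have "summable (\<lambda>n. lam n * sqrt \<bar>A n \<omega>\<bar>)"
        using elim by (simp add: A_def)
      moreover have "summable (\<lambda>n. (1 / 2 :: real) ^ n)" by (rule summable_geometric) simp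
      ultimately have sum_e: "summable (\<lambda>n. e n \<omega>)"
        unfolding e_def w_def using elim \<alpha>(2) \<beta>(2) by (intro summable_add)
      define B where "B = (\<Sum>n. e n \<omega>)"
      have e0: "0 \<le> e n \<omega>" for n using e_pos[of \<omega> n] elim by simp
      have eB: "e n \<omega> \<le> B" for n
        using sum_le_suminf[OF sum_e, of "{n}"] e0 by (simp add: B_def)
      have "norm (\<delta> n \<omega>) \<le> (C * (1 + B) ^ 3) * e n \<omega>" for n
      proof -
        have "e n \<omega> * (1 + e n \<omega>) ^ 3 \<le> e n \<omega> * (1 + B) ^ 3"
          using e0[of n] eB[of n] by (intro mult_left_mono power_mono) auto
        then have "C * (e n \<omega> * (1 + e n \<omega>) ^ 3) \<le> C * (e n \<omega> * (1 + B) ^ 3)"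
          using C by (rule mult_left_mono)
        then show ?thesis using C e0[of n] by (simp add: \<delta>_def mult_ac)
      qed
      then show ?case
        by (rule summable_comparison_test'[OF summable_mult[OF sum_e], of 0])
    qed
  qed
  have "AE \<omega> in M. convergent (\<lambda>n. V n \<omega>) \<and> summable (\<lambda>n. W n \<omega>)"
  proof (rule robbins_siegmund[where F = G and \<delta> = \<delta>, OF sub mono V_meas W_meas \<delta>_meas V_int _ _ _ V_step \<delta>_sum])
    fix n \<omega> assume "\<omega> \<in> space M"
    show "0 \<le> V n \<omega>" by (simp add: V_def)
    show "0 \<le> W n \<omega>" using lam(1)[of n] \<kappa>_pos \<eta> by (simp add: W_def D_def r_def)
    show "0 \<le> \<delta> n \<omega>" using C e_pos[OF \<open>\<omega> \<in> space M\<close>, of n] by (simp add: \<delta>_def)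
  qed
  then show ?thesis
  proof eventually_elim
    case (elim \<omega>)
    have "convergent (\<lambda>n. sqrt (V n \<omega> - 1))"
    proof -
      obtain L where "(\<lambda>n. V n \<omega>) \<longlonglongrightarrow> L" using elim by (auto simp: convergent_def)
      then have "(\<lambda>n. sqrt (V n \<omega> - 1)) \<longlonglongrightarrow> sqrt (L - 1)"
        by (intro tendsto_real_sqrt tendsto_diff tendsto_const)
      then show ?thesis by (rule convergentI)
    qed
    then have "convergent (\<lambda>n. norm (x n \<omega> - z))" by (simp add: V_def)
    moreover have pos: "0 \<le> lam n" "0 \<le> D n \<omega>" "0 \<le> r n \<omega>" for n
      using lam(1)[of n] by (simp_all add: D_def r_def)
    have "summable (\<lambda>n. lam n * D n \<omega>)"
    proof (rule summable_comparison_test'[OF summable_mult[of _ "1 / \<kappa>"]])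
      show "summable (\<lambda>n. W n \<omega>)" using elim by simp
      show "norm (lam n * D n \<omega>) \<le> 1 / \<kappa> * W n \<omega>" if "n \<ge> 0" for n
        using pos[of n] \<kappa>_pos \<eta> by (simp add: W_def field_simps)
    qed
    moreover have "summable (\<lambda>n. lam n * r n \<omega>)"
    proof (rule summable_comparison_test'[OF summable_mult[of _ "2 / \<eta>"]])
      show "summable (\<lambda>n. W n \<omega>)" using elim by simp
      show "norm (lam n * r n \<omega>) \<le> 2 / \<eta> * W n \<omega>" if "n \<ge> 0" for n
        using pos[of n] \<kappa>_pos \<eta> by (simp add: W_def field_simps)
    qed
    ultimately show ?case by (simp add: D_def r_def)
  qed
qed

theorem theorem2p1:
  fixes f :: "'h::euclidean_space \<Rightarrow> ereal"
    and g :: "'h \<Rightarrow> real" and grad_g :: "'h \<Rightarrow> 'h"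
    and \<theta> :: real and F :: "'h set"
    and M :: "'a measure" and \<X> :: "nat \<Rightarrow> 'a measure"
    and x u a :: "nat \<Rightarrow> 'a \<Rightarrow> 'h"
    and lam \<gamma> \<tau> :: "nat \<Rightarrow> real"
    and fn :: "nat \<Rightarrow> 'h \<Rightarrow> ereal"
  assumes f: "f \<in> Gamma0"
    and \<theta>: "\<theta> > 0"
    and g_convex: "convex_on UNIV g"
    and g_grad: "\<And>y. GDERIV g y :> grad_g y"
    and g_lipschitz: "(1 / \<theta>)-lipschitz_on UNIV grad_g"
    and F_def: "F = minimizers (\<lambda>y. f y + ereal (g y))"
    and F_nonempty: "F \<noteq> {}"
    and M: "prob_space M"
    and x0_L2: "x 0 \<in> L2_rv M"
    and u_L2: "\<And>n. u n \<in> L2_rv M"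
    and a_L2: "\<And>n. a n \<in> L2_rv M"
    and lam: "\<And>n. lam n \<in> {0<..1}"
    and \<gamma>: "\<And>n. \<gamma> n \<in> {0<..<2 * \<theta>}"
    and fn: "\<And>n. fn n \<in> Gamma0"
    and x_Suc: "\<And>n \<omega>. \<omega> \<in> space M \<Longrightarrow>
      x (Suc n) \<omega> = x n \<omega> + lam n *\<^sub>R (prox (\<gamma> n) (fn n) (x n \<omega> - \<gamma> n *\<^sub>R u n \<omega>) + a n \<omega> - x n \<omega>)"
    and \<tau>: "\<And>n. \<tau> n \<ge> 0"
    and \<X>_sub: "\<And>n. subalgebra M (\<X> n)"
    and \<X>_gen: "\<And>n. subalgebra (\<X> n) (sigma_upto M x n)"
    and \<X>_mono: "\<And>n. subalgebra (\<X> (Suc n)) (\<X> n)"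
    and hyp_a: "AE \<omega> in M. summable (\<lambda>n. lam n *
      sqrt (real_cond_exp M (\<X> n) (\<lambda>\<omega>. (norm (a n \<omega>))\<^sup>2) \<omega>))"
    and hyp_b: "AE \<omega> in M. summable (\<lambda>n. sqrt (lam n) *
      norm (vec_cond_exp M (\<X> n) (u n) \<omega> - grad_g (x n \<omega>)))"
    and hyp_c: "\<And>z. z \<in> F \<Longrightarrow> \<exists>\<zeta> \<in> ell_plus_infty M \<X>.
      (\<lambda>n \<omega>. lam n * \<zeta> n \<omega>) \<in> ell_plus_half M \<X> \<and>
      (\<forall>n. AE \<omega> in M.
        real_cond_exp M (\<X> n) (\<lambda>\<omega>. (norm (u n \<omega> - vec_cond_exp M (\<X> n) (u n) \<omega>))\<^sup>2) \<omega>
          \<le> \<tau> n * (norm (grad_g (x n \<omega>) - grad_g z))\<^sup>2 + \<zeta> n \<omega>)"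
    and hyp_d: "\<exists>\<alpha> \<beta> :: nat \<Rightarrow> real. (\<forall>n. \<alpha> n \<ge> 0) \<and> (\<forall>n. \<beta> n \<ge> 0) \<and>
      summable (\<lambda>n. sqrt (lam n) * \<alpha> n) \<and> summable (\<lambda>n. lam n * \<beta> n) \<and>
      (\<forall>n y. norm (prox (\<gamma> n) (fn n) y - prox (\<gamma> n) f y) \<le> \<alpha> n * norm y + \<beta> n)"
    and hyp_e: "(INF n. \<gamma> n) > 0" "bdd_above (range \<tau>)" "(SUP n. (1 + \<tau> n) * \<gamma> n) < 2 * \<theta>"
    and hyp_f: "(INF n. lam n) > 0 \<or>
      ((\<exists>c. \<forall>n. \<gamma> n = c) \<and> summable \<tau> \<and> \<not> summable lam)"
  shows "\<exists>x_lim. x_lim \<in> borel_measurable M \<and> (\<forall>\<omega>\<in>space M. x_lim \<omega> \<in> F) \<and>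
    (\<forall>z\<in>F.
      (AE \<omega> in M. summable (\<lambda>n. lam n * (norm (grad_g (x n \<omega>) - grad_g z))\<^sup>2)) \<and>
      (AE \<omega> in M. summable (\<lambda>n. lam n *
        (norm (x n \<omega> - \<gamma> n *\<^sub>R grad_g (x n \<omega>)
          - prox (\<gamma> n) f (x n \<omega> - \<gamma> n *\<^sub>R grad_g (x n \<omega>)) + \<gamma> n *\<^sub>R grad_g z))\<^sup>2)) \<and>
      (AE \<omega> in M. (\<lambda>n. x n \<omega>) \<longlonglongrightarrow> x_lim \<omega>))"
proof -
  interpret prob_space M by (rule M)
  obtain \<alpha> \<beta> where \<alpha>: "\<And>n. 0 \<le> \<alpha> n" "summable (\<lambda>n. sqrt (lam n) * \<alpha> n)"
    and \<beta>: "\<And>n. 0 \<le> \<beta> n" "summable (\<lambda>n. lam n * \<beta> n)"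
    and prox_close: "\<And>n y. norm (prox (\<gamma> n) (fn n) y - prox (\<gamma> n) f y) \<le> \<alpha> n * norm y + \<beta> n"
    using hyp_d by blast
  define c where "c = (INF n. \<gamma> n)"
  have \<gamma>_ge: "c \<le> \<gamma> n" for n
    unfolding c_def by (rule cINF_lower) (use \<gamma> in \<open>auto intro!: bdd_belowI[of _ 0] less_imp_le\<close>)
  have c: "0 < c" using hyp_e(1) by (simp add: c_def)
  have \<gamma>_pos: "0 < \<gamma> n" and \<gamma>_le: "\<gamma> n \<le> 2 * \<theta>" for n using \<gamma>[of n] by auto
  obtain T where T: "\<And>n. \<tau> n \<le> T" using hyp_e(2) by (auto simp: bdd_above_def)
  define \<mu> where "\<mu> = 2 * \<theta> - (SUP n. (1 + \<tau> n) * \<gamma> n)"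
  have \<mu>: "0 < \<mu>" using hyp_e(3) by (simp add: \<mu>_def)
  have \<mu>_le: "(1 + \<tau> n) * \<gamma> n \<le> 2 * \<theta> - \<mu>" for n
  proof -
    have "(1 + \<tau> k) * \<gamma> k \<le> (1 + T) * (2 * \<theta>)" for k
      using \<tau>[of k] T[of k] \<gamma>_pos[of k] \<gamma>_le[of k] by (intro mult_mono) auto
    then have "bdd_above (range (\<lambda>n. (1 + \<tau> n) * \<gamma> n))" by (auto intro!: bdd_aboveI)
    then show ?thesis unfolding \<mu>_def using cSUP_upper[of n UNIV "\<lambda>n. (1 + \<tau> n) * \<gamma> n"] by simp
  qed
  have lam_pos: "0 < lam n" and lam_le: "lam n \<le> 1" for n using lam[of n] by auto
  have lam_div: "\<not> summable lam"
  proof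
    assume "summable lam"
    then have "(INF n. lam n) > 0" using hyp_f by blast
    moreover have "(INF n. lam n) \<le> lam n" for n
      by (rule cINF_lower) (use lam_pos in \<open>auto intro!: bdd_belowI[of _ 0] less_imp_le\<close>)
    then have "(INF n. lam n) \<le> 0"
      by (intro LIMSEQ_le_const[OF summable_LIMSEQ_zero[OF \<open>summable lam\<close>]]) auto
    ultimately show False by simp
  qed
  have prop_f: "proper_fun f" and conv_f: "convex_fun f" using f by (auto simp: Gamma0_def)
  have coco: "\<theta> * (norm (grad_g y - grad_g y'))\<^sup>2 \<le> inner (y - y') (grad_g y - grad_g y')" for y y'
    using baillon_haddad[OF \<theta> g_convex g_grad g_lipschitz] .
  have fixed_point: "prox (\<gamma> n) f (z - \<gamma> n *\<^sub>R grad_g z) = z" if "z \<in> F" for z n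
  proof -
    have "subgradient f z (- grad_g z)"
      using that minimizers_iff_subgradient[OF prop_f conv_f g_convex g_grad] by (simp add: F_def)
    from prox_eqI_subgradient[OF f \<gamma>_pos[of n] this] show ?thesis by simp
  qed
  \<comment> \<open>Proximity operators are nonexpansive and hence preserve square integrability.\<close>
  have x_L2: "x n \<in> L2_rv M" for n
  proof (induction n)
    case (Suc n)
    have "(\<lambda>\<omega>. x n \<omega> + lam n *\<^sub>R (prox (\<gamma> n) (fn n) (x n \<omega> - \<gamma> n *\<^sub>R u n \<omega>) + a n \<omega> - x n \<omega>)) \<in> L2_rv M"
      by (intro L2_rv_add L2_rv_scaleR L2_rv_diff L2_rv_lipschitz_image[OF _ prox_lipschitz[OF fn \<gamma>_pos]] Suc u_L2 a_L2)
    then show ?case by (subst L2_rv_cong[OF x_Suc])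
  qed (rule x0_L2)
  have x_meas: "x n \<in> borel_measurable M" for n using x_L2[of n] by (simp add: L2_rv_def)
  have adapted: "x n \<in> borel_measurable (\<X> n)" for n
    by (rule measurable_from_subalg[OF \<X>_gen sigma_upto_measurable[OF x_meas]])
  have fejer: "AE \<omega> in M. convergent (\<lambda>n. norm (x n \<omega> - z))
    \<and> summable (\<lambda>n. lam n * (norm (grad_g (x n \<omega>) - grad_g z))\<^sup>2)
    \<and> summable (\<lambda>n. lam n * (norm (x n \<omega> - \<gamma> n *\<^sub>R grad_g (x n \<omega>)
        - prox (\<gamma> n) f (x n \<omega> - \<gamma> n *\<^sub>R grad_g (x n \<omega>)) + \<gamma> n *\<^sub>R grad_g z))\<^sup>2)" if z: "z \<in> F" for z
  proof -
    obtain \<zeta> where \<zeta>: "\<zeta> \<in> ell_plus_infty M \<X>" "(\<lambda>n \<omega>. lam n * \<zeta> n \<omega>) \<in> ell_plus_half M \<X>"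
      and S: "\<And>n. AE \<omega> in M. real_cond_exp M (\<X> n) (\<lambda>\<omega>. (norm (u n \<omega> - vec_cond_exp M (\<X> n) (u n) \<omega>))\<^sup>2) \<omega>
          \<le> \<tau> n * (norm (grad_g (x n \<omega>) - grad_g z))\<^sup>2 + \<zeta> n \<omega>"
      using hyp_c[OF z] by blast
    have \<zeta>': "\<And>n. \<zeta> n \<in> borel_measurable (\<X> n)" "\<And>n \<omega>. \<omega> \<in> space M \<Longrightarrow> 0 \<le> \<zeta> n \<omega>"
      "AE \<omega> in M. summable (\<lambda>n. sqrt (lam n * \<zeta> n \<omega>))"
      using \<zeta> by (auto simp: ell_plus_infty_def ell_plus_half_def ell_plus_def)
    show ?thesis
    proof (rule stochastic_forward_backward_fejer[where f = f and \<gamma> = \<gamma> and u = u and a = a and G = \<X>,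
          OF f \<theta> g_lipschitz coco fixed_point[OF z] c \<gamma>_ge \<mu> \<mu>_le \<tau> T lam_pos lam_le \<alpha> \<beta>
          \<X>_sub \<X>_mono x_L2 u_L2 a_L2 adapted _ hyp_a hyp_b \<zeta>' S])
      fix n \<omega> assume "\<omega> \<in> space M"
      then show "\<exists>t. x (Suc n) \<omega> = x n \<omega> + lam n *\<^sub>R (t + a n \<omega> - x n \<omega>)
          \<and> norm (t - prox (\<gamma> n) f (x n \<omega> - \<gamma> n *\<^sub>R u n \<omega>)) \<le> \<alpha> n * norm (x n \<omega> - \<gamma> n *\<^sub>R u n \<omega>) + \<beta> n"
        using x_Suc prox_close by blast
    qed
  qed
  obtain D where D: "countable D" "D \<subseteq> F" "F \<subseteq> closure D" by (rule separable)
  have D_ne: "D \<noteq> {}" using D F_nonempty by auto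
  obtain z0 where z0: "z0 \<in> F" using F_nonempty by blast
  have "AE \<omega> in M. \<forall>d\<in>D. convergent (\<lambda>n. norm (x n \<omega> - d))"
    using fejer D(2) by (subst AE_ball_countable[OF D(1)]) (auto elim: eventually_mono)
  with fejer[OF z0] have conv: "AE \<omega> in M. \<exists>y\<in>F. (\<lambda>n. x n \<omega>) \<longlonglongrightarrow> y"
  proof eventually_elim
    case (elim \<omega>)
    show ?case
      unfolding F_def
      by (rule forward_backward_pathwise_convergence[where \<gamma> = \<gamma> and l = lam and z = z0 and D = D,
            OF f g_convex g_grad lipschitz_on_continuous_on[OF g_lipschitz] c \<gamma>_ge \<gamma>_le less_imp_le[OF lam_pos] lam_div])
        (use elim D(3) D_ne in \<open>auto simp: F_def\<close>)
  qed
  then obtain N where N: "{\<omega> \<in> space M. \<not> (\<exists>y\<in>F. (\<lambda>n. x n \<omega>) \<longlonglongrightarrow> y)} \<subseteq> N" "N \<in> null_sets M"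
    by (auto simp: eventually_ae_filter)
  \<comment> \<open>The limit must lie in \<open>F\<close> on the exceptional null set too.\<close>
  define x_lim where "x_lim \<omega> = (if \<omega> \<in> N then z0 else lim (\<lambda>n. x n \<omega>))" for \<omega>
  have lim: "(\<lambda>n. x n \<omega>) \<longlonglongrightarrow> x_lim \<omega> \<and> x_lim \<omega> \<in> F" if "\<omega> \<in> space M" "\<omega> \<notin> N" for \<omega>
    using that N(1) by (auto simp: x_lim_def limI)
  have "x_lim \<in> borel_measurable M"
  proof -
    have "N \<inter> space M \<in> sets M" using N(2) by (auto simp: null_sets_def)
    moreover have "(\<lambda>\<omega>. lim (\<lambda>n. x n \<omega>)) \<in> borel_measurable M" by (rule borel_measurable_lim_metric[OF x_meas])
    ultimately show ?thesis
      unfolding x_lim_def[abs_def] by (intro measurable_If_set) auto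
  qed
  moreover have "\<forall>\<omega>\<in>space M. x_lim \<omega> \<in> F"
    using lim z0 by (auto simp: x_lim_def)
  moreover have "AE \<omega> in M. (\<lambda>n. x n \<omega>) \<longlonglongrightarrow> x_lim \<omega>"
    using AE_not_in[OF N(2)] AE_space by eventually_elim (use lim in blast)
  moreover have "AE \<omega> in M. summable (\<lambda>n. lam n * (norm (grad_g (x n \<omega>) - grad_g z))\<^sup>2)"
    "AE \<omega> in M. summable (\<lambda>n. lam n * (norm (x n \<omega> - \<gamma> n *\<^sub>R grad_g (x n \<omega>)
          - prox (\<gamma> n) f (x n \<omega> - \<gamma> n *\<^sub>R grad_g (x n \<omega>)) + \<gamma> n *\<^sub>R grad_g z))\<^sup>2)" if "z \<in> F" for z
    using fejer[OF that] by (auto elim: eventually_mono)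
  ultimately show ?thesis by blast
qed

end
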